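(* Let $\mathcal A\in\{\mathcal P,\mathcal B,\mathcal H,\mathcal Bs\}$ and let $(A,(m_p)_{p\in\mathcal A})$ be an $\mathcal A$-tracial algebra endowed with a transpose operation $a\mapsto {}^ta$. For any $A_1,A_2\subset A$ such that $A_1\cup A_2$ is $U$-invariant and deterministic, $A_1$ and ${}^tA_2=\{{}^ta: a\in A_2\}$ are free in the sense of Voiculescu (for the linear form $m_{\mathrm{id}_1}$).
   Context: Partitions. For $k\ge 0$, $\mathcal P_k$ is the set of partitions of $\{1,\dots,k,1',\dots,k'\}$. A partition is drawn as a diagram with a top row $1,\dots,k$ and a bottom row $1',\dots,k'$. $\mathrm{nc}(p)$ is the number of blocks of $p$; $p\vee p'$ is the finest partition coarser than both; $\mathrm{id}_k=\{\{i,i'\}:1\le i\le k\}$. A permutation $\sigma\in\mathfrak S_k$ is identified with $\{\{i,\sigma(i)'\}\}\in\mathcal P_k$. $\mathcal B_k$, $\mathcal H_k$, $\mathcal Bs_k$ are the sets of $p\in\mathcal P_k$ whose blocks all have size $2$, all have even size, all have size at most $2$ respectively; $\mathcal P=\bigcup_k\mathcal P_k$, $\mathfrak S=\bigcup_k\mathfrak S_k$, etc. (each of the sets $\mathcal A$ contains $\mathfrak S$). $p\circ p'$ is obtained by putting $p'$ above $p$, identifying the bottom row of $p'$ with the top row of $p$, then erasing the middle row and keeping connections. $p\otimes p'$ is obtained by putting $p'$ to the right of $p$. Set $d(p,p')=\frac{\mathrm{nc}(p)+\mathrm{nc}(p')}{2}-\mathrm{nc}(p\vee p')$ and $p\le p'$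 if $d(\mathrm{id}_k,p)+d(p,p')=d(\mathrm{id}_k,p')$ (a partial order). $\mathcal A$-tracial algebra. For $p\in\mathcal P_k$, $l\ge k$ and $1\le i_1<\dots<i_k\le l$, $\mathrm{Ins}^l_{(i_1,\dots,i_k)}(p)\in\mathcal P_l$ is obtained by relabelling $j\mapsto i_j$, $j'\mapsto i_j'$ in $p$ and adding the blocks $\{i,i'\}$ for $i\notin\{i_1,\dots,i_k\}$. An $\mathcal A$-tracial algebra $(A,(m_p)_{p\in\mathcal A})$ is a (complex) algebra $A$ with $k$-linear forms $m_p:A^k\to\mathbb C$ for $p\in\mathcal A_k$ ($m_\emptyset=1$) such that (1) $m_p(a_1,\dots,a_k)=m_{\sigma\circ p\circ\sigma^{-1}}(a_{\sigma^{-1}(1)},\dots,a_{\sigma^{-1}(k)})$ for all $\sigma\in\mathfrak S_k$; (2) $m_p\big(\prod_{i=1}^{n_1}a^{(1)}_i,\dots,\prod_{i=1}^{n_k}a_i^{(k)}\big)=m_{\mathrm{Ins}^{n}_{\mathbf i}(p)\circ\sigma}(a^{(1)}_1,\dots,a^{(1)}_{n_1},\dots,a^{(k)}_1,\dots,a^{(k)}_{n_k})$, with $n=\sum_j n_j$, $\mathbf i=(1,1+n_1,\dots,1+n_1+\dots+n_{k-1})$ and $\sigma=(1,\dots,n_1)(n_1+1,\dots,n_1+n_2)\cdots(n_1+\dots+n_{k-1}+1,\dots,n)$. A family of elements is deterministic if on the algebra it generates $m_{p_1\otimes p_2}(a_1,\dots,a_{k_1+k_2})=m_{p_1}(a_1,\dots,a_{k_1})m_{p_2}(a_{k_1+1},\dots,a_{k_1+k_2})$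 for all $p_1\in\mathcal A_{k_1},p_2\in\mathcal A_{k_2}$. For $\mathcal C\in\{\mathcal A,\mathfrak S\}$ the $\mathcal C$-cumulants $(\kappa^{\mathcal C}_p)_{p\in\mathcal C}$ are the unique multilinear forms with $m_p=\sum_{p'\in\mathcal C_k,\,p'\le p}\kappa^{\mathcal C}_{p'}$ for all $k$, $p\in\mathcal C_k$. A family $F\subset A$ is $U$-invariant if for all $k$, $p\in\mathcal A_k$ and $(a_1,\dots,a_k)\in F^k$, $\kappa^{\mathcal A}_p(a_1,\dots,a_k)$ equals $\kappa_p^{\mathfrak S}(a_1,\dots,a_k)$ if $p\in\mathfrak S_k$ and $0$ otherwise. Transpose operation. For $k_1<k$ and $p\in\mathcal P_k$, $\mathsf S_{k_1}(p)$ is obtained from $p$ by exchanging $i$ and $i'$ for every $i\in\{k_1+1,\dots,k\}$ ($\mathcal A_k$ is stable under this for the $\mathcal A$ considered). A transpose operation is a linear map $a\mapsto{}^ta$ on $A$ such that for all integers $k_1<k$, $p\in\mathcal A_k$ and $(a_1,\dots,a_k)\in A^k$: $m_p(a_1,\dots,a_{k_1},{}^ta_{k_1+1},\dots,{}^ta_k)=m_{\mathsf S_{k_1}(p)}(a_1,\dots,a_k)$. Freeness in the sense of Voiculescu for a linear form $\phi$ is the usual notion of free probability for the generated algebras: $\phi$ vanishes on alternating products $a_1b_1\cdots a_kb_k$ and $a_1b_1\cdots a_k$ of elements taken alternately in the two algebras and centered for $\phi$. *)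

theory Defs
  imports Complex_Main "HOL-Library.Disjoint_Sets" "HOL-Combinatorics.Cycles"
begin

section \<open>Partitions\<close>

text \<open>Columns are numbered from 0. The point \<open>(0, i)\<close> is the (i+1)-st point of the top row and
  \<open>(1, i)\<close> is the (i+1)-st point of the bottom row; row 2 occurs only in intermediate three-row
  diagrams. A partition is its set of blocks. Since \<open>k\<close> can be read off from the union of the blocks,
  the sets \<open>all_parts k\<close> are pairwise disjoint, and \<open>m p\<close> needs no extra argument \<open>k\<close> below.\<close>

type_synonym point = "nat \<times> nat"
type_synonym part = "point set set"

definition points :: "nat \<Rightarrow> point set" where
  "points k = {0, 1} \<times> {..<k}"

definition all_parts :: "nat \<Rightarrow> part set" where
  "all_parts k = {p. partition_on (points k) p}"

definition pair_parts :: "nat \<Rightarrow> part set" where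
  "pair_parts k = {p \<in> all_parts k. \<forall>b\<in>p. card b = 2}"

definition even_parts :: "nat \<Rightarrow> part set" where
  "even_parts k = {p \<in> all_parts k. \<forall>b\<in>p. even (card b)}"

definition short_parts :: "nat \<Rightarrow> part set" where
  "short_parts k = {p \<in> all_parts k. \<forall>b\<in>p. card b \<le> 2}"

definition perm_part :: "nat \<Rightarrow> (nat \<Rightarrow> nat) \<Rightarrow> part" where
  "perm_part k \<sigma> = (\<lambda>i. {(0, i), (1, \<sigma> i)}) ` {..<k}"

definition perm_parts :: "nat \<Rightarrow> part set" where
  "perm_parts k = {perm_part k \<sigma> |\<sigma>. \<sigma> permutes {..<k}}"

definition id_part :: "nat \<Rightarrow> part" where
  "id_part k = perm_part k id"

definition relabel :: "(point \<Rightarrow> point) \<Rightarrow> part \<Rightarrow> part" where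
  "relabel f p = image f ` p"

definition same_block :: "part \<Rightarrow> (point \<times> point) set" where
  "same_block p = {(x, y). \<exists>b\<in>p. x \<in> b \<and> y \<in> b}"

text \<open>The arguments of \<open>part_join\<close> may have different ground sets: \<open>part_comp\<close> applies it to two
  diagrams that share only the middle row. On a common ground set it is the finest
  partition coarser than both, see \<open>part_join_is_join\<close>.\<close>

definition part_join :: "part \<Rightarrow> part \<Rightarrow> part" where
  "part_join p q = (\<Union>p \<union> \<Union>q) // (same_block p \<union> same_block q)\<^sup>*"

text \<open>\<open>part_comp p q\<close> has \<open>q\<close> on rows 0, 1 and \<open>p\<close> on rows 1, 2. The blocks lying inside
  the middle row become empty and are removed.\<close>

definition erase_middle :: "point set \<Rightarrow> point set" where
  "erase_middle b = {(0, i) |i. (0, i) \<in> b} \<union> {(1, i) |i. (2, i) \<in> b}"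

definition part_comp :: "part \<Rightarrow> part \<Rightarrow> part" where
  "part_comp p q = erase_middle ` part_join q (relabel (\<lambda>(r, i). (r + 1, i)) p) - {{}}"

text \<open>In \<open>part_tensor k p q\<close>, the number \<open>k\<close> is the number of columns of the left factor \<open>p\<close>.\<close>

definition part_tensor :: "nat \<Rightarrow> part \<Rightarrow> part \<Rightarrow> part" where
  "part_tensor k p q = p \<union> relabel (\<lambda>(r, i). (r, k + i)) q"

definition part_ins :: "nat \<Rightarrow> nat list \<Rightarrow> part \<Rightarrow> part" where
  "part_ins l is p = relabel (\<lambda>(r, j). (r, is ! j)) p \<union> {{(0, i), (1, i)} |i. i < l \<and> i \<notin> set is}"

definition part_transpose :: "nat \<Rightarrow> part \<Rightarrow> part" where
  "part_transpose k1 p = relabel (\<lambda>(r, i). if k1 \<le> i then (1 - r, i) else (r, i)) p"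

definition part_dist :: "part \<Rightarrow> part \<Rightarrow> real" where
  "part_dist p q = (real (card p) + real (card q)) / 2 - real (card (part_join p q))"

definition part_le :: "nat \<Rightarrow> part \<Rightarrow> part \<Rightarrow> bool" where
  "part_le k p q \<longleftrightarrow> part_dist (id_part k) p + part_dist p q = part_dist (id_part k) q"


section \<open>Tracial algebras\<close>

locale complex_algebra = vector_space scale
  for scale :: "complex \<Rightarrow> 'a::ring \<Rightarrow> 'a" +
  assumes scale_mult_left: "scale c (x * y) = scale c x * y"
    and scale_mult_right: "scale c (x * y) = x * scale c y"

definition multilinear_form :: "(complex \<Rightarrow> 'a::ring \<Rightarrow> 'a) \<Rightarrow> nat \<Rightarrow> ('a list \<Rightarrow> complex) \<Rightarrow> bool" where
  "multilinear_form scale k f \<longleftrightarrow>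
    (\<forall>as i. length as = k \<and> i < k \<longrightarrow> Vector_Spaces.linear scale (*) (\<lambda>x. f (as[i := x])))"

text \<open>The algebra need not have a unit, so only nonempty words have a product.\<close>

fun word_prod :: "'a::semigroup_mult list \<Rightarrow> 'a" where
  "word_prod [a] = a"
| "word_prod (a # b # w) = a * word_prod (b # w)"

text \<open>For word lengths \<open>ns\<close>, \<open>word_start ns j\<close> is the position of the first letter of the j-th word
  in the concatenation; \<open>word_cycles ns\<close> cyclically permutes the positions of each word.\<close>

definition word_start :: "nat list \<Rightarrow> nat \<Rightarrow> nat" where
  "word_start ns j = sum_list (take j ns)"

definition word_cycles :: "nat list \<Rightarrow> nat \<Rightarrow> nat" where
  "word_cycles ns =
    foldr (\<lambda>j f. cycle_of_list [word_start ns j..<word_start ns (Suc j)] \<circ> f) [0..<length ns] id"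

locale tracial_algebra = complex_algebra scale
  for scale :: "complex \<Rightarrow> 'a::ring \<Rightarrow> 'a" +
  fixes \<A> :: "nat \<Rightarrow> part set"
    and m :: "part \<Rightarrow> 'a list \<Rightarrow> complex"
  assumes multilinear: "p \<in> \<A> k \<Longrightarrow> multilinear_form scale k (m p)"
    and m_empty: "m {} [] = 1"
    and equivariant:
      "p \<in> \<A> k \<Longrightarrow> \<sigma> permutes {..<k} \<Longrightarrow> length as = k \<Longrightarrow>
        m p as = m (part_comp (perm_part k \<sigma>) (part_comp p (perm_part k (inv \<sigma>))))
          (map (\<lambda>i. as ! inv \<sigma> i) [0..<k])"
    and product:
      "p \<in> \<A> k \<Longrightarrow> length ws = k \<Longrightarrow> [] \<notin> set ws \<Longrightarrow> ns = map length ws \<Longrightarrow> n = sum_list ns \<Longrightarrow>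
        m p (map word_prod ws) =
        m (part_comp (part_ins n (map (word_start ns) [0..<k]) p) (perm_part n (word_cycles ns)))
          (concat ws)"

inductive_set generated_algebra :: "(complex \<Rightarrow> 'a::ring \<Rightarrow> 'a) \<Rightarrow> 'a set \<Rightarrow> 'a set"
  for scale :: "complex \<Rightarrow> 'a::ring \<Rightarrow> 'a" and F :: "'a set" where
  base: "a \<in> F \<Longrightarrow> a \<in> generated_algebra scale F"
| zero: "0 \<in> generated_algebra scale F"
| add: "a \<in> generated_algebra scale F \<Longrightarrow> b \<in> generated_algebra scale F \<Longrightarrow>
    a + b \<in> generated_algebra scale F"
| scale: "a \<in> generated_algebra scale F \<Longrightarrow> scale c a \<in> generated_algebra scale F"
| mult: "a \<in> generated_algebra scale F \<Longrightarrow> b \<in> generated_algebra scale F \<Longrightarrow>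
    a * b \<in> generated_algebra scale F"

definition deterministic ::
  "(complex \<Rightarrow> 'a::ring \<Rightarrow> 'a) \<Rightarrow> (nat \<Rightarrow> part set) \<Rightarrow> (part \<Rightarrow> 'a list \<Rightarrow> complex) \<Rightarrow> 'a set \<Rightarrow> bool" where
  "deterministic scale \<A> m F \<longleftrightarrow>
    (\<forall>k1 k2. \<forall>p1\<in>\<A> k1. \<forall>p2\<in>\<A> k2. \<forall>as bs.
      length as = k1 \<and> length bs = k2 \<and> set (as @ bs) \<subseteq> generated_algebra scale F \<longrightarrow>
      m (part_tensor k1 p1 p2) (as @ bs) = m p1 as * m p2 bs)"

text \<open>The cumulants exist and are unique, see \<open>cumulants_exist\<close> and \<open>cumulants_unique\<close>.\<close>

definition cumulants ::
  "(complex \<Rightarrow> 'a::ring \<Rightarrow> 'a) \<Rightarrow> (nat \<Rightarrow> part set) \<Rightarrow> (part \<Rightarrow> 'a list \<Rightarrow> complex) \<Rightarrow>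
    (part \<Rightarrow> 'a list \<Rightarrow> complex) \<Rightarrow> bool" where
  "cumulants scale \<C> m \<kappa> \<longleftrightarrow>
    (\<forall>k. \<forall>p\<in>\<C> k. multilinear_form scale k (\<kappa> p) \<and>
      (\<forall>as. length as = k \<longrightarrow> m p as = (\<Sum>q\<in>{q \<in> \<C> k. part_le k q p}. \<kappa> q as)))"

definition U_invariant ::
  "(complex \<Rightarrow> 'a::ring \<Rightarrow> 'a) \<Rightarrow> (nat \<Rightarrow> part set) \<Rightarrow> (part \<Rightarrow> 'a list \<Rightarrow> complex) \<Rightarrow> 'a set \<Rightarrow> bool" where
  "U_invariant scale \<A> m F \<longleftrightarrow>
    (\<exists>\<kappa>\<^sub>A \<kappa>\<^sub>S. cumulants scale \<A> m \<kappa>\<^sub>A \<and> cumulants scale perm_parts m \<kappa>\<^sub>S \<and>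
      (\<forall>k. \<forall>p\<in>\<A> k. \<forall>as. length as = k \<and> set as \<subseteq> F \<longrightarrow>
        \<kappa>\<^sub>A p as = (if p \<in> perm_parts k then \<kappa>\<^sub>S p as else 0)))"

definition transpose_operation ::
  "(complex \<Rightarrow> 'a::ring \<Rightarrow> 'a) \<Rightarrow> (nat \<Rightarrow> part set) \<Rightarrow> (part \<Rightarrow> 'a list \<Rightarrow> complex) \<Rightarrow> ('a \<Rightarrow> 'a) \<Rightarrow> bool" where
  "transpose_operation scale \<A> m t \<longleftrightarrow>
    Vector_Spaces.linear scale scale t \<and>
    (\<forall>k1 k. k1 < k \<longrightarrow> (\<forall>p\<in>\<A> k. \<forall>as. length as = k \<longrightarrow>
      m p (take k1 as @ map t (drop k1 as)) = m (part_transpose k1 p) as))"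


section \<open>Freeness\<close>

definition alternating :: "'b set \<Rightarrow> 'b set \<Rightarrow> 'b list \<Rightarrow> bool" where
  "alternating B1 B2 xs \<longleftrightarrow>
    (\<forall>i<length xs. xs ! i \<in> (if even i then B1 else B2)) \<or>
    (\<forall>i<length xs. xs ! i \<in> (if even i then B2 else B1))"

text \<open>Freeness refers to unital algebras and to a form mapping 1 to 1, whereas the algebra here need
  not have a unit. It is therefore expressed in the unitization \<open>\<complex> \<oplus> A\<close>, whose elements \<open>(c, a)\<close>
  stand for \<open>c 1 + a\<close>, with \<open>\<phi>\<close> extended by \<open>\<phi>(1) = 1\<close>. For a unital algebra with \<open>\<phi> 1 = 1\<close> this is
  the usual definition (\<open>voiculescu_free_unital\<close>), and in any algebra it implies the vanishing of
  \<open>\<phi>\<close> on alternating products of centered elements of the generated (not necessarily unital) algebras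
  (\<open>voiculescu_free_nonunital\<close>).\<close>

definition unitization_mult ::
  "(complex \<Rightarrow> 'a::ring \<Rightarrow> 'a) \<Rightarrow> complex \<times> 'a \<Rightarrow> complex \<times> 'a \<Rightarrow> complex \<times> 'a" where
  "unitization_mult scale x y =
    (fst x * fst y, scale (fst x) (snd y) + scale (fst y) (snd x) + snd x * snd y)"

definition unitization_form :: "('a::ring \<Rightarrow> complex) \<Rightarrow> complex \<times> 'a \<Rightarrow> complex" where
  "unitization_form \<phi> x = fst x + \<phi> (snd x)"

definition voiculescu_free ::
  "(complex \<Rightarrow> 'a::ring \<Rightarrow> 'a) \<Rightarrow> ('a \<Rightarrow> complex) \<Rightarrow> 'a set \<Rightarrow> 'a set \<Rightarrow> bool" where
  "voiculescu_free scale \<phi> F1 F2 \<longleftrightarrow>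
    (\<forall>xs. xs \<noteq> [] \<and>
      alternating (UNIV \<times> generated_algebra scale F1) (UNIV \<times> generated_algebra scale F2) xs \<and>
      (\<forall>x\<in>set xs. unitization_form \<phi> x = 0) \<longrightarrow>
      unitization_form \<phi> (foldr (unitization_mult scale) xs (1, 0)) = 0)"


section \<open>The definitions above have their intended meaning\<close>

lemma equiv_rtrancl_same_block:
  assumes "partition_on A p" "partition_on A q"
  shows "equiv A ((same_block p \<union> same_block q)\<^sup>* \<inter> A \<times> A)"
proof (rule equivI)
  show "refl_on A ((same_block p \<union> same_block q)\<^sup>* \<inter> A \<times> A)" by (auto simp: refl_on_def)
  have "sym (same_block p \<union> same_block q)" by (auto simp: sym_def same_block_def)
  then have "sym ((same_block p \<union> same_block q)\<^sup>*)" by (rule sym_rtrancl)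
  then show "sym ((same_block p \<union> same_block q)\<^sup>* \<inter> A \<times> A)"
    by (simp add: sym_def)
  show "trans ((same_block p \<union> same_block q)\<^sup>* \<inter> A \<times> A)"
    by (rule transI) (blast intro: rtrancl_trans)
qed auto

lemma part_join_eq_quotient:
  assumes "partition_on A p" "partition_on A q"
  shows "part_join p q = A // ((same_block p \<union> same_block q)\<^sup>* \<inter> A \<times> A)"
proof -
  have A: "\<Union>p = A" "\<Union>q = A" using assms by (auto simp: partition_on_def)
  have "y \<in> A" if "(x, y) \<in> (same_block p \<union> same_block q)\<^sup>*" "x \<in> A" for x y
    using that by induction (use A in \<open>auto simp: same_block_def\<close>)
  then show ?thesis unfolding part_join_def A quotient_def by auto
qed

theorem part_join_is_join:
  assumes p: "partition_on A p" and q: "partition_on A q"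
  shows "refines A p (part_join p q)" "refines A q (part_join p q)"
    and "refines A p r \<Longrightarrow> refines A q r \<Longrightarrow> refines A (part_join p q) r"
proof -
  let ?R = "(same_block p \<union> same_block q)\<^sup>* \<inter> A \<times> A"
  note eq = part_join_eq_quotient[OF assms]
  have part: "partition_on A (part_join p q)"
    unfolding eq using equiv_rtrancl_same_block[OF assms] by (rule partition_on_quotient)
  have sub: "\<exists>Y\<in>part_join p q. X \<subseteq> Y" if X: "X \<in> p \<or> X \<in> q" for X
  proof -
    have "X \<noteq> {}" "X \<subseteq> A" using X p q by (auto simp: partition_on_def)
    then obtain x where x: "x \<in> X" "x \<in> A" by blast
    have "X \<subseteq> ?R `` {x}"
      using X x \<open>X \<subseteq> A\<close> by (auto simp: same_block_def)
    moreover have "?R `` {x} \<in> part_join p q" unfolding eq by (rule quotientI) (rule x)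
    ultimately show ?thesis by blast
  qed
  show "refines A p (part_join p q)" "refines A q (part_join p q)"
    unfolding refines_def using p q part sub by auto
  assume pr: "refines A p r" and qr: "refines A q r"
  have r: "partition_on A r" using pr by (simp add: refines_def)
  have "\<exists>Z\<in>r. Y \<subseteq> Z" if Y: "Y \<in> part_join p q" for Y
  proof -
    obtain x where x: "x \<in> A" "Y = ?R `` {x}" using Y unfolding eq by (rule quotientE) auto
    obtain Z where Z: "Z \<in> r" "x \<in> Z" using x r by (auto simp: partition_on_def)
    have "y \<in> Z" if "(x, y) \<in> (same_block p \<union> same_block q)\<^sup>*" for y
      using that
    proof induction
      case (step y z)
      then obtain b where b: "b \<in> p \<or> b \<in> q" "y \<in> b" "z \<in> b" by (auto simp: same_block_def)
      then obtain Z' where Z': "Z' \<in> r" "b \<subseteq> Z'" using pr qr unfolding refines_def by blast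
      then have "Z' = Z" using step.IH b Z r unfolding partition_on_def disjoint_def by blast
      then show ?case using Z' b by blast
    qed (rule Z)
    then show ?thesis using Z x by blast
  qed
  then show "refines A (part_join p q) r" using part r by (simp add: refines_def)
qed

theorem part_comp_perm_part:
  assumes \<sigma>: "\<sigma> permutes {..<k}" and \<tau>: "\<tau> permutes {..<k}"
  shows "part_comp (perm_part k \<sigma>) (perm_part k \<tau>) = perm_part k (\<sigma> \<circ> \<tau>)"
proof -
  let ?p = "relabel (\<lambda>(r, i). (r + 1, i)) (perm_part k \<sigma>)" and ?q = "perm_part k \<tau>"
  let ?R = "same_block ?q \<union> same_block ?p"
  define B :: "nat \<Rightarrow> point set" where "B i = {(0, i), (1, \<tau> i), (2, \<sigma> (\<tau> i))}" for i
  have \<tau>k: "\<tau> i < k" if "i < k" for i using permutes_in_image[OF \<tau>, of i] that by simp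
  have inj: "\<tau> i = \<tau> j \<longleftrightarrow> i = j" "\<sigma> i = \<sigma> j \<longleftrightarrow> i = j" for i j
    using permutes_inj[OF \<sigma>] permutes_inj[OF \<tau>] by (auto dest: injD)
  have surj: "\<exists>i<k. j = \<tau> i" if "j < k" for j
    using permutes_image[OF \<tau>] that by (metis imageE lessThan_iff)
  have p: "?p = (\<lambda>i. {(1, \<tau> i), (2, \<sigma> (\<tau> i))}) ` {..<k}"
  proof -
    have "?p = (\<lambda>j. {(1, j), (2, \<sigma> j)}) ` \<tau> ` {..<k}"
      unfolding permutes_image[OF \<tau>] by (simp add: relabel_def perm_part_def image_image numeral_2_eq_2)
    then show ?thesis by (simp add: image_image)
  qed
  have q: "?q = (\<lambda>i. {(0, i), (1, \<tau> i)}) ` {..<k}" by (simp add: perm_part_def)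
  have step: "z \<in> B i" if "y \<in> B i" "(y, z) \<in> ?R" for y z i
    using that unfolding p q by (auto simp: same_block_def B_def inj)
  have "z \<in> B i" if "(y, z) \<in> ?R\<^sup>*" "y \<in> B i" for y z i
    using that by induction (auto dest: step)
  moreover have "(y, z) \<in> ?R\<^sup>*" if "y \<in> B i" "z \<in> B i" "i < k" for y z i
  proof -
    have "(u, (1, \<tau> i)) \<in> ?R \<and> ((1, \<tau> i), u) \<in> ?R" if "u \<in> B i" for u
      using that \<open>i < k\<close> unfolding p q by (auto simp: same_block_def B_def)
    then show ?thesis using that by (meson converse_rtrancl_into_rtrancl r_into_rtrancl)
  qed
  ultimately have cls: "?R\<^sup>* `` {y} = B i" if "y \<in> B i" "i < k" for y i using that by blast
  have U: "\<Union>?q \<union> \<Union>?p = (\<Union>i<k. B i)" unfolding p q by (auto simp: B_def)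
  have "part_join ?q ?p = B ` {..<k}"
  proof (rule set_eqI)
    fix X
    have "X \<in> part_join ?q ?p \<longleftrightarrow> (\<exists>i<k. \<exists>y\<in>B i. X = ?R\<^sup>* `` {y})"
      unfolding part_join_def U quotient_def by auto
    also have "\<dots> \<longleftrightarrow> (\<exists>i<k. X = B i)"
      using cls by (metis B_def insertI1)
    finally show "X \<in> part_join ?q ?p \<longleftrightarrow> X \<in> B ` {..<k}" by auto
  qed
  moreover have "erase_middle (B i) = {(0, i), (1, \<sigma> (\<tau> i))}" for i
    by (auto simp: erase_middle_def B_def)
  ultimately show ?thesis by (auto simp: part_comp_def perm_part_def image_image)
qed

lemma card_refines:
  assumes "refines A p r" "finite A"
  shows "card r \<le> card p" and "card r = card p \<Longrightarrow> r = p"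
proof -
  have p: "partition_on A p" and r: "partition_on A r" using assms by (auto simp: refines_def)
  have fin: "finite p" using assms(2) p by (rule finite_elements)
  obtain f where f: "\<And>X. X \<in> p \<Longrightarrow> f X \<in> r \<and> X \<subseteq> f X" using assms(1) unfolding refines_def by metis
  have one: "\<exists>X\<in>p. y \<in> X \<and> f X = Y" if "Y \<in> r" "y \<in> Y" for Y y
  proof -
    have "y \<in> A" using that r by (auto simp: partition_on_def)
    then obtain X where X: "X \<in> p" "y \<in> X" using p by (auto simp: partition_on_def)
    then have "f X = Y" using f[OF X(1)] that r unfolding partition_on_def disjoint_def by blast
    then show ?thesis using X by blast
  qed
  have img: "f ` p = r"
  proof
    show "r \<subseteq> f ` p"
    proof
      fix Y assume Y: "Y \<in> r"
      then have "Y \<noteq> {}" using r by (auto simp: partition_on_def)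
      then show "Y \<in> f ` p" using one[OF Y] by blast
    qed
  qed (use f in auto)
  then show "card r \<le> card p" using fin card_image_le by blast
  assume "card r = card p"
  then have inj: "inj_on f p" using img fin eq_card_imp_inj_on by metis
  have "f X = X" if X: "X \<in> p" for X
  proof
    show "f X \<subseteq> X"
    proof
      fix y assume "y \<in> f X"
      then obtain X' where "X' \<in> p" "y \<in> X'" "f X' = f X" using one f[OF X] by blast
      then show "y \<in> X" using inj X by (metis inj_onD)
    qed
  qed (use f[OF X] in auto)
  then show "r = p" using img by simp
qed

lemma finite_points: "finite (points k)" by (simp add: points_def)

lemma finite_all_parts: "finite (all_parts k)"
  unfolding all_parts_def using finite_points by (rule finitely_many_partition_on)

lemma id_part_in: "id_part k \<in> all_parts k"
  unfolding all_parts_def mem_Collect_eq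
  by (rule partition_onI) (auto simp: id_part_def perm_part_def points_def disjnt_def)

lemma part_dist_pos:
  assumes "p \<in> all_parts k" "q \<in> all_parts k"
  shows "0 \<le> part_dist p q" and "p \<noteq> q \<Longrightarrow> 0 < part_dist p q"
proof -
  have pq: "partition_on (points k) p" "partition_on (points k) q"
    using assms by (auto simp: all_parts_def)
  note c1 = card_refines[OF part_join_is_join(1)[OF pq] finite_points]
  note c2 = card_refines[OF part_join_is_join(2)[OF pq] finite_points]
  show "0 \<le> part_dist p q" using c1(1) c2(1) by (simp add: part_dist_def)
  assume "p \<noteq> q"
  then have "card (part_join p q) < card p \<or> card (part_join p q) < card q"
    using c1 c2 by (metis order_le_less)
  then show "0 < part_dist p q" using c1(1) c2(1) by (auto simp: part_dist_def)
qed

lemma part_le_refl: "p \<in> all_parts k \<Longrightarrow> part_le k p p"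
proof -
  assume p: "p \<in> all_parts k"
  then have "partition_on (points k) p" by (simp add: all_parts_def)
  then have "part_join p p = p"
    using part_join_is_join[of "points k" p p] refines_refl refines_asym by metis
  then show ?thesis by (simp add: part_le_def part_dist_def)
qed

definition part_rank :: "nat \<Rightarrow> part \<Rightarrow> nat" where
  "part_rank k p = card (id_part k) + card p - 2 * card (part_join (id_part k) p)"

lemma part_rank_less:
  assumes "p \<in> all_parts k" "q \<in> all_parts k" "part_le k q p" "q \<noteq> p"
  shows "part_rank k q < part_rank k p"
proof -
  have r: "real (part_rank k x) = 2 * part_dist (id_part k) x" if "x \<in> all_parts k" for x
    using part_dist_pos(1)[OF id_part_in that] by (simp add: part_rank_def part_dist_def of_nat_diff)
  show ?thesis using part_dist_pos(2)[OF assms(2,1,4)] assms(3) r[OF assms(1)] r[OF assms(2)]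
    by (simp add: part_le_def)
qed

lemma sum_part_le_split:
  assumes "\<C> k \<subseteq> all_parts k" "p \<in> \<C> k"
  shows "(\<Sum>q\<in>{q \<in> \<C> k. part_le k q p}. (f q :: complex)) =
    f p + (\<Sum>q\<in>{q \<in> \<C> k. part_le k q p \<and> q \<noteq> p}. f q)"
proof -
  have "finite (\<C> k)" using assms(1) finite_all_parts finite_subset by blast
  moreover have "{q \<in> \<C> k. part_le k q p} = insert p {q \<in> \<C> k. part_le k q p \<and> q \<noteq> p}"
    using assms part_le_refl by auto
  ultimately show ?thesis by simp
qed

theorem cumulants_unique:
  assumes "\<And>k. \<C> k \<subseteq> all_parts k" "cumulants scale \<C> m \<kappa>" "cumulants scale \<C> m \<kappa>'"
    and "p \<in> \<C> k" "length as = k"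
  shows "\<kappa> p as = \<kappa>' p as"
  using assms(4)
proof (induction "part_rank k p" arbitrary: p rule: less_induct)
  case less
  have "(\<Sum>q\<in>{q \<in> \<C> k. part_le k q p \<and> q \<noteq> p}. \<kappa> q as) =
      (\<Sum>q\<in>{q \<in> \<C> k. part_le k q p \<and> q \<noteq> p}. \<kappa>' q as)"
    using assms(1) less part_rank_less by (intro sum.cong) blast+
  moreover have "m p as = (\<Sum>q\<in>{q \<in> \<C> k. part_le k q p}. \<kappa> q as)"
    "m p as = (\<Sum>q\<in>{q \<in> \<C> k. part_le k q p}. \<kappa>' q as)"
    using assms(2,3,5) less.prems unfolding cumulants_def by blast+
  ultimately show ?case using sum_part_le_split[where \<C> = \<C>, OF assms(1) less.prems] by simp
qed

function cumulant_rec ::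
  "(nat \<Rightarrow> part set) \<Rightarrow> (part \<Rightarrow> 'a list \<Rightarrow> complex) \<Rightarrow> part \<Rightarrow> 'a list \<Rightarrow> complex" where
  "cumulant_rec \<C> m p as = m p as -
    (\<Sum>q\<in>{q \<in> \<C> (length as) \<inter> all_parts (length as).
        p \<in> all_parts (length as) \<and> part_le (length as) q p \<and> q \<noteq> p}. cumulant_rec \<C> m q as)"
  by auto
termination
  by (relation "measure (\<lambda>(\<C>, m, p, as). part_rank (length as) p)") (auto simp: part_rank_less)

declare cumulant_rec.simps [simp del]

theorem cumulants_exist:
  fixes scale :: "complex \<Rightarrow> 'a::ring \<Rightarrow> 'a"
  assumes "vector_space scale" and \<C>: "\<And>k. \<C> k \<subseteq> all_parts k"
    and lin: "\<And>k p. p \<in> \<C> k \<Longrightarrow> multilinear_form scale k (m p)"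
  shows "cumulants scale \<C> m (cumulant_rec \<C> m)"
proof -
  interpret vector_space_pair scale "(*) :: complex \<Rightarrow> complex \<Rightarrow> complex"
    using assms(1) by (simp add: vector_space_pair_def vector_space_def algebra_simps)
  have rec: "cumulant_rec \<C> m p as =
      m p as - (\<Sum>q\<in>{q \<in> \<C> k. part_le k q p \<and> q \<noteq> p}. cumulant_rec \<C> m q as)"
    if "p \<in> \<C> k" "length as = k" for p k as
    using that \<C> by (subst cumulant_rec.simps) (intro arg_cong2[of _ _ _ _ minus] sum.cong, auto)
  have "multilinear_form scale k (cumulant_rec \<C> m p)" if "p \<in> \<C> k" for p k
    using that
  proof (induction "part_rank k p" arbitrary: p rule: less_induct)
    case less
    show ?case unfolding multilinear_form_def
    proof (intro allI impI, elim conjE)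
      fix as :: "'a list" and i assume as: "length as = k" "i < k"
      have "(\<lambda>x. cumulant_rec \<C> m p (as[i := x])) = (\<lambda>x. m p (as[i := x]) -
          (\<Sum>q\<in>{q \<in> \<C> k. part_le k q p \<and> q \<noteq> p}. cumulant_rec \<C> m q (as[i := x])))"
        using less.prems as by (intro ext rec) auto
      moreover have "Vector_Spaces.linear scale (*) (\<lambda>x. m p (as[i := x]) -
          (\<Sum>q\<in>{q \<in> \<C> k. part_le k q p \<and> q \<noteq> p}. cumulant_rec \<C> m q (as[i := x])))"
      proof (intro linear_compose_sub linear_compose_sum ballI)
        show "Vector_Spaces.linear scale (*) (\<lambda>x. m p (as[i := x]))"
          using lin[OF less.prems] as by (simp add: multilinear_form_def)
        fix q assume "q \<in> {q \<in> \<C> k. part_le k q p \<and> q \<noteq> p}"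
        then have "multilinear_form scale k (cumulant_rec \<C> m q)"
          using less \<C> part_rank_less by blast
        then show "Vector_Spaces.linear scale (*) (\<lambda>x. cumulant_rec \<C> m q (as[i := x]))"
          using as by (simp add: multilinear_form_def)
      qed
      ultimately show "Vector_Spaces.linear scale (*) (\<lambda>x. cumulant_rec \<C> m p (as[i := x]))" by simp
    qed
  qed
  then show ?thesis unfolding cumulants_def by (simp add: sum_part_le_split[where \<C> = \<C>, OF \<C>] rec)
qed

theorem voiculescu_free_nonunital:
  assumes alg: "complex_algebra scale" and free: "voiculescu_free scale \<phi> F1 F2"
    and "xs \<noteq> []" "alternating (generated_algebra scale F1) (generated_algebra scale F2) xs"
    and "\<forall>x\<in>set xs. \<phi> x = 0"
  shows "\<phi> (word_prod xs) = 0"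
proof -
  interpret complex_algebra scale by (rule alg)
  let ?ys = "map (Pair (0::complex)) xs"
  have "foldr (unitization_mult scale) ?ys (1, 0) = (0, word_prod xs)"
    using \<open>xs \<noteq> []\<close> by (induction xs rule: word_prod.induct) (auto simp: unitization_mult_def)
  moreover have "alternating (UNIV \<times> generated_algebra scale F1) (UNIV \<times> generated_algebra scale F2) ?ys"
    using assms(4) unfolding alternating_def by auto
  ultimately show ?thesis
    using free[unfolded voiculescu_free_def, rule_format, of ?ys] assms(3,5)
    by (auto simp: unitization_form_def)
qed

theorem voiculescu_free_unital:
  fixes scale :: "complex \<Rightarrow> 'a::ring_1 \<Rightarrow> 'a"
  assumes alg: "complex_algebra scale" and lin: "Vector_Spaces.linear scale (*) \<phi>" and one: "\<phi> 1 = 1"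
  shows "voiculescu_free scale \<phi> F1 F2 \<longleftrightarrow>
    (\<forall>xs. xs \<noteq> [] \<and>
      alternating (generated_algebra scale (insert 1 F1)) (generated_algebra scale (insert 1 F2)) xs \<and>
      (\<forall>x\<in>set xs. \<phi> x = 0) \<longrightarrow> \<phi> (prod_list xs) = 0)"
proof -
  interpret complex_algebra scale by (rule alg)
  interpret \<phi>: Vector_Spaces.linear scale "(*)" \<phi> by (rule lin)
  let ?G = "generated_algebra scale"
  define h where "h x = scale (fst x) 1 + snd x" for x :: "complex \<times> 'a"
  have h_form: "\<phi> (h x) = unitization_form \<phi> x" for x
    by (simp add: h_def unitization_form_def \<phi>.add \<phi>.scale one)
  have h_mult: "h (unitization_mult scale x y) = h x * h y" for x y
    by (simp add: h_def unitization_mult_def scale_right_distrib algebra_simps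
        scale_mult_left[symmetric] scale_mult_right[symmetric])
  have h_prod: "h (foldr (unitization_mult scale) xs (1, 0)) = prod_list (map h xs)" for xs
    by (induction xs) (auto simp: h_mult, simp add: h_def)
  have mono: "x \<in> ?G (insert 1 F)" if "x \<in> ?G F" for x F
    using that by induction (auto intro: generated_algebra.intros)
  have h_in: "h x \<in> ?G (insert 1 F)" if "snd x \<in> ?G F" for x F
    unfolding h_def
    by (rule generated_algebra.add[OF generated_algebra.scale[OF generated_algebra.base] mono[OF that]]) simp
  have h_onto: "\<exists>c a. a \<in> ?G F \<and> x = h (c, a)" if "x \<in> ?G (insert 1 F)" for x F
    using that
  proof induction
    case (base a)
    show ?case
    proof (cases "a = 1")
      case True
      then have "a = h (1, 0)" by (simp add: h_def)
      then show ?thesis using generated_algebra.zero by blast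
    next
      case False
      then have "a \<in> F" using base by blast
      then have "a \<in> ?G F" by (rule generated_algebra.base)
      moreover have "a = h (0, a)" by (simp add: h_def)
      ultimately show ?thesis by blast
    qed
  next
    case zero
    have "0 = h (0, 0)" by (simp add: h_def)
    then show ?case using generated_algebra.zero by blast
  next
    case (add a b)
    then obtain c a' d b' where "a' \<in> ?G F" "a = h (c, a')" "b' \<in> ?G F" "b = h (d, b')" by blast
    moreover from this have "a + b = h (c + d, a' + b')"
      by (simp add: h_def scale_left_distrib algebra_simps)
    ultimately show ?case using generated_algebra.add by blast
  next
    case (scale a c)
    then obtain d a' where "a' \<in> ?G F" "a = h (d, a')" by blast
    moreover from this have "scale c a = h (c * d, scale c a')"
      by (simp add: h_def scale_right_distrib)
    ultimately show ?case using generated_algebra.scale by blast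
  next
    case (mult a b)
    then obtain c a' d b' where *: "a' \<in> ?G F" "a = h (c, a')" "b' \<in> ?G F" "b = h (d, b')" by blast
    then have "a * b = h (unitization_mult scale (c, a') (d, b'))" by (simp add: h_mult)
    then have "a * b = h (c * d, scale c b' + scale d a' + a' * b')" by (simp add: unitization_mult_def)
    moreover have "scale c b' + scale d a' + a' * b' \<in> ?G F"
      using * by (intro generated_algebra.add generated_algebra.scale generated_algebra.mult)
    ultimately show ?case by blast
  qed
  show ?thesis
  proof
    assume free: "voiculescu_free scale \<phi> F1 F2"
    show "\<forall>xs. xs \<noteq> [] \<and> alternating (?G (insert 1 F1)) (?G (insert 1 F2)) xs \<and>
      (\<forall>x\<in>set xs. \<phi> x = 0) \<longrightarrow> \<phi> (prod_list xs) = 0"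
    proof (intro allI impI, elim conjE)
      fix xs assume xs: "xs \<noteq> []" "alternating (?G (insert 1 F1)) (?G (insert 1 F2)) xs"
        "\<forall>x\<in>set xs. \<phi> x = 0"
      have lift: "\<exists>ys. length ys = length xs \<and> (\<forall>i<length xs. ys ! i \<in> UNIV \<times> ?G (B i) \<and> h (ys ! i) = xs ! i)"
        if mem: "\<And>i. i < length xs \<Longrightarrow> xs ! i \<in> ?G (insert 1 (B i))" for B
      proof -
        have "\<exists>y. y \<in> UNIV \<times> ?G (B i) \<and> h y = xs ! i" if i: "i < length xs" for i
        proof -
          obtain c a where "a \<in> ?G (B i)" "xs ! i = h (c, a)" using h_onto[OF mem[OF i]] by blast
          then show ?thesis by (intro exI[of _ "(c, a)"]) simp
        qed
        then have "\<forall>i\<in>{..<length xs}. \<exists>y. y \<in> UNIV \<times> ?G (B i) \<and> h y = xs ! i" by blast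
        then obtain g where "\<forall>i\<in>{..<length xs}. g i \<in> UNIV \<times> ?G (B i) \<and> h (g i) = xs ! i"
          by (rule bchoice[THEN exE])
        then show ?thesis by (intro exI[of _ "map g [0..<length xs]"]) auto
      qed
      have "\<exists>ys. length ys = length xs \<and> (\<forall>i<length xs. h (ys ! i) = xs ! i) \<and>
        alternating (UNIV \<times> ?G F1) (UNIV \<times> ?G F2) ys"
        using xs(2)[unfolded alternating_def]
      proof
        assume "\<forall>i<length xs. xs ! i \<in> (if even i then ?G (insert 1 F1) else ?G (insert 1 F2))"
        then have "xs ! i \<in> ?G (insert 1 (if even i then F1 else F2))" if "i < length xs" for i
          using that by (cases "even i") auto
        from lift[OF this] obtain ys where ys: "length ys = length xs"
          "\<And>i. i < length xs \<Longrightarrow> ys ! i \<in> UNIV \<times> ?G (if even i then F1 else F2) \<and> h (ys ! i) = xs ! i"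
          by blast
        have "ys ! i \<in> (if even i then UNIV \<times> ?G F1 else UNIV \<times> ?G F2)" if "i < length ys" for i
          using ys(2)[of i] ys(1) that by (cases "even i") simp_all
        then show ?thesis unfolding alternating_def using ys by blast
      next
        assume "\<forall>i<length xs. xs ! i \<in> (if even i then ?G (insert 1 F2) else ?G (insert 1 F1))"
        then have "xs ! i \<in> ?G (insert 1 (if even i then F2 else F1))" if "i < length xs" for i
          using that by (cases "even i") auto
        from lift[OF this] obtain ys where ys: "length ys = length xs"
          "\<And>i. i < length xs \<Longrightarrow> ys ! i \<in> UNIV \<times> ?G (if even i then F2 else F1) \<and> h (ys ! i) = xs ! i"
          by blast
        have "ys ! i \<in> (if even i then UNIV \<times> ?G F2 else UNIV \<times> ?G F1)" if "i < length ys" for i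
          using ys(2)[of i] ys(1) that by (cases "even i") simp_all
        then show ?thesis unfolding alternating_def using ys by blast
      qed
      then obtain ys where ys: "length ys = length xs" "\<forall>i<length xs. h (ys ! i) = xs ! i"
        "alternating (UNIV \<times> ?G F1) (UNIV \<times> ?G F2) ys" by blast
      have map: "xs = map h ys" using ys by (auto intro: nth_equalityI)
      then have "unitization_form \<phi> (foldr (unitization_mult scale) ys (1, 0)) = 0"
        using free ys xs unfolding voiculescu_free_def by (auto simp: h_form)
      then show "\<phi> (prod_list xs) = 0" unfolding h_form[symmetric] h_prod map .
    qed
  next
    assume *: "\<forall>xs. xs \<noteq> [] \<and> alternating (?G (insert 1 F1)) (?G (insert 1 F2)) xs \<and>
      (\<forall>x\<in>set xs. \<phi> x = 0) \<longrightarrow> \<phi> (prod_list xs) = 0"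
    show "voiculescu_free scale \<phi> F1 F2" unfolding voiculescu_free_def
    proof (intro allI impI, elim conjE)
      fix xs assume xs: "xs \<noteq> []" "alternating (UNIV \<times> ?G F1) (UNIV \<times> ?G F2) xs"
        "\<forall>x\<in>set xs. unitization_form \<phi> x = 0"
      have "alternating (?G (insert 1 F1)) (?G (insert 1 F2)) (map h xs)"
        using xs(2) unfolding alternating_def
        by (auto split: if_splits intro!: h_in simp: mem_Times_iff)
      then have "\<phi> (prod_list (map h xs)) = 0" using *[rule_format, of "map h xs"] xs by (auto simp: h_form)
      then show "unitization_form \<phi> (foldr (unitization_mult scale) xs (1, 0)) = 0"
        by (simp add: h_form[symmetric] h_prod)
    qed
  qed
qed

end

theory Submission
  imports Defs
begin

text \<open>
  Write \<open>\<phi>\<close> for the form \<open>m (id_part 1)\<close>. By multilinearity it suffices to show that \<open>\<phi>\<close> vanishes on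
  \<open>(W 0 - \<phi> (W 0)) \<dots> (W (n - 1) - \<phi> (W (n - 1)))\<close>, where the words \<open>W i\<close> have their letters alternately
  in \<open>A\<^sub>1\<close> and in \<open>t ` A\<^sub>2\<close>. Expanding gives a sum over \<open>I \<subseteq> {..<n}\<close> with the sign \<open>(-1) ^ (n - card I)\<close> of
  \<open>\<phi> (product of the W i with i \<in> I)\<close> times the \<open>\<phi> (W i)\<close> with \<open>i \<notin> I\<close>.

  By determinism each term of this sum is the moment of the whole sequence of letters at the
  permutation with one cycle through the words of \<open>I\<close> and one cycle for each other word
  (\<open>moment_cycles\<close>). Removing the transposes from the letters exchanges the two points
  of the corresponding columns (\<open>moment_transposed_at\<close>). So the terms are \<open>m (q I) as\<close> for partitions
  \<open>q I\<close> and one fixed sequence \<open>as\<close> of letters from \<open>A\<^sub>1 \<union> A\<^sub>2\<close>. By \<open>U\<close>-invariance \<open>m (q I) as\<close> is the sum,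
  over the permutations \<open>\<sigma> \<le> q I\<close>, of a number that depends only on \<open>\<sigma>\<close> and \<open>as\<close>. The claim thus becomes
  combinatorial: for every permutation \<open>\<sigma>\<close> of the \<open>N\<close> letters, the signed number of sets \<open>I\<close> with
  \<open>\<sigma> \<le> q I\<close> is zero.

  All partitions involved are pairings of the \<open>2 N\<close> points, so \<open>\<sigma> \<le> q\<close> compares
  numbers of connected components: \<open>N + nc (id \<or> q) = nc (id \<or> \<sigma>) + nc (\<sigma> \<or>
  q)\<close>. For \<open>I = {..<n}\<close> the pairings \<open>id\<close> and \<open>q I\<close> together form one
  circle through all points, and the equation says that \<open>\<sigma>\<close> is non-crossing on it; the equation
  for any \<open>I\<close> leads to this case (\<open>geodesic_excess_mono\<close>). Some pair of
  \<open>\<sigma>\<close> then consists of neighbours on the circle (\<open>planar_adjacent_pair\<close>). Being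
  neighbours, its points have different parity on the circle; belonging to a permutation, they have different rows;
  and parity and row are linked by whether the column was exchanged. Hence both columns are exchanged or none is, and
  since the words alternate, both lie in the same word. Deleting the pair leaves a smaller circle, and by induction
  some word is mapped to itself by \<open>\<sigma>\<close> (\<open>stable_segment_exists\<close>).

  Suppose that \<open>\<sigma>\<close> maps the word \<open>i\<close> to itself. If the cycle of this word is merged with the long cycle,
  then \<open>nc (id \<or> q)\<close> and \<open>nc (\<sigma> \<or> q)\<close> both drop by one (\<open>num_components_ring_merge\<close>), so that \<open>\<sigma> \<le> q I\<close>
  does not depend on whether \<open>i \<in> I\<close>. The sets \<open>I\<close> with and without \<open>i\<close> therefore cancel
  (\<open>alternating_sum_zero\<close>).
\<close>

section \<open>Connected components\<close>

definition connected_in :: "('v \<times> 'v) set \<Rightarrow> ('v \<times> 'v) set" where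
  "connected_in R = (R \<union> R\<inverse>)\<^sup>*"

text \<open>The blocks of a join of pair partitions are the connected components of a graph, for which the
  effect of adding a single edge is easy to control. Edges are unordered in effect, since
  \<open>connected_in\<close> symmetrizes.\<close>
definition num_components :: "'v set \<Rightarrow> ('v \<times> 'v) set \<Rightarrow> nat" where
  "num_components V R = card (V // connected_in R)"

lemma connected_refl [simp]: "(x, x) \<in> connected_in R"
  by (simp add: connected_in_def)

lemma connected_edge: "(x, y) \<in> R \<Longrightarrow> (x, y) \<in> connected_in R"
  by (auto simp: connected_in_def)

lemma connected_sym: "(x, y) \<in> connected_in R \<Longrightarrow> (y, x) \<in> connected_in R"
  unfolding connected_in_def using sym_rtrancl[OF sym_Un_converse] by (rule symD)

lemma connected_trans:
  "(x, y) \<in> connected_in R \<Longrightarrow> (y, z) \<in> connected_in R \<Longrightarrow> (x, z) \<in> connected_in R"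
  unfolding connected_in_def by (rule rtrancl_trans)

lemma connected_mono: "R \<subseteq> S \<Longrightarrow> connected_in R \<subseteq> connected_in S"
  unfolding connected_in_def by (intro rtrancl_mono) blast

lemma connected_in_closed:
  assumes "(x, y) \<in> connected_in R" "x \<in> K"
    and "\<And>u v. (u, v) \<in> R \<Longrightarrow> u \<in> K \<longleftrightarrow> v \<in> K"
  shows "y \<in> K"
  using assms(1,2) unfolding connected_in_def
  by (induction rule: rtrancl_induct) (use assms(3) in auto)

lemma connected_in_eqI:
  assumes "R \<subseteq> connected_in S" "S \<subseteq> connected_in R"
  shows "connected_in R = connected_in S"
proof -
  have "connected_in R \<subseteq> connected_in S" if "R \<subseteq> connected_in S" for R S :: "('v \<times> 'v) set"
  proof
    fix e assume "e \<in> connected_in R"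
    moreover obtain x y where "e = (x, y)" by (cases e)
    ultimately have "(x, y) \<in> (R \<union> R\<inverse>)\<^sup>*" by (simp add: connected_in_def)
    then have "(x, y) \<in> connected_in S"
      by induction (use that in \<open>auto intro: connected_trans connected_sym\<close>)
    then show "e \<in> connected_in S" using \<open>e = (x, y)\<close> by simp
  qed
  then show ?thesis using assms by blast
qed

lemma connected_in_insert_connected:
  "(a, b) \<in> connected_in R \<Longrightarrow> connected_in (insert (a, b) R) = connected_in R"
  by (rule connected_in_eqI) (auto intro: connected_edge)

text \<open>A new edge merges the classes of its two ends and leaves the other classes alone.\<close>
lemma connected_in_insert:
  "connected_in (insert (a, b) R) = connected_in R \<union>
    (connected_in R `` {a, b}) \<times> (connected_in R `` {a, b})" (is "?L = _ \<union> ?K \<times> ?K")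
proof
  show "?L \<subseteq> connected_in R \<union> ?K \<times> ?K"
  proof
    fix e assume "e \<in> ?L"
    moreover obtain x y where e: "e = (x, y)" by (cases e)
    ultimately have "(x, y) \<in> (insert (a, b) R \<union> (insert (a, b) R)\<inverse>)\<^sup>*"
      by (simp add: connected_in_def)
    then have "(x, y) \<in> connected_in R \<or> x \<in> ?K \<and> y \<in> ?K"
    proof induction
      case (step y z)
      have "(y, z) \<in> connected_in R \<or> y \<in> {a, b} \<and> z \<in> {a, b}"
        using step(2) by (auto intro: connected_edge connected_sym)
      then show ?case
      proof
        assume yz: "(y, z) \<in> connected_in R"
        then have "y \<in> ?K \<Longrightarrow> z \<in> ?K" by (meson Image_iff connected_trans)
        then show ?thesis using step(3) connected_trans[OF _ yz] by blast
      next
        assume yz: "y \<in> {a, b} \<and> z \<in> {a, b}"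
        then have "(x, y) \<in> connected_in R \<Longrightarrow> x \<in> ?K" by (meson ImageI connected_sym)
        moreover have "z \<in> ?K" using yz by (meson ImageI connected_refl)
        ultimately show ?thesis using step(3) by blast
      qed
    qed simp
    then show "e \<in> connected_in R \<union> ?K \<times> ?K" using e by simp
  qed
  have sub: "connected_in R \<subseteq> ?L" by (rule connected_mono) blast
  have K: "(a, x) \<in> ?L" if x: "x \<in> ?K" for x
  proof -
    obtain u where u: "u = a \<or> u = b" "(u, x) \<in> connected_in R" using x by blast
    have "(a, b) \<in> ?L" by (rule connected_edge) simp
    then have "(a, u) \<in> ?L" using u(1) connected_refl by metis
    then show ?thesis using u(2) sub by (meson connected_trans subsetD)
  qed
  have "(x, y) \<in> ?L" if "x \<in> ?K" "y \<in> ?K" for x y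
    using connected_trans[OF connected_sym[OF K[OF that(1)]] K[OF that(2)]] .
  then show "connected_in R \<union> ?K \<times> ?K \<subseteq> ?L" using sub by blast
qed

lemma class_eq_iff:
  "connected_in R `` {x} = connected_in R `` {y} \<longleftrightarrow> (x, y) \<in> connected_in R"
proof
  assume "connected_in R `` {x} = connected_in R `` {y}"
  then have "y \<in> connected_in R `` {x}" by simp
  then show "(x, y) \<in> connected_in R" by simp
next
  assume "(x, y) \<in> connected_in R"
  then have "(x, z) \<in> connected_in R \<longleftrightarrow> (y, z) \<in> connected_in R" for z
    by (metis connected_sym connected_trans)
  then show "connected_in R `` {x} = connected_in R `` {y}" by blast
qed

lemma num_components_cong:
  "connected_in R = connected_in S \<Longrightarrow> num_components V R = num_components V S"
  by (simp add: num_components_def)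

lemma num_components_symmetric_closure:
  "R \<union> R\<inverse> = S \<union> S\<inverse> \<Longrightarrow> num_components V R = num_components V S"
  by (simp add: num_components_def connected_in_def)

lemma num_components_insert_connected:
  "(a, b) \<in> connected_in R \<Longrightarrow> num_components V (insert (a, b) R) = num_components V R"
  by (simp add: num_components_def connected_in_insert_connected)

lemma num_components_insert_disconnected:
  assumes fin: "finite V" and "a \<in> V" "b \<in> V" and ab: "(a, b) \<notin> connected_in R"
  shows "Suc (num_components V (insert (a, b) R)) = num_components V R"
proof -
  let ?c = "\<lambda>x. connected_in R `` {x}" and ?c' = "\<lambda>x. connected_in (insert (a, b) R) `` {x}"
  have c': "?c' x = (if x \<in> ?c a \<union> ?c b then ?c a \<union> ?c b else ?c x)" for x
  proof (cases "x \<in> ?c a \<union> ?c b")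
    case True
    then have "(a, x) \<in> connected_in R \<or> (b, x) \<in> connected_in R" by simp
    then have "?c x = ?c a \<or> ?c x = ?c b" using class_eq_iff[of R] by metis
    then show ?thesis using True unfolding connected_in_insert by auto
  qed (auto simp: connected_in_insert)
  have q: "V // connected_in S = (\<lambda>x. connected_in S `` {x}) ` V" for S
    by (auto simp: quotient_def)
  have ne: "?c a \<noteq> ?c b" using ab class_eq_iff[of R a b] by simp
  have "?c a \<union> ?c b \<noteq> ?c x" for x
  proof
    assume *: "?c a \<union> ?c b = ?c x"
    have "a \<in> ?c a \<union> ?c b" "b \<in> ?c a \<union> ?c b" by simp_all
    then have x: "(x, a) \<in> connected_in R" "(x, b) \<in> connected_in R" unfolding * by simp_all
    show False using ab connected_trans[OF connected_sym[OF x(1)] x(2)] by simp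
  qed
  then have new: "?c a \<union> ?c b \<notin> ?c ` V" by blast
  have img: "?c' ` V = insert (?c a \<union> ?c b) (?c ` V - {?c a, ?c b})"
  proof (intro set_eqI iffI)
    fix C assume "C \<in> ?c' ` V"
    then obtain x where x: "x \<in> V" "C = ?c' x" by blast
    show "C \<in> insert (?c a \<union> ?c b) (?c ` V - {?c a, ?c b})"
    proof (cases "x \<in> ?c a \<union> ?c b")
      case False
      then have "(a, x) \<notin> connected_in R" "(b, x) \<notin> connected_in R" by simp_all
      then have "?c x \<noteq> ?c a" "?c x \<noteq> ?c b" using class_eq_iff[of R] by metis+
      then show ?thesis using x False by (simp add: c')
    qed (use x in \<open>simp add: c'\<close>)
  next
    fix C assume "C \<in> insert (?c a \<union> ?c b) (?c ` V - {?c a, ?c b})"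
    then consider "C = ?c a \<union> ?c b" | x where "x \<in> V" "C = ?c x" "?c x \<noteq> ?c a" "?c x \<noteq> ?c b"
      by blast
    then show "C \<in> ?c' ` V"
    proof cases
      case 1
      then have "C = ?c' a" by (simp add: c')
      then show ?thesis using \<open>a \<in> V\<close> by blast
    next
      case 2
      then have "(a, x) \<notin> connected_in R \<and> (b, x) \<notin> connected_in R" using class_eq_iff[of R] by metis
      then have "x \<notin> ?c a \<union> ?c b" by simp
      then have "C = ?c' x" using 2 by (simp add: c')
      then show ?thesis using \<open>x \<in> V\<close> by blast
    qed
  qed
  moreover have two: "card {?c a, ?c b} = 2" using ne by simp
  moreover have sub: "{?c a, ?c b} \<subseteq> ?c ` V" using assms by blast
  moreover have "card {?c a, ?c b} \<le> card (?c ` V)" using fin sub by (intro card_mono) auto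
  moreover have "card (?c ` V - {?c a, ?c b}) = card (?c ` V) - card {?c a, ?c b}"
    using sub by (intro card_Diff_subset) auto
  moreover have "card (insert (?c a \<union> ?c b) (?c ` V - {?c a, ?c b})) = Suc (card (?c ` V - {?c a, ?c b}))"
    using fin new by (intro card_insert_disjoint) auto
  ultimately show ?thesis unfolding num_components_def q img by linarith
qed

lemma num_components_insert_ge:
  assumes "finite V" "a \<in> V" "b \<in> V"
  shows "num_components V R \<le> Suc (num_components V (insert (a, b) R))"
    and "num_components V (insert (a, b) R) \<le> num_components V R"
  using num_components_insert_connected[of a b R V] num_components_insert_disconnected[OF assms, of R]
  by (cases "(a, b) \<in> connected_in R"; simp)+

lemma num_components_isolated:
  assumes "finite V" "R \<subseteq> V \<times> V" "x \<notin> V"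
  shows "num_components (insert x V) R = Suc (num_components V R)"
proof -
  have "y = x" if "(x, y) \<in> connected_in R" for y
    using connected_in_closed[OF that, of "{x}"] assms by auto
  then have x: "connected_in R `` {x} = {x}" by auto
  have "y \<in> V" if "(z, y) \<in> connected_in R" "z \<in> V" for y z
    using connected_in_closed[OF that] assms by auto
  then have "{x} \<notin> V // connected_in R" using assms(3) by (auto simp: quotient_def)
  moreover have "insert x V // connected_in R = insert {x} (V // connected_in R)"
    using x by (auto simp: quotient_def)
  ultimately show ?thesis using assms(1)
    by (simp add: num_components_def quotient_def)
qed

text \<open>The next two lemmas are the two effects of deleting an innermost pair \<open>x\<close>, \<open>y\<close> from a
  non-crossing pairing: in one of the two graphs the pair sits in the middle of a path \<open>p, x, y, r\<close>,
  which shrinks to the edge \<open>p, r\<close>; in the other graph it is a component of its own.\<close>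
lemma num_components_subdivide:
  assumes V: "finite V" "R \<subseteq> V \<times> V" "p \<in> V" "r \<in> V" "x \<notin> V" "y \<notin> V" "x \<noteq> y"
  shows "num_components (insert x (insert y V)) (R \<union> {(p, x), (x, y), (y, r)}) =
    num_components V (insert (p, r) R)"
proof -
  let ?V = "insert x (insert y V)" and ?R = "insert (p, r) R"
  have R: "?R \<subseteq> V \<times> V" using V by blast
  have "connected_in (R \<union> {(p, x), (x, y), (y, r)}) = connected_in (insert (x, y) (insert (p, x) ?R))"
  proof (rule connected_in_eqI)
    let ?A = "R \<union> {(p, x), (x, y), (y, r)}" and ?B = "insert (x, y) (insert (p, x) ?R)"
    have "(p, x) \<in> connected_in ?A" "(x, y) \<in> connected_in ?A" "(y, r) \<in> connected_in ?A"
      by (auto intro: connected_edge)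
    then have "(p, r) \<in> connected_in ?A" by (meson connected_trans)
    then show "?B \<subseteq> connected_in ?A" by (auto intro: connected_edge)
    have "(p, x) \<in> connected_in ?B" "(x, y) \<in> connected_in ?B" "(p, r) \<in> connected_in ?B"
      by (auto intro: connected_edge)
    then have "(y, r) \<in> connected_in ?B" by (meson connected_trans connected_sym)
    then show "?A \<subseteq> connected_in ?B" by (auto intro: connected_edge)
  qed
  then have "num_components ?V (R \<union> {(p, x), (x, y), (y, r)}) =
      num_components ?V (insert (x, y) (insert (p, x) ?R))" by (rule num_components_cong)
  moreover have "(x, y) \<notin> connected_in (insert (p, x) ?R)"
  proof
    assume "(x, y) \<in> connected_in (insert (p, x) ?R)"
    then have "y \<in> insert x V" by (rule connected_in_closed) (use V in auto)
    then show False using V by auto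
  qed
  then have "Suc (num_components ?V (insert (x, y) (insert (p, x) ?R))) =
      num_components ?V (insert (p, x) ?R)"
    by (intro num_components_insert_disconnected) (use V in auto)
  moreover have "(p, x) \<notin> connected_in ?R"
  proof
    assume "(p, x) \<in> connected_in ?R"
    then have "x \<in> V" by (rule connected_in_closed) (use V in auto)
    then show False using V by auto
  qed
  then have "Suc (num_components ?V (insert (p, x) ?R)) = num_components ?V ?R"
    by (intro num_components_insert_disconnected) (use V in auto)
  moreover have "num_components ?V ?R = Suc (num_components (insert y V) ?R)"
    by (rule num_components_isolated) (use V in auto)
  moreover have "num_components (insert y V) ?R = Suc (num_components V ?R)"
    by (rule num_components_isolated) (use V in auto)
  ultimately show ?thesis by simp
qed

lemma num_components_separate_edge:
  assumes V: "finite V" "R \<subseteq> V \<times> V" "x \<notin> V" "y \<notin> V" "x \<noteq> y"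
  shows "num_components (insert x (insert y V)) (insert (x, y) R) = Suc (num_components V R)"
proof -
  have "(x, y) \<notin> connected_in R"
  proof
    assume "(x, y) \<in> connected_in R"
    then have "y \<in> {x}" by (rule connected_in_closed) (use V in auto)
    then show False using V by auto
  qed
  then have "Suc (num_components (insert x (insert y V)) (insert (x, y) R)) =
      num_components (insert x (insert y V)) R"
    by (intro num_components_insert_disconnected) (use V in auto)
  moreover have "num_components (insert x (insert y V)) R = Suc (num_components (insert y V) R)"
    by (rule num_components_isolated) (use V in auto)
  moreover have "num_components (insert y V) R = Suc (num_components V R)"
    by (rule num_components_isolated) (use V in auto)
  ultimately show ?thesis by simp
qed

section \<open>Planar pairings\<close>

text \<open>A list of points of even length stands for a circle. Its edges are coloured alternately:
  \<open>alternate_edges L\<close> are those of one colour, and \<open>alternate_edges (rotate1 L)\<close> are those of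
  the other colour, including the edge that closes the circle.\<close>
fun alternate_edges :: "'v list \<Rightarrow> ('v \<times> 'v) set" where
  "alternate_edges (x # y # L) = insert (x, y) (alternate_edges L)"
| "alternate_edges _ = {}"

lemma alternate_edges_append:
  "even (length u) \<Longrightarrow> alternate_edges (u @ v) = alternate_edges u \<union> alternate_edges v"
  by (induction u rule: alternate_edges.induct) auto

lemma alternate_edges_subset: "alternate_edges L \<subseteq> set L \<times> set L"
  by (induction L rule: alternate_edges.induct) auto

lemma alternate_edges_rotate_twice:
  "even (length L) \<Longrightarrow> alternate_edges (rotate1 (rotate1 L)) = alternate_edges L"
proof (cases L rule: alternate_edges.cases)
  case (1 x y v)
  moreover assume "even (length L)"
  ultimately show ?thesis by (simp add: alternate_edges_append)
qed auto

lemma alternate_edges_adjacent: "(x, y) \<in> alternate_edges L \<Longrightarrow> \<exists>u v. L = u @ [x, y] @ v"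
proof (induction L rule: alternate_edges.induct)
  case (1 a b L)
  show ?case
  proof (cases "(x, y) = (a, b)")
    case True
    then have "a # b # L = [] @ [x, y] @ L" by simp
    then show ?thesis by blast
  next
    case False
    then obtain u v where "L = u @ [x, y] @ v" using 1 by auto
    then have "a # b # L = (a # b # u) @ [x, y] @ v" by simp
    then show ?thesis by blast
  qed
qed auto

lemma alternate_edges_partner:
  "even (length L) \<Longrightarrow> x \<in> set L \<Longrightarrow> \<exists>y. (x, y) \<in> alternate_edges L \<or> (y, x) \<in> alternate_edges L"
  by (induction L rule: alternate_edges.induct) auto

lemma alternate_edges_rotate1_cases:
  assumes "(x, y) \<in> alternate_edges (rotate1 L)"
  shows "(\<exists>u v. L = u @ [x, y] @ v) \<or> x = last L \<and> y = hd L"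
proof (cases L)
  case (Cons h t)
  then obtain u v where uv: "t @ [h] = u @ [x, y] @ v" using alternate_edges_adjacent[OF assms] by auto
  show ?thesis
  proof (cases v rule: rev_cases)
    case Nil
    then have "t = u @ [x]" "y = h" using uv by (simp_all flip: append_assoc add: append_eq_append_conv2)
    then show ?thesis using Cons by simp
  next
    case (snoc v' z)
    then have "t = u @ [x, y] @ v'" using uv by (simp flip: append_assoc append_Cons)
    then have "L = (h # u) @ [x, y] @ v'" using Cons by simp
    then show ?thesis by blast
  qed
qed (use assms in simp)

definition graph_on :: "('v \<Rightarrow> 'v) \<Rightarrow> 'v set \<Rightarrow> ('v \<times> 'v) set" where
  "graph_on s V = (\<lambda>x. (x, s x)) ` V"

definition pairing_on :: "('v \<Rightarrow> 'v) \<Rightarrow> 'v set \<Rightarrow> bool" where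
  "pairing_on s V \<longleftrightarrow> (\<forall>x\<in>V. s x \<in> V \<and> s (s x) = x \<and> s x \<noteq> x)"

lemma pairing_onD:
  "pairing_on s V \<Longrightarrow> x \<in> V \<Longrightarrow> s x \<in> V" "pairing_on s V \<Longrightarrow> x \<in> V \<Longrightarrow> s (s x) = x"
  "pairing_on s V \<Longrightarrow> x \<in> V \<Longrightarrow> s x \<noteq> x"
  by (auto simp: pairing_on_def)

lemma graph_on_subset: "pairing_on s V \<Longrightarrow> graph_on s V \<subseteq> V \<times> V"
  by (auto simp: graph_on_def pairing_on_def)

text \<open>This is the condition of genus zero. Draw the pairing \<open>s\<close> by \<open>N\<close> chords of the circle \<open>L\<close> with
  \<open>2 N\<close> points. If the chords do not cross, they cut the disc into \<open>N + 1\<close> regions, which correspond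
  to the components of the two graphs; crossings leave fewer components.\<close>
definition planar :: "('v \<Rightarrow> 'v) \<Rightarrow> 'v list \<Rightarrow> bool" where
  "planar s L \<longleftrightarrow> even (length L) \<and>
    length L + 2 \<le> 2 * (num_components (set L) (alternate_edges L \<union> graph_on s (set L)) +
      num_components (set L) (alternate_edges (rotate1 L) \<union> graph_on s (set L)))"

lemma planar_rotate: "planar s L \<Longrightarrow> planar s (rotate n L)"
proof (induction n)
  case (Suc n)
  then show ?case by (simp add: planar_def alternate_edges_rotate_twice)
qed simp

text \<open>Deleting two paired neighbours shortens the circle by two points and lowers the number of
  components by one, in the sum of the two graphs.\<close>
lemma planar_remove_front:
  assumes pl: "planar s (x # y # v)" and s: "s x = y" "s y = x" "pairing_on s (set v)"
    and dist: "distinct (x # y # v)" and "v \<noteq> []"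
  shows "planar s v"
proof -
  let ?E = "graph_on s (set v)"
  have E: "?E \<subseteq> set v \<times> set v" by (rule graph_on_subset) (rule s)
  have ev: "even (length v)" using pl by (simp add: planar_def)
  obtain r v' where v': "v = r # v'" using \<open>v \<noteq> []\<close> by (cases v) auto
  then have "v' \<noteq> []" using ev by auto
  then obtain w p where w: "v = r # w @ [p]" using v' by (cases v' rule: rev_cases) auto
  then have evw: "even (length w)" using ev by simp
  have V: "set (x # y # v) = insert x (insert y (set v))" by simp
  have graph: "graph_on s (set (x # y # v)) = {(x, y), (y, x)} \<union> ?E" using s by (auto simp: graph_on_def)
  have "num_components (set (x # y # v)) (alternate_edges (x # y # v) \<union> graph_on s (set (x # y # v))) =
      num_components (set (x # y # v)) (insert (x, y) (alternate_edges v \<union> ?E))"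
    unfolding graph alternate_edges.simps by (rule num_components_symmetric_closure) blast
  also have "\<dots> = Suc (num_components (set v) (alternate_edges v \<union> ?E))"
    unfolding V using E alternate_edges_subset[of v] dist by (intro num_components_separate_edge) auto
  finally have a: "num_components (set (x # y # v)) (alternate_edges (x # y # v) \<union> graph_on s (set (x # y # v))) =
    Suc (num_components (set v) (alternate_edges v \<union> ?E))" .
  have alt1: "alternate_edges (rotate1 (x # y # v)) = {(y, r), (p, x)} \<union> alternate_edges w"
    and alt2: "alternate_edges (rotate1 v) = insert (p, r) (alternate_edges w)"
    using w evw by (auto simp: alternate_edges_append)
  have wv: "alternate_edges w \<subseteq> set v \<times> set v" using alternate_edges_subset[of w] w by auto
  have "num_components (set (x # y # v)) (alternate_edges (rotate1 (x # y # v)) \<union> graph_on s (set (x # y # v))) =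
      num_components (set (x # y # v)) ((alternate_edges w \<union> ?E) \<union> {(p, x), (x, y), (y, r)})"
    unfolding graph alt1 by (rule num_components_symmetric_closure) blast
  also have "\<dots> = num_components (set v) (insert (p, r) (alternate_edges w \<union> ?E))"
    unfolding V using E wv dist w by (intro num_components_subdivide) auto
  also have "insert (p, r) (alternate_edges w \<union> ?E) = alternate_edges (rotate1 v) \<union> ?E"
    unfolding alt2 by simp
  finally show ?thesis using pl a ev unfolding planar_def by simp
qed

lemma class_subset:
  assumes "R \<subseteq> V \<times> V" "C \<in> V // connected_in R"
  shows "C \<subseteq> V"
proof
  fix y assume "y \<in> C"
  then obtain x where x: "x \<in> V" "(x, y) \<in> connected_in R" using assms(2) by (auto simp: quotient_def)
  show "y \<in> V" using connected_in_closed[OF x(2,1)] assms(1) by auto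
qed

lemma class_disjoint:
  assumes "C \<in> V // connected_in R" "D \<in> V // connected_in R" "C \<noteq> D"
  shows "C \<inter> D = {}"
proof (rule ccontr)
  assume "C \<inter> D \<noteq> {}"
  moreover obtain x y where xy: "C = connected_in R `` {x}" "D = connected_in R `` {y}"
    using assms(1,2) by (auto simp: quotient_def)
  ultimately obtain z where z: "(x, z) \<in> connected_in R" "(y, z) \<in> connected_in R" by auto
  then have "C = connected_in R `` {z}" "D = connected_in R `` {z}" using xy class_eq_iff[of R] by metis+
  then show False using assms(3) by simp
qed

lemma sum_card_classes:
  assumes "finite V" "R \<subseteq> V \<times> V"
  shows "(\<Sum>C\<in>V // connected_in R. card C) = card V"
proof -
  have "\<Union>(V // connected_in R) = V"
  proof
    show "\<Union>(V // connected_in R) \<subseteq> V" using class_subset[OF assms(2)] by blast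
    show "V \<subseteq> \<Union>(V // connected_in R)"
    proof
      fix x assume "x \<in> V"
      then have "connected_in R `` {x} \<in> V // connected_in R" by (rule quotientI)
      moreover have "x \<in> connected_in R `` {x}" by simp
      ultimately show "x \<in> \<Union>(V // connected_in R)" by blast
    qed
  qed
  moreover have "card (\<Union>(V // connected_in R)) = (\<Sum>C\<in>V // connected_in R. card C)"
  proof (rule card_Union_disjoint)
    show "pairwise disjnt (V // connected_in R)"
      unfolding pairwise_def disjnt_def using class_disjoint[of _ V R] by blast
    show "finite C" if "C \<in> V // connected_in R" for C
      using class_subset[OF assms(2) that] assms(1) finite_subset by blast
  qed
  ultimately show ?thesis by simp
qed

text \<open>The set \<open>D\<close> is the one class that is allowed to have fewer than four points. It will be
  the pair of points joined by the edge that closes the circle.\<close>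
lemma num_components_large_classes:
  assumes fin: "finite V" "R \<subseteq> V \<times> V"
    and big: "\<And>C. C \<in> V // connected_in R \<Longrightarrow> C \<noteq> D \<Longrightarrow> 4 \<le> card C"
    and D: "D \<in> V // connected_in R \<Longrightarrow> 2 \<le> card D"
  shows "4 * num_components V R \<le> card V + (if D \<in> V // connected_in R then 2 else 0)"
proof -
  let ?Q = "V // connected_in R"
  have finQ: "finite ?Q" using fin(1) by (simp add: quotient_def)
  have "4 * card ?Q = (\<Sum>C\<in>?Q. 4)" by simp
  also have "\<dots> \<le> (\<Sum>C\<in>?Q. card C + (if C = D then 2 else 0))"
    using big D by (intro sum_mono) force
  also have "\<dots> = card V + (if D \<in> ?Q then 2 else 0)"
    using sum_card_classes[OF fin] finQ by (simp add: sum.distrib)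
  finally show ?thesis by (simp add: num_components_def)
qed

text \<open>If the neighbours \<open>x\<close> and \<open>y\<close> are not paired by \<open>s\<close>, then \<open>x\<close>, \<open>s x\<close>, \<open>y\<close>, \<open>s y\<close> are four
  distinct points of one class.\<close>
lemma class_card_ge_4:
  assumes s: "pairing_on s V" "graph_on s V \<subseteq> R" and fin: "finite V" "R \<subseteq> V \<times> V"
    and C: "C \<in> V // connected_in R" "x \<in> C"
    and xy: "(x, y) \<in> R \<or> (y, x) \<in> R" "y \<noteq> x" "y \<noteq> s x"
  shows "4 \<le> card C"
proof -
  have V: "x \<in> V" "y \<in> V" using class_subset[OF fin(2) C(1)] C(2) xy(1) fin(2) by auto
  have "C = connected_in R `` {x}"
  proof -
    have "connected_in R `` {x} \<in> V // connected_in R" using V(1) by (rule quotientI)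
    moreover have "x \<in> C \<inter> connected_in R `` {x}" using C(2) by simp
    ultimately show ?thesis using class_disjoint[OF C(1)] by blast
  qed
  moreover have "(z, s z) \<in> connected_in R" if "z \<in> V" for z
    using s(2) that by (auto intro!: connected_edge simp: graph_on_def)
  moreover have "(x, y) \<in> connected_in R" using xy(1) connected_edge connected_sym by metis
  ultimately have "{x, s x, y, s y} \<subseteq> C" using V connected_trans[of x y R "s y"] by auto
  moreover have "distinct [x, s x, y, s y]"
    using pairing_onD[OF s(1) V(1)] pairing_onD[OF s(1) V(2)] xy(2,3) by auto
  then have "card {x, s x, y, s y} = 4" using distinct_card[of "[x, s x, y, s y]"] by simp
  moreover have "finite C" using class_subset[OF fin(2) C(1)] fin(1) finite_subset by blast
  ultimately show ?thesis using card_mono by metis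
qed

text \<open>Otherwise all components have at least four points, except possibly for one component
  formed by the last and the first point of the list. Then the two graphs together have at most
  \<open>(4 N + 2) / 4 < N + 1\<close> components. The pair found lies in consecutive places of the list and not
  across its end, which matters for the division of the list into segments.\<close>
lemma planar_adjacent_pair:
  assumes pl: "planar s L" and dist: "distinct L" and s: "pairing_on s (set L)"
  shows "\<exists>u x v. L = u @ [x, s x] @ v"
proof (rule ccontr)
  assume no: "\<nexists>u x v. L = u @ [x, s x] @ v"
  let ?V = "set L" and ?D = "{hd L, last L}"
  let ?A = "alternate_edges L \<union> graph_on s (set L)" and ?B = "alternate_edges (rotate1 L) \<union> graph_on s (set L)"
  have sub: "?A \<subseteq> ?V \<times> ?V" "?B \<subseteq> ?V \<times> ?V"
    using graph_on_subset[OF s] alternate_edges_subset[of L] alternate_edges_subset[of "rotate1 L"] by auto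
  have ev: "even (length L)" "even (length (rotate1 L))" using pl by (simp_all add: planar_def)
  have adj: "x \<noteq> y \<and> y \<noteq> s x \<and> x \<noteq> s y" if "L = u @ [x, y] @ v" for u v x y
  proof -
    have "x \<in> set L" "y \<in> set L" "x \<noteq> y" using that dist by auto
    then show ?thesis using no that pairing_onD(2)[OF s] by metis
  qed
  have "4 \<le> card C" if C: "C \<in> ?V // connected_in ?A" for C
  proof -
    obtain x where "x \<in> ?V" "C = connected_in ?A `` {x}" using C by (rule quotientE)
    then have x: "x \<in> C" "x \<in> ?V" by simp_all
    obtain y where y: "(x, y) \<in> alternate_edges L \<or> (y, x) \<in> alternate_edges L"
      using alternate_edges_partner[OF ev(1) x(2)] by blast
    then have "y \<noteq> x" "y \<noteq> s x" using alternate_edges_adjacent[of _ _ L] adj by metis+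
    then show ?thesis using class_card_ge_4[OF s _ _ sub(1) C x(1), of y] y by auto
  qed
  moreover have "{} \<notin> ?V // connected_in ?A"
  proof
    assume "{} \<in> ?V // connected_in ?A"
    then obtain x where "{} = connected_in ?A `` {x}" by (rule quotientE)
    moreover have "x \<in> connected_in ?A `` {x}" by simp
    ultimately show False by blast
  qed
  ultimately have a: "4 * num_components ?V ?A \<le> length L"
    using num_components_large_classes[OF _ sub(1), of "{}"] distinct_card[OF dist] by simp
  have small: "C = ?D \<and> 2 \<le> card C \<or> 4 \<le> card C" if C: "C \<in> ?V // connected_in ?B" for C
  proof (cases "C \<subseteq> ?D")
    case True
    obtain x where x: "x \<in> ?V" "C = connected_in ?B `` {x}" using C by (auto simp: quotient_def)
    have "(x, s x) \<in> connected_in ?B" using x(1) by (auto intro!: connected_edge simp: graph_on_def)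
    then have xs: "{x, s x} \<subseteq> C" unfolding x(2) by simp
    have "card {x, s x} = 2" using pairing_onD(3)[OF s x(1)] by simp
    moreover have "finite C" using True finite_subset by blast
    ultimately have two: "2 \<le> card C" using card_mono[OF _ xs] by simp
    have "card ?D \<le> 2" by (simp add: card_insert_if)
    then have "C = ?D" using two True by (intro card_seteq) auto
    then show ?thesis using two by simp
  next
    case False
    then obtain x where x: "x \<in> C" "x \<noteq> hd L" "x \<noteq> last L" by auto
    have xV: "x \<in> ?V" using class_subset[OF sub(2) C] x(1) by auto
    obtain y where y: "(x, y) \<in> alternate_edges (rotate1 L) \<or> (y, x) \<in> alternate_edges (rotate1 L)"
      using alternate_edges_partner[OF ev(2)] xV by auto
    then have "y \<noteq> x" "y \<noteq> s x" using alternate_edges_rotate1_cases[of _ _ L] adj x by metis+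
    then show ?thesis using class_card_ge_4[OF s _ _ sub(2) C x(1), of y] y by auto
  qed
  have "4 * num_components ?V ?B \<le> card ?V + (if ?D \<in> ?V // connected_in ?B then 2 else 0)"
  proof (rule num_components_large_classes[OF _ sub(2)])
    show "4 \<le> card C" if "C \<in> ?V // connected_in ?B" "C \<noteq> ?D" for C using small that by blast
    show "2 \<le> card ?D" if "?D \<in> ?V // connected_in ?B" using small[OF that] by auto
  qed simp
  then have "4 * num_components ?V ?B \<le> length L + 2" using distinct_card[OF dist] by (auto split: if_splits)
  then show False using a pl unfolding planar_def by simp
qed

lemma planar_remove_adjacent:
  assumes "planar s (u @ [x, y] @ v)" "s x = y" "s y = x" "pairing_on s (set (u @ v))"
    and "distinct (u @ [x, y] @ v)" "u @ v \<noteq> []"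
  shows "planar s (u @ v)"
proof -
  have "planar s (x # y # v @ u)"
    using planar_rotate[OF assms(1), of "length u"] rotate_append[of u "[x, y] @ v"] by simp
  then have "planar s (v @ u)"
    by (rule planar_remove_front) (use assms in \<open>auto simp: Un_commute\<close>)
  then show ?thesis using planar_rotate[of s "v @ u" "length v"] by (simp add: rotate_append)
qed

text \<open>The induction removes a pair of neighbours at each step. Their parities \<open>par\<close> differ, so their
  colours \<open>col\<close> agree and they lie in the same segment. The segments stay nonempty until the
  removed pair is all that is left of one of them; that segment is stable, and it stays so when the
  removed pairs are put back.\<close>
lemma stable_segment_exists:
  fixes par :: "'v \<Rightarrow> bool" and col :: "'v \<Rightarrow> 'c"
  assumes "Ls \<noteq> []" "[] \<notin> set Ls" "distinct (concat Ls)" "planar s (concat Ls)"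
    and "pairing_on s (set (concat Ls))"
    and "successively (\<lambda>x y. par x \<noteq> par y) (concat Ls)"
    and "\<And>x. x \<in> set (concat Ls) \<Longrightarrow> par (s x) \<noteq> par x \<Longrightarrow> col (s x) = col x"
    and "successively (\<lambda>X Y. \<forall>a\<in>set X. \<forall>b\<in>set Y. col a \<noteq> col b) Ls"
  shows "\<exists>X\<in>set Ls. s ` set X \<subseteq> set X"
  using assms
proof (induction "length (concat Ls)" arbitrary: Ls rule: less_induct)
  case less
  note Ls = less.prems
  have s: "s z \<in> set (concat Ls)" "s (s z) = z" "s z \<noteq> z" if "z \<in> set (concat Ls)" for z
    using pairing_onD[OF Ls(5) that] by simp_all
  obtain u x v where uxv: "concat Ls = u @ [x, s x] @ v"
    using planar_adjacent_pair[OF Ls(4,3,5)] by blast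
  then have x: "x \<in> set (concat Ls)" by simp
  have "par x \<noteq> par (s x)" using Ls(6) unfolding uxv by (simp add: successively_append_iff)
  then have col: "col (s x) = col x" using Ls(7)[OF x] by simp
  obtain P X X' Q where PQ: "Ls = P @ (X @ X') # Q" "u @ [x] = concat P @ X" "s x # v = X' @ concat Q"
    using uxv concat_eq_append_conv[of Ls "u @ [x]" "s x # v"] Ls(1) by auto
  show ?case
  proof (cases "X = [] \<or> X' = []")
    case True
    \<comment> \<open>Impossible: the two points would lie in neighbouring segments, which have different colours.\<close>
    have "\<exists>P' Y Y' Q'. Ls = P' @ Y # Y' # Q' \<and> x \<in> set Y \<and> s x \<in> set Y'"
    proof (cases "X = []")
      case True
      then have uP: "u @ [x] = concat P" using PQ(2) by simp
      then obtain P' Y where P: "P = P' @ [Y]" by (cases P rule: rev_cases) auto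
      then have "Y \<noteq> []" using Ls(2) PQ(1) by auto
      moreover have "last (u @ [x]) = last (concat P' @ Y)" using uP P by simp
      ultimately have "x \<in> set Y" using last_in_set[of Y] by simp
      moreover have "X' \<noteq> []" using True PQ(1) Ls(2) by auto
      then have "s x \<in> set X'" using PQ(3) by (cases X') auto
      ultimately show ?thesis using PQ(1) P True by auto
    next
      case False
      then have X': "X' = []" using \<open>X = [] \<or> X' = []\<close> by simp
      then obtain Y' Q' where Q: "Q = Y' # Q'" using PQ(3) by (cases Q) auto
      then have "Y' \<noteq> []" using Ls(2) PQ(1) by auto
      then have "s x \<in> set Y'" using PQ(3) X' Q by (cases Y') auto
      moreover have "x \<in> set X" using PQ(2) False by (metis last_appendR last_in_set last_snoc)
      ultimately show ?thesis using PQ(1) X' Q by auto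
    qed
    then obtain P' Y Y' Q' where "Ls = P' @ Y # Y' # Q'" "x \<in> set Y" "s x \<in> set Y'" by blast
    then have "col x \<noteq> col (s x)" using Ls(8) by (auto simp: successively_append_iff)
    then show ?thesis using col by simp
  next
    case False
    then obtain Z where Z: "X = Z @ [x]" "u = concat P @ Z" using PQ(2)
      by (cases X rule: rev_cases) auto
    obtain Z' where Z': "X' = s x # Z'" "v = Z' @ concat Q" using PQ(3) False by (cases X') auto
    have Ls_eq: "Ls = P @ [Z @ [x, s x] @ Z'] @ Q" using PQ(1) Z Z' by simp
    show ?thesis
    proof (cases "Z @ Z' = []")
      case True
      then have "Ls = P @ [[x, s x]] @ Q" using Ls_eq by simp
      moreover have "s ` set [x, s x] \<subseteq> set [x, s x]" using s(2)[OF x] by simp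
      ultimately show ?thesis by (metis in_set_conv_decomp append_Cons append_Nil)
    next
      case ne: False
      define Ls' where "Ls' = P @ [Z @ Z'] @ Q"
      have uv: "concat Ls' = u @ v" using Z Z' by (simp add: Ls'_def)
      have V: "set (concat Ls) = {x, s x} \<union> set (u @ v)" using uxv by auto
      have dist: "distinct (u @ [x, s x] @ v)" using Ls(3) uxv by simp
      have pair: "pairing_on s (set (u @ v))" unfolding pairing_on_def
      proof
        fix z assume z: "z \<in> set (u @ v)"
        then have "z \<in> set (concat Ls)" "z \<noteq> x" "z \<noteq> s x" using V dist by auto
        then show "s z \<in> set (u @ v) \<and> s (s z) = z \<and> s z \<noteq> z"
          using s[of z] s(2)[OF x] V by (metis UnE empty_iff insert_iff)
      qed
      have "\<exists>X\<in>set Ls'. s ` set X \<subseteq> set X"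
      proof (rule less.hyps)
        show "length (concat Ls') < length (concat Ls)" using uv uxv by simp
        show "Ls' \<noteq> []" "[] \<notin> set Ls'" using Ls(2) ne unfolding Ls'_def Ls_eq by auto
        show "distinct (concat Ls')" using dist unfolding uv by auto
        show "planar s (concat Ls')" unfolding uv
          by (rule planar_remove_adjacent[of s u x "s x" v])
            (use Ls(4) uxv s(2)[OF x] pair dist ne Z Z' in auto)
        show "pairing_on s (set (concat Ls'))" unfolding uv by (rule pair)
        show "successively (\<lambda>x y. par x \<noteq> par y) (concat Ls')"
          using Ls(6) unfolding uxv uv by (cases v) (auto simp: successively_append_iff)
        show "col (s z) = col z" if "z \<in> set (concat Ls')" "par (s z) \<noteq> par z" for z
          using Ls(7)[of z] that V uv by auto
        show "successively (\<lambda>X Y. \<forall>a\<in>set X. \<forall>b\<in>set Y. col a \<noteq> col b) Ls'"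
          using Ls(8) unfolding Ls'_def Ls_eq by (cases Q) (auto simp: successively_append_iff)
      qed
      then obtain Y where Y: "Y \<in> set Ls'" "s ` set Y \<subseteq> set Y" by blast
      show ?thesis
      proof (cases "Y = Z @ Z'")
        case True
        then have "s ` set (Z @ [x, s x] @ Z') \<subseteq> set (Z @ [x, s x] @ Z')"
          using Y(2) s(2)[OF x] by auto
        then show ?thesis unfolding Ls_eq by (intro bexI[of _ "Z @ [x, s x] @ Z'"]) auto
      next
        case False
        then have "Y \<in> set Ls" using Y(1) unfolding Ls'_def Ls_eq by auto
        then show ?thesis using Y(2) by blast
      qed
    qed
  qed
qed

section \<open>Cycles drawn as rings of points\<close>

text \<open>The columns in \<open>J\<close> are those that carry a transposed letter; their two points are exchanged.
  Running through the columns of a cycle \<open>c\<close> and through the points of each column, the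
  identity and the cycle together trace out the circle \<open>col_points J c\<close>; \<open>ring_edges J c\<close> are the
  edges that come from the cycle.\<close>
definition flip :: "nat set \<Rightarrow> point \<Rightarrow> point" where
  "flip J = (\<lambda>(r, i). if i \<in> J then (1 - r, i) else (r, i))"

definition col_points :: "nat set \<Rightarrow> nat list \<Rightarrow> point list" where
  "col_points J c = concat (map (\<lambda>k. [flip J (1, k), flip J (0, k)]) c)"

definition ring_edges :: "nat set \<Rightarrow> nat list \<Rightarrow> (point \<times> point) set" where
  "ring_edges J c = (\<lambda>k. (flip J (0, k), flip J (1, cycle_of_list c k))) ` set c"

lemma flip_simps: "flip J (r, i) = (if i \<in> J then 1 - r else r, i)"
  by (simp add: flip_def)

lemma col_points_simps [simp]:
  "col_points J [] = []" "col_points J (k # c) = flip J (1, k) # flip J (0, k) # col_points J c"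
  "col_points J (c @ d) = col_points J c @ col_points J d"
  "length (col_points J c) = 2 * length c"
  "col_points J (concat cs) = concat (map (col_points J) cs)"
proof -
  show *: "col_points J [] = []" "col_points J (k # c) = flip J (1, k) # flip J (0, k) # col_points J c"
    "col_points J (c @ d) = col_points J c @ col_points J d" for k c d
    by (simp_all add: col_points_def)
  show "length (col_points J c) = 2 * length c" by (induction c) (simp_all add: *)
  show "col_points J (concat cs) = concat (map (col_points J) cs)" by (induction cs) (simp_all add: *)
qed

lemma set_col_points: "set (col_points J c) = {0, 1} \<times> set c"
  by (induction c) (auto simp: flip_simps)

lemma distinct_col_points: "distinct c \<Longrightarrow> distinct (col_points J c)"
  by (induction c) (auto simp: flip_simps set_col_points)

lemma alternate_edges_col_points:
  "alternate_edges (col_points J c) = (\<lambda>k. (flip J (1, k), flip J (0, k))) ` set c"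
  by (induction c) auto

lemma ring_edges_eq_alternate:
  assumes "distinct c"
  shows "ring_edges J c = alternate_edges (rotate1 (col_points J c))"
proof (cases c)
  case (Cons h t)
  have alt: "alternate_edges (flip J (0, h) # col_points J t @ [flip J (1, z)]) =
      set (zip (map (\<lambda>k. flip J (0, k)) (h # t)) (map (\<lambda>k. flip J (1, k)) (t @ [z])))" for h z t
    by (induction t arbitrary: h) simp_all
  have "ring_edges J c = set (zip (map (\<lambda>k. flip J (0, k)) c) (map (\<lambda>k. flip J (1, k)) (map (cycle_of_list c) c)))"
    by (auto simp: ring_edges_def zip_map1 zip_map2 zip_same_conv_map)
  also have "map (cycle_of_list c) c = rotate1 c" using cyclic_rotation[OF assms, of 1] by simp
  finally show ?thesis using alt[of h t h] Cons by simp
qed (simp add: ring_edges_def)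

lemma ring_edges_subset: "ring_edges J c \<subseteq> ({0, 1} \<times> set c) \<times> ({0, 1} \<times> set c)"
  using permutes_in_image[OF cycle_permutes[of c]] by (auto simp: ring_edges_def flip_simps split: if_splits)

lemma ring_edges_rotate:
  assumes "distinct (c @ d)"
  shows "ring_edges J (c @ d) = ring_edges J (d @ c)"
proof -
  have "cycle_of_list (c @ d) = cycle_of_list (d @ c)"
    using cycle_of_list_rotate_independent[OF assms, of "length c"] by (simp add: rotate_append)
  then show ?thesis by (simp add: ring_edges_def Un_commute)
qed

lemma col_points_ends:
  assumes "c \<noteq> []" "distinct c"
  obtains a b M where "col_points J c = a # M @ [b]" "even (length M)" "distinct (a # M @ [b])"
proof -
  obtain h t where "c = h # t" using assms(1) by (cases c) auto
  then obtain a R where R: "col_points J c = a # R" "R \<noteq> []" by simp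
  then obtain M b where M: "col_points J c = a # M @ [b]" by (cases R rule: rev_cases) auto
  have "even (length (col_points J c))" by simp
  then have "even (length M)" unfolding M by simp
  then show ?thesis using that[OF M] distinct_col_points[OF assms(2), of J] M by simp
qed

lemma pairing_on_even_card: "finite K \<Longrightarrow> pairing_on s K \<Longrightarrow> even (card K)"
proof (induction "card K" arbitrary: K rule: less_induct)
  case less
  show ?case
  proof (cases "K = {}")
    case False
    then obtain x where x: "x \<in> K" by blast
    note s = pairing_onD[OF less.prems(2)]
    have "pairing_on s (K - {x, s x})"
      unfolding pairing_on_def using s x by (metis Diff_iff insert_iff singletonD)
    moreover have "card (K - {x, s x}) < card K"
      using x less.prems(1) by (intro psubset_card_mono) auto
    ultimately have "even (card (K - {x, s x}))" using less by simp
    moreover have two: "card {x, s x} = 2" using s(3)[OF x] by simp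
    then have "card (K - {x, s x}) = card K - 2" using s(1)[OF x] x by (subst card_Diff_subset) auto
    moreover have "2 \<le> card K" using card_mono[of K "{x, s x}"] less.prems(1) s(1)[OF x] x two by simp
    ultimately show ?thesis by simp
  qed simp
qed

lemma alternate_edges_even_card:
  assumes "distinct M" "even (length M)" "\<And>x y. (x, y) \<in> alternate_edges M \<Longrightarrow> x \<in> K \<longleftrightarrow> y \<in> K"
  shows "even (card (K \<inter> set M))"
  using assms
proof (induction M rule: alternate_edges.induct)
  case (1 x y L)
  then have IH: "even (card (K \<inter> set L))" by auto
  have "x \<in> K \<longleftrightarrow> y \<in> K" using 1(4) by simp
  then have "K \<inter> set (x # y # L) = (if x \<in> K then {x, y} else {}) \<union> (K \<inter> set L)" by auto
  moreover have "card ({x, y} \<union> (K \<inter> set L)) = 2 + card (K \<inter> set L)"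
    using 1(2) by (subst card_Un_disjoint) auto
  ultimately show ?case using IH by auto
qed auto

text \<open>A component of the graph is closed under \<open>s\<close>, hence even. Along the path \<open>a, M, b\<close> the inner
  points are paired by \<open>alternate_edges M\<close>, so a component that contains \<open>a\<close> but not
  \<open>b\<close> would be odd.\<close>
lemma path_ends_connected:
  assumes "distinct (a # M @ [b])" "even (length M)" and s: "pairing_on s (set (a # M @ [b]))"
    and R: "alternate_edges M \<subseteq> R" "graph_on s (set (a # M @ [b])) \<subseteq> R"
  shows "(a, b) \<in> connected_in R"
proof (rule ccontr)
  assume ab: "(a, b) \<notin> connected_in R"
  define W where "W = set (a # M @ [b])"
  define K where "K = connected_in R `` {a} \<inter> W"
  have step: "(x, y) \<in> R \<Longrightarrow> (a, x) \<in> connected_in R \<longleftrightarrow> (a, y) \<in> connected_in R" for x y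
    using connected_edge connected_sym connected_trans by metis
  have "s x \<in> K" if "x \<in> K" for x
  proof -
    have "x \<in> W" using that by (simp add: K_def)
    then have "(x, s x) \<in> R" using R(2) by (auto simp: graph_on_def W_def)
    moreover have "s x \<in> W" using pairing_onD(1)[OF s] \<open>x \<in> W\<close> by (simp only: W_def)
    ultimately show ?thesis using step[of x "s x"] that unfolding K_def by blast
  qed
  then have "pairing_on s K" using s unfolding pairing_on_def W_def[symmetric] by (auto simp: K_def)
  then have "even (card K)" by (intro pairing_on_even_card) (simp_all add: K_def W_def)
  moreover have "K = insert a (connected_in R `` {a} \<inter> set M)" using ab by (auto simp: K_def W_def)
  then have "card K = Suc (card (connected_in R `` {a} \<inter> set M))" using assms(1) by simp
  moreover have "even (card (connected_in R `` {a} \<inter> set M))"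
    using step R(1) assms(1,2) by (intro alternate_edges_even_card) auto
  ultimately show False by simp
qed

text \<open>Merging two rings replaces the edges \<open>(oB, iB)\<close>, \<open>(oD, iD)\<close> by \<open>(oB, iD)\<close>, \<open>(oD, iB)\<close>, where \<open>iB\<close>
  and \<open>oB\<close> are the first and the last point of \<open>B\<close>, and \<open>iD\<close> and \<open>oD\<close> those of the rest. With any
  three of these four edges the four points are connected; so
  adding \<open>(oB, iD)\<close> to the graph of two rings gives the same components as adding \<open>(oB, iB)\<close> to the
  graph of the merged ring. Each addition costs at most one component. If neither \<open>s\<close> nor \<open>E\<close> leads out of
  the ring \<open>B\<close>, then the first addition costs exactly one component, and the second costs
  none, by \<open>path_ends_connected\<close>.\<close>
lemma num_components_ring_merge:
  fixes V :: "point set" and J :: "nat set" and E :: "(point \<times> point) set"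
  assumes V: "finite V" "{0, 1} \<times> set (A @ B @ C) \<subseteq> V" and s: "pairing_on s V"
    and dist: "distinct (A @ B @ C)" and ne: "B \<noteq> []" "A @ C \<noteq> []"
  defines "S \<equiv> num_components V (E \<union> ring_edges J (A @ C) \<union> ring_edges J B \<union> graph_on s V)"
    and "T \<equiv> num_components V (E \<union> ring_edges J (A @ B @ C) \<union> graph_on s V)"
  shows "S \<le> Suc T"
    and "s ` ({0, 1} \<times> set B) \<subseteq> {0, 1} \<times> set B \<Longrightarrow>
      E \<subseteq> (- ({0, 1} \<times> set B)) \<times> (- ({0, 1} \<times> set B)) \<Longrightarrow> S = Suc T"
proof -
  let ?W = "{0, 1 :: nat} \<times> set B"
  \<comment> \<open>Rotating the cycles reduces the claim to a block \<open>B\<close> at the front.\<close>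
  define D where "D = C @ A"
  have D: "distinct B" "distinct D" "D \<noteq> []" "distinct (B @ D)" "set B \<inter> set D = {}"
    using dist ne by (auto simp: D_def)
  obtain iB MB oB where B: "col_points J B = iB # MB @ [oB]" "even (length MB)" "distinct (iB # MB @ [oB])"
    using col_points_ends[OF ne(1) D(1)] by blast
  obtain iD MD oD where Dp: "col_points J D = iD # MD @ [oD]" "even (length MD)" "distinct (iD # MD @ [oD])"
    using col_points_ends[OF D(3,2)] by blast
  define P where "P = E \<union> alternate_edges MB \<union> alternate_edges MD \<union> graph_on s V"
  have in_B: "{iB, oB} \<union> set MB = ?W" using set_col_points[of J B] B(1) by auto
  have in_D: "{iD, oD} \<union> set MD = {0, 1} \<times> set D" using set_col_points[of J D] Dp(1) by auto
  have rB: "ring_edges J B = insert (oB, iB) (alternate_edges MB)"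
    using D(1) B by (simp add: ring_edges_eq_alternate alternate_edges_append)
  have "ring_edges J (A @ C) = ring_edges J D" unfolding D_def by (rule ring_edges_rotate) (use dist in auto)
  also have "\<dots> = insert (oD, iD) (alternate_edges MD)"
    using D(2) Dp by (simp add: ring_edges_eq_alternate alternate_edges_append)
  finally have rD: "ring_edges J (A @ C) = insert (oD, iD) (alternate_edges MD)" .
  have "ring_edges J (A @ B @ C) = ring_edges J (B @ D)"
    unfolding D_def using ring_edges_rotate[of A "B @ C" J] dist by simp
  also have "\<dots> = alternate_edges (MB @ [oB, iD] @ MD @ [oD, iB])"
    using D(4) B Dp by (simp add: ring_edges_eq_alternate)
  also have "\<dots> = {(oB, iD), (oD, iB)} \<union> alternate_edges MB \<union> alternate_edges MD"
    using B(2) Dp(2) by (auto simp: alternate_edges_append)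
  finally have rBD: "ring_edges J (A @ B @ C) = \<dots>" .
  have X: "E \<union> ring_edges J (A @ C) \<union> ring_edges J B \<union> graph_on s V = insert (oD, iD) (insert (oB, iB) P)"
    unfolding rB rD P_def by auto
  have Y: "E \<union> ring_edges J (A @ B @ C) \<union> graph_on s V = insert (oD, iB) (insert (oB, iD) P)"
    unfolding rBD P_def by auto
  let ?X = "insert (oD, iD) (insert (oB, iB) P)" and ?Y = "insert (oD, iB) (insert (oB, iD) P)"
  have inV: "oB \<in> V" "iB \<in> V" "oD \<in> V" "iD \<in> V"
  proof -
    have "?W \<subseteq> V" "{0, 1} \<times> set D \<subseteq> V" using V(2) by (auto simp: D_def)
    moreover have "{iB, oB} \<subseteq> ?W" "{iD, oD} \<subseteq> {0, 1} \<times> set D" using in_B in_D by blast+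
    ultimately show "oB \<in> V" "iB \<in> V" "oD \<in> V" "iD \<in> V" by blast+
  qed
  have "connected_in (insert (oB, iD) ?X) = connected_in (insert (oB, iB) ?Y)"
  proof (rule connected_in_eqI)
    have "(oD, iB) \<in> connected_in (insert (oB, iD) ?X)"
    proof (rule connected_trans)
      show "(oD, iD) \<in> connected_in (insert (oB, iD) ?X)" by (rule connected_edge) simp
      show "(iD, iB) \<in> connected_in (insert (oB, iD) ?X)"
        by (rule connected_trans[OF connected_sym[OF connected_edge] connected_edge, of oB]) simp_all
    qed
    then show "insert (oB, iB) ?Y \<subseteq> connected_in (insert (oB, iD) ?X)" by (auto intro: connected_edge)
    have "(oD, iD) \<in> connected_in (insert (oB, iB) ?Y)"
    proof (rule connected_trans)
      show "(oD, iB) \<in> connected_in (insert (oB, iB) ?Y)" by (rule connected_edge) simp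
      show "(iB, iD) \<in> connected_in (insert (oB, iB) ?Y)"
        by (rule connected_trans[OF connected_sym[OF connected_edge] connected_edge, of oB]) simp_all
    qed
    then show "insert (oB, iD) ?X \<subseteq> connected_in (insert (oB, iB) ?Y)" by (auto intro: connected_edge)
  qed
  then have eq: "num_components V (insert (oB, iD) ?X) = num_components V (insert (oB, iB) ?Y)"
    by (rule num_components_cong)
  show "S \<le> Suc T"
    unfolding S_def T_def X Y using eq num_components_insert_ge[OF V(1) inV(1,4), of ?X]
      num_components_insert_ge[OF V(1) inV(1,2), of ?Y] by simp
  assume W: "s ` ?W \<subseteq> ?W" "E \<subseteq> (- ?W) \<times> (- ?W)"
  have WV: "?W \<subseteq> V" using V(2) by auto
  have sW: "pairing_on s ?W" unfolding pairing_on_def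
  proof
    fix x assume x: "x \<in> ?W"
    then have "x \<in> V" using WV by (rule subsetD[rotated])
    moreover have "s x \<in> ?W" using W(1) x by (rule subsetD[OF _ imageI])
    ultimately show "s x \<in> ?W \<and> s (s x) = x \<and> s x \<noteq> x" using pairing_onD[OF s] by simp
  qed
  have "(oB, iD) \<notin> connected_in ?X"
  proof
    assume "(oB, iD) \<in> connected_in ?X"
    moreover have "oB \<in> ?W" using in_B by blast
    ultimately have "iD \<in> ?W"
    proof (rule connected_in_closed)
      fix u v assume "(u, v) \<in> ?X"
      then consider "(u, v) \<in> E" | "(u, v) \<in> ring_edges J B" | "(u, v) \<in> ring_edges J D" | "u \<in> V" "v = s u"
        unfolding X[symmetric] \<open>ring_edges J (A @ C) = ring_edges J D\<close> by (auto simp: graph_on_def)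
      then show "u \<in> ?W \<longleftrightarrow> v \<in> ?W"
      proof cases
        case 1
        then show ?thesis using W(2) by blast
      next
        case 2
        then show ?thesis using ring_edges_subset[of J B] by blast
      next
        case 3
        then show ?thesis using ring_edges_subset[of J D] D(5) by blast
      next
        case 4
        then show ?thesis using W(1) pairing_onD(2)[OF s 4(1)] by (metis image_subset_iff)
      qed
    qed
    moreover have "iD \<in> {0, 1} \<times> set D" using in_D by blast
    ultimately show False using D(5) by blast
  qed
  from num_components_insert_disconnected[OF V(1) inV(1,4) this]
  have "Suc (num_components V (insert (oB, iD) ?X)) = num_components V ?X" .
  moreover have "(iB, oB) \<in> connected_in ?Y"
  proof (rule path_ends_connected[OF B(3,2)])
    have WB: "set (iB # MB @ [oB]) = ?W" using in_B by auto
    show "pairing_on s (set (iB # MB @ [oB]))" unfolding WB by (rule sW)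
    show "graph_on s (set (iB # MB @ [oB])) \<subseteq> ?Y" unfolding WB P_def using WV by (auto simp: graph_on_def)
    show "alternate_edges MB \<subseteq> ?Y" by (auto simp: P_def)
  qed
  then have "num_components V (insert (oB, iB) ?Y) = num_components V ?Y"
    by (rule num_components_insert_connected[OF connected_sym])
  ultimately show "S = Suc T" unfolding S_def T_def X Y using eq by simp
qed

section \<open>Merging rings of alternating colours\<close>

lemma distinct_concat_filter:
  "distinct (concat (map f xs)) \<Longrightarrow> distinct (concat (map f (filter P xs)))"
  by (induction xs) auto

definition opposite :: "point \<Rightarrow> point" where
  "opposite x = (1 - fst x, snd x)"

lemma pairing_on_opposite: "pairing_on opposite ({0, 1} \<times> K)"
  by (auto simp: pairing_on_def opposite_def)

text \<open>The columns \<open>0, \<dots>, N - 1\<close> are divided into \<open>n\<close> consecutive blocks, one for each word.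
  As neighbouring blocks are nonempty, \<open>colour\<close> also forces each of them to lie entirely inside or
  entirely outside \<open>J\<close>.\<close>
locale coloured_blocks =
  fixes blk :: "nat \<Rightarrow> nat list" and n N :: nat and J :: "nat set"
  assumes n_pos: "0 < n"
    and blk_ne: "i < n \<Longrightarrow> blk i \<noteq> []"
    and concat_blk: "concat (map blk [0..<n]) = [0..<N]"
    and colour: "Suc i < n \<Longrightarrow> a \<in> set (blk i) \<Longrightarrow> b \<in> set (blk (Suc i)) \<Longrightarrow> a \<in> J \<longleftrightarrow> b \<notin> J"
begin

definition merged :: "nat set \<Rightarrow> nat list" where
  "merged I = concat (map blk (filter (\<lambda>i. i \<in> I) [0..<n]))"

definition ring_system :: "nat set \<Rightarrow> (point \<times> point) set" where
  "ring_system I = ring_edges J (merged I) \<union> (\<Union>i\<in>{..<n} - I. ring_edges J (blk i))"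

definition joint_components :: "(point \<Rightarrow> point) \<Rightarrow> nat set \<Rightarrow> nat" where
  "joint_components s I = num_components (points N) (ring_system I \<union> graph_on s (points N))"

lemma merged_all: "merged {..<n} = [0..<N]"
proof -
  have "filter (\<lambda>i. i \<in> {..<n}) [0..<n] = [0..<n]" by (rule filter_True) simp
  then show ?thesis by (simp add: merged_def concat_blk)
qed

lemma merged_empty: "merged {} = []"
  by (simp add: merged_def)

lemma merged_insert:
  assumes "i < n" "i \<notin> I"
  obtains A C where "merged I = A @ C" "merged (insert i I) = A @ blk i @ C"
proof -
  define A where "A = concat (map blk (filter (\<lambda>j. j \<in> I) [0..<i]))"
  define C where "C = concat (map blk (filter (\<lambda>j. j \<in> I) [Suc i..<n]))"
  have split: "[0..<n] = [0..<i] @ [i] @ [Suc i..<n]"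
    using assms(1) upt_add_eq_append[of 0 i "n - i"] by (simp add: upt_conv_Cons)
  have "filter (\<lambda>j. j \<in> insert i I) [0..<i] = filter (\<lambda>j. j \<in> I) [0..<i]"
    "filter (\<lambda>j. j \<in> insert i I) [Suc i..<n] = filter (\<lambda>j. j \<in> I) [Suc i..<n]"
    by (auto intro!: filter_cong)
  then have "merged I = A @ C" "merged (insert i I) = A @ blk i @ C"
    using assms(2) unfolding merged_def split A_def C_def by simp_all
  then show ?thesis by (rule that)
qed

lemma merged_single:
  assumes "i < n"
  shows "merged {i} = blk i"
proof -
  obtain A C where "merged {} = A @ C" "merged {i} = A @ blk i @ C"
    using merged_insert[OF assms, of "{}"] by auto
  then show ?thesis by (simp add: merged_empty)
qed

lemma distinct_merged: "distinct (merged I)"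
  unfolding merged_def using concat_blk by (intro distinct_concat_filter) simp

lemma set_merged: "set (merged I) \<subseteq> {..<N}"
proof -
  have "set (merged I) \<subseteq> set (concat (map blk [0..<n]))" by (auto simp: merged_def)
  then show ?thesis unfolding concat_blk by (simp add: atLeast0LessThan)
qed

lemma merged_ne: "i \<in> I \<Longrightarrow> i < n \<Longrightarrow> merged I \<noteq> []"
  using blk_ne by (auto simp: merged_def)

lemma blk_disjoint:
  assumes "i < n" "j < n" "i \<noteq> j"
  shows "set (blk i) \<inter> set (blk j) = {}"
proof -
  have "i \<notin> {j}" using assms(3) by simp
  from merged_insert[OF assms(1) this]
  obtain A C where "merged {j} = A @ C" "merged (insert i {j}) = A @ blk i @ C" .
  then show ?thesis using distinct_merged[of "insert i {j}"] merged_single[OF assms(2)] by auto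
qed

lemma ring_system_empty: "i < n \<Longrightarrow> ring_system {i} = ring_system {}"
  by (auto simp: ring_system_def merged_empty merged_single ring_edges_def[of J "[]"])

lemma finite_points_N: "finite (points N)"
  by (simp add: points_def)

lemma joint_components_insert:
  assumes I: "I \<subseteq> {..<n}" "I \<noteq> {}" and i: "i < n" "i \<notin> I" and s: "pairing_on s (points N)"
  shows "joint_components s I \<le> Suc (joint_components s (insert i I))"
    and "s ` ({0, 1} \<times> set (blk i)) \<subseteq> {0, 1} \<times> set (blk i) \<Longrightarrow>
      joint_components s I = Suc (joint_components s (insert i I))"
proof -
  obtain A C where AC: "merged I = A @ C" "merged (insert i I) = A @ blk i @ C" using merged_insert[OF i] .
  define E where "E = (\<Union>j\<in>{..<n} - insert i I. ring_edges J (blk j))"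
  have ins: "{..<n} - I = insert i ({..<n} - insert i I)" using i by auto
  have eq: "ring_system I = E \<union> ring_edges J (A @ C) \<union> ring_edges J (blk i)"
    "ring_system (insert i I) = E \<union> ring_edges J (A @ blk i @ C)"
    unfolding ring_system_def AC E_def by (subst ins, auto)
  have sub: "{0, 1} \<times> set (A @ blk i @ C) \<subseteq> points N"
    using set_merged[of "insert i I"] unfolding AC points_def by auto
  have ne: "A @ C \<noteq> []" using I merged_ne[of _ I] AC(1) by force
  have dist: "distinct (A @ blk i @ C)" using distinct_merged[of "insert i I"] AC(2) by simp
  note merge = num_components_ring_merge[OF finite_points_N sub s dist blk_ne[OF i(1)] ne, of E J]
  show "joint_components s I \<le> Suc (joint_components s (insert i I))"
    using merge(1) by (simp only: joint_components_def eq)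
  assume stable: "s ` ({0, 1} \<times> set (blk i)) \<subseteq> {0, 1} \<times> set (blk i)"
  have "E \<subseteq> (- ({0, 1} \<times> set (blk i))) \<times> (- ({0, 1} \<times> set (blk i)))"
  proof
    fix e assume "e \<in> E"
    then obtain j where j: "j < n" "j \<noteq> i" "e \<in> ring_edges J (blk j)" by (auto simp: E_def)
    then show "e \<in> (- ({0, 1} \<times> set (blk i))) \<times> (- ({0, 1} \<times> set (blk i)))"
      using ring_edges_subset[of J "blk j"] blk_disjoint[OF j(1) i(1) j(2)] by blast
  qed
  then show "joint_components s I = Suc (joint_components s (insert i I))"
    using merge(2)[OF stable] by (simp only: joint_components_def eq)
qed

lemma pairing_opposite: "pairing_on opposite (points N)"
  unfolding points_def by (rule pairing_on_opposite)

lemma joint_components_opposite: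
  assumes I: "I \<subseteq> {..<n}" "I \<noteq> {}" and i: "i < n" "i \<notin> I"
  shows "joint_components opposite I = Suc (joint_components opposite (insert i I))"
  by (rule joint_components_insert(2)[OF assms pairing_opposite]) (auto simp: opposite_def)

text \<open>With \<open>s\<close> the pairing of a permutation \<open>\<sigma>\<close>, this is \<open>\<sigma> \<le> q I\<close> expressed by numbers of components,
  see \<open>part_le_iff_geodesic\<close>.\<close>
definition geodesic :: "(point \<Rightarrow> point) \<Rightarrow> nat set \<Rightarrow> bool" where
  "geodesic s I \<longleftrightarrow> N + joint_components opposite I =
    num_components (points N) (graph_on opposite (points N) \<union> graph_on s (points N)) + joint_components s I"

text \<open>Adding blocks to \<open>I\<close> one at a time lowers the number of components with \<open>opposite\<close> by exactly
  one each time, and the number with \<open>s\<close> by at most one. The complement \<open>K\<close> of \<open>I\<close> is the convenient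
  variable of the induction.\<close>
lemma geodesic_excess_mono:
  assumes s: "pairing_on s (points N)" and "K \<subseteq> {..<n}" "K \<noteq> {..<n}"
  shows "joint_components s ({..<n} - K) + joint_components opposite {..<n} \<le>
    joint_components s {..<n} + joint_components opposite ({..<n} - K)"
proof -
  have "finite K" using assms(2) finite_subset by blast
  then show ?thesis using assms(2,3)
  proof (induction K)
    case (insert j K)
    have j: "{..<n} - K = insert j ({..<n} - insert j K)" "j < n" using insert by auto
    have K: "K \<noteq> {..<n}" "K \<subseteq> {..<n}" using insert j(2) by auto
    have I: "{..<n} - insert j K \<subseteq> {..<n}" "{..<n} - insert j K \<noteq> {}" "j \<notin> {..<n} - insert j K"
      using insert.prems by auto
    note step = joint_components_insert(1)[OF I(1,2) j(2) I(3) s] joint_components_opposite[OF I(1,2) j(2) I(3)]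
    show ?case using insert.IH[OF K(2,1)] step unfolding j(1) by linarith
  qed simp
qed

text \<open>By \<open>geodesic_excess_mono\<close> the condition for some \<open>I\<close> gives at least the planarity of \<open>s\<close> on the
  single circle through all columns. There \<open>par\<close> tells the first from the second point of
  a column, in the order of the circle, and \<open>colr\<close> tells whether the column is in \<open>J\<close>; a pairing that
  changes rows and parity preserves the colour.\<close>
lemma stable_block_exists:
  assumes s: "pairing_on s (points N)" and rows: "\<And>x. x \<in> points N \<Longrightarrow> fst (s x) \<noteq> fst x"
    and I: "I \<subseteq> {..<n}" "geodesic s I"
  shows "\<exists>i<n. s ` ({0, 1} \<times> set (blk i)) \<subseteq> {0, 1} \<times> set (blk i)"
proof -
  let ?V = "points N" and ?L = "col_points J [0..<N]"
  have L: "set ?L = ?V" by (simp add: set_col_points points_def atLeast0LessThan)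
  have "\<exists>I. I \<noteq> {} \<and> I \<subseteq> {..<n} \<and> geodesic s I"
  proof (cases "I = {}")
    case True
    \<comment> \<open>The empty set and a singleton give the same rings.\<close>
    then have "geodesic s {0}" using I(2) n_pos ring_system_empty[of 0]
      by (simp add: geodesic_def joint_components_def)
    then show ?thesis using n_pos by (intro exI[of _ "{0}"]) simp
  qed (use I in blast)
  then obtain I where I: "I \<noteq> {}" "I \<subseteq> {..<n}" "geodesic s I" by blast
  then have "{..<n} - ({..<n} - I) = I" "{..<n} - I \<noteq> {..<n}" by auto
  with geodesic_excess_mono[OF s, of "{..<n} - I"] I(3)
  have excess: "N + joint_components opposite {..<n} \<le>
      num_components ?V (graph_on opposite ?V \<union> graph_on s ?V) + joint_components s {..<n}"
    by (simp add: geodesic_def)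
  have Npos: "0 < N" using set_merged[of "{0}"] blk_ne[OF n_pos] merged_single[OF n_pos] by (cases N) auto
  have "?V // connected_in R \<noteq> {}" for R using Npos by (auto simp: points_def quotient_def)
  then have "joint_components opposite {..<n} \<ge> 1"
    using finite_points_N by (simp add: joint_components_def num_components_def Suc_le_eq card_gt_0_iff quotient_def)
  moreover have "num_components ?V (graph_on opposite ?V \<union> graph_on s ?V) =
      num_components ?V (alternate_edges ?L \<union> graph_on s ?V)"
  proof (rule num_components_symmetric_closure)
    have "graph_on opposite ?V \<union> (graph_on opposite ?V)\<inverse> = alternate_edges ?L \<union> (alternate_edges ?L)\<inverse>"
      unfolding alternate_edges_col_points by (auto simp: graph_on_def points_def flip_simps opposite_def image_iff split: if_splits)
    then show "graph_on opposite ?V \<union> graph_on s ?V \<union> (graph_on opposite ?V \<union> graph_on s ?V)\<inverse> =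
      alternate_edges ?L \<union> graph_on s ?V \<union> (alternate_edges ?L \<union> graph_on s ?V)\<inverse>" by blast
  qed
  moreover have "joint_components s {..<n} = num_components ?V (alternate_edges (rotate1 ?L) \<union> graph_on s ?V)"
    by (simp add: joint_components_def ring_system_def merged_all ring_edges_eq_alternate)
  ultimately have planar: "planar s ?L" using excess unfolding planar_def L by simp
  define Ls where "Ls = map (\<lambda>i. col_points J (blk i)) [0..<n]"
  have concat_Ls: "concat Ls = ?L" unfolding concat_blk[symmetric] by (simp add: Ls_def comp_def)
  define par :: "point \<Rightarrow> bool" where "par x \<longleftrightarrow> (fst x = 1) \<noteq> (snd x \<in> J)" for x
  define colr :: "point \<Rightarrow> bool" where "colr x \<longleftrightarrow> snd x \<in> J" for x
  have par: "par (flip J (r, i)) \<longleftrightarrow> r = 1" if "r = 0 \<or> r = 1" for r i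
    using that by (auto simp: par_def flip_simps)
  have "\<exists>X\<in>set Ls. s ` set X \<subseteq> set X"
  proof (rule stable_segment_exists[where par = par and col = colr])
    show "Ls \<noteq> []" using n_pos by (simp add: Ls_def)
    show "[] \<notin> set Ls"
    proof
      assume "[] \<in> set Ls"
      then obtain i where i: "i < n" "col_points J (blk i) = []" by (auto simp: Ls_def)
      then have "length (col_points J (blk i)) = 0" by simp
      then show False using blk_ne[OF i(1)] by simp
    qed
    show "distinct (concat Ls)" unfolding concat_Ls by (simp add: distinct_col_points)
    show "planar s (concat Ls)" unfolding concat_Ls by (rule planar)
    show "pairing_on s (set (concat Ls))" unfolding concat_Ls L by (rule s)
    have "successively (\<lambda>x y. par x \<noteq> par y) (col_points J c)" for c
    proof (induction c)
      case (Cons k c)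
      then show ?case by (cases c) (simp_all add: par)
    qed simp
    then show "successively (\<lambda>x y. par x \<noteq> par y) (concat Ls)" unfolding concat_Ls .
    show "colr (s x) = colr x" if "x \<in> set (concat Ls)" "par (s x) \<noteq> par x" for x
    proof -
      have x: "x \<in> ?V" using that(1) unfolding concat_Ls L .
      then have "fst x \<in> {0, 1}" "fst (s x) \<in> {0, 1}" "fst (s x) \<noteq> fst x"
        using pairing_onD(1)[OF s x] rows[OF x] by (auto simp: points_def)
      then show ?thesis using that(2) by (auto simp: par_def colr_def)
    qed
    have "successively (\<lambda>i j. \<forall>a\<in>set (col_points J (blk i)). \<forall>b\<in>set (col_points J (blk j)). colr a \<noteq> colr b)
        [0..<k]" if "k \<le> n" for k
      using that
    proof (induction k)
      case (Suc k)
      show ?case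
      proof (cases k)
        case (Suc k')
        then have "\<forall>a\<in>set (col_points J (blk k')). \<forall>b\<in>set (col_points J (blk k)). colr a \<noteq> colr b"
          using colour[of k'] Suc.prems by (auto simp: set_col_points colr_def)
        then show ?thesis using Suc.IH Suc.prems Suc by (simp add: successively_append_iff)
      qed simp
    qed simp
    then show "successively (\<lambda>X Y. \<forall>a\<in>set X. \<forall>b\<in>set Y. colr a \<noteq> colr b) Ls"
      by (simp add: Ls_def successively_map)
  qed
  then show ?thesis by (auto simp: Ls_def set_col_points)
qed

theorem geodesic_toggle:
  assumes s: "pairing_on s (points N)" and rows: "\<And>x. x \<in> points N \<Longrightarrow> fst (s x) \<noteq> fst x"
  obtains "\<And>I. I \<subseteq> {..<n} \<Longrightarrow> \<not> geodesic s I"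
  | i where "i < n" "\<And>I. I \<subseteq> {..<n} \<Longrightarrow> i \<notin> I \<Longrightarrow> geodesic s (insert i I) \<longleftrightarrow> geodesic s I"
proof (cases "\<exists>I. I \<subseteq> {..<n} \<and> geodesic s I")
  case False
  then show ?thesis using that(1) by blast
next
  case True
  then obtain i where i: "i < n" "s ` ({0, 1} \<times> set (blk i)) \<subseteq> {0, 1} \<times> set (blk i)"
    using stable_block_exists[OF s rows] by blast
  have "geodesic s (insert i I) \<longleftrightarrow> geodesic s I" if I: "I \<subseteq> {..<n}" "i \<notin> I" for I
  proof (cases "I = {}")
    case True
    then show ?thesis using ring_system_empty[OF i(1)] by (simp add: geodesic_def joint_components_def)
  next
    case False
    then show ?thesis
      using joint_components_insert(2)[OF I(1) False i(1) I(2) s i(2)]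
        joint_components_opposite[OF I(1) False i(1) I(2)] by (simp add: geodesic_def)
  qed
  then show ?thesis using that(2) i(1) by blast
qed

end

section \<open>Pair partitions as edge sets\<close>

definition pairs :: "(point \<times> point) set \<Rightarrow> part" where
  "pairs E = (\<lambda>(x, y). {x, y}) ` E"

lemma part_join_pairs:
  "part_join (pairs E) (pairs E') = (\<Union>(pairs E) \<union> \<Union>(pairs E')) // connected_in (E \<union> E')"
proof -
  have "(same_block (pairs E) \<union> same_block (pairs E'))\<^sup>* = connected_in (E \<union> E')"
    unfolding connected_in_def by (rule rtrancl_subset) (auto simp: same_block_def pairs_def)
  then show ?thesis by (simp add: part_join_def)
qed

definition perm_pairing :: "(nat \<Rightarrow> nat) \<Rightarrow> point \<Rightarrow> point" where
  "perm_pairing \<tau> x = (if fst x = 0 then (1, \<tau> (snd x)) else (0, inv \<tau> (snd x)))"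

lemma perm_pairing:
  assumes "\<tau> permutes {..<N}"
  shows "pairing_on (perm_pairing \<tau>) (points N)" "fst (perm_pairing \<tau> x) \<noteq> fst x"
proof -
  have "\<tau> i < N \<longleftrightarrow> i < N" "inv \<tau> i < N \<longleftrightarrow> i < N" for i
    using permutes_in_image[OF assms] permutes_in_image[OF permutes_inv[OF assms]] by auto
  then show "pairing_on (perm_pairing \<tau>) (points N)"
    using permutes_inverses[OF assms] by (auto simp: pairing_on_def perm_pairing_def points_def)
qed (simp add: perm_pairing_def)

text \<open>Each edge occurs in both directions, as \<open>perm_pairing \<tau>\<close> is an involution.\<close>
lemma perm_part_eq_pairs:
  assumes "\<tau> permutes {..<N}"
  shows "perm_part N \<tau> = pairs (graph_on (perm_pairing \<tau>) (points N))"
proof -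
  have bottom: "{(1, j), (0, inv \<tau> j)} \<in> perm_part N \<tau>" if "j < N" for j
  proof -
    have "inv \<tau> j < N" "\<tau> (inv \<tau> j) = j"
      using that permutes_in_image[OF permutes_inv[OF assms], of j] permutes_inverses[OF assms] by auto
    then show ?thesis unfolding perm_part_def by (intro image_eqI[of _ _ "inv \<tau> j"]) auto
  qed
  have "pairs (graph_on (perm_pairing \<tau>) (points N)) =
      (\<lambda>i. {(0, i), (1, \<tau> i)}) ` {..<N} \<union> (\<lambda>j. {(1, j), (0, inv \<tau> j)}) ` {..<N}"
    unfolding points_def graph_on_def pairs_def image_image
    by (simp add: Sigma_Un_distrib1 insert_Times_insert perm_pairing_def image_Un image_image Times_insert_right flip: insert_is_Un)
      (auto simp: perm_pairing_def image_iff)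
  then show ?thesis using bottom by (auto simp: perm_part_def)
qed

lemma id_part_eq_pairs: "id_part N = pairs (graph_on opposite (points N))"
  by (auto simp: id_part_def perm_part_def pairs_def graph_on_def opposite_def points_def image_iff)

lemma relabel_flip_perm_part:
  "relabel (flip J) (perm_part N \<pi>) = pairs ((\<lambda>k. (flip J (0, k), flip J (1, \<pi> k))) ` {..<N})"
  by (simp add: relabel_def perm_part_def pairs_def image_image)

lemma perm_part_in_all_parts: "\<pi> permutes {..<N} \<Longrightarrow> perm_part N \<pi> \<in> all_parts N"
  unfolding all_parts_def mem_Collect_eq
proof (rule partition_onI)
  assume \<pi>: "\<pi> permutes {..<N}"
  then have im: "\<pi> ` {..<N} = {..<N}" by (rule permutes_image)
  have "\<Union>(perm_part N \<pi>) = {0} \<times> {..<N} \<union> {1} \<times> \<pi> ` {..<N}" by (auto simp: perm_part_def)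
  then show "\<Union>(perm_part N \<pi>) = points N" unfolding im points_def by auto
  show "disjnt p q" if "p \<in> perm_part N \<pi>" "q \<in> perm_part N \<pi>" "p \<noteq> q" for p q
    using that permutes_inj[OF \<pi>] by (auto simp: perm_part_def disjnt_def dest: injD)
qed (auto simp: perm_part_def)

lemma card_perm_part: "card (perm_part N \<pi>) = N"
proof -
  have "inj_on (\<lambda>i. {(0, i), (1, \<pi> i)} :: point set) {..<N}" by (auto simp: inj_on_def doubleton_eq_iff)
  then show ?thesis by (simp add: perm_part_def card_image)
qed

lemma flip_points: "x \<in> points N \<Longrightarrow> flip J x \<in> points N \<and> flip J (flip J x) = x"
  by (cases x) (auto simp: points_def flip_simps)

lemma bij_betw_flip: "bij_betw (flip J) (points N) (points N)"
  by (rule bij_betw_byWitness[of _ "flip J"]) (auto simp: flip_points)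

lemma relabel_points:
  assumes "p \<in> all_parts N" "bij_betw f (points N) (points N)"
  shows "relabel f p \<in> all_parts N" "card (relabel f p) = card p" "b \<in> p \<Longrightarrow> card (f ` b) = card b"
proof -
  have p: "partition_on (points N) p" using assms(1) by (simp add: all_parts_def)
  have inj: "inj_on f (points N)" "f ` points N = points N" using assms(2) by (auto simp: bij_betw_def)
  have "(`) f ` p - {{}} = relabel f p" using partition_onD3[OF p] by (auto simp: relabel_def)
  then show "relabel f p \<in> all_parts N"
    using partition_on_inj_image[OF p inj(1)] by (simp add: all_parts_def inj(2))
  have "inj_on f (\<Union>p)" using inj(1) partition_onD1[OF p] by simp
  then show "card (relabel f p) = card p" unfolding relabel_def by (intro card_image inj_on_image)
  show "card (f ` b) = card b" if "b \<in> p"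
  proof -
    have "b \<subseteq> points N" using that partition_onD1[OF p] by blast
    then show ?thesis using inj_on_subset[OF inj(1)] card_image by blast
  qed
qed

lemma part_le_perm_part_iff:
  fixes J :: "nat set"
  assumes \<tau>: "\<tau> permutes {..<N}" and \<pi>: "\<pi> permutes {..<N}"
  defines "Q \<equiv> (\<lambda>k. (flip J (0, k), flip J (1, \<pi> k))) ` {..<N}" and "s \<equiv> perm_pairing \<tau>"
    and "V \<equiv> points N"
  shows "part_le N (perm_part N \<tau>) (relabel (flip J) (perm_part N \<pi>)) \<longleftrightarrow>
    N + num_components V (Q \<union> graph_on opposite V) =
    num_components V (graph_on opposite V \<union> graph_on s V) + num_components V (Q \<union> graph_on s V)"
proof -
  have q: "relabel (flip J) (perm_part N \<pi>) = pairs Q" unfolding Q_def by (rule relabel_flip_perm_part)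
  have id: "id_part N = pairs (graph_on opposite V)" unfolding V_def by (rule id_part_eq_pairs)
  have \<sigma>: "perm_part N \<tau> = pairs (graph_on s V)" unfolding V_def s_def by (rule perm_part_eq_pairs[OF \<tau>])
  have all: "pairs Q \<in> all_parts N" "pairs (graph_on opposite V) \<in> all_parts N" "pairs (graph_on s V) \<in> all_parts N"
    using relabel_points(1)[OF perm_part_in_all_parts[OF \<pi>] bij_betw_flip[of J]] id_part_in[of N]
      perm_part_in_all_parts[OF \<tau>] unfolding q id \<sigma> by simp_all
  then have U: "\<Union>(pairs Q) = V" "\<Union>(pairs (graph_on opposite V)) = V" "\<Union>(pairs (graph_on s V)) = V"
    by (auto simp: all_parts_def V_def dest: partition_onD1)
  have card: "card (pairs Q) = N" "card (pairs (graph_on opposite V)) = N" "card (pairs (graph_on s V)) = N"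
    using relabel_points(2)[OF perm_part_in_all_parts[OF \<pi>] bij_betw_flip[of J]] card_perm_part[of N]
    unfolding q[symmetric] id[symmetric] \<sigma>[symmetric] by (simp_all add: id_part_def)
  have arith: "((real N + real N) / 2 - real a + ((real N + real N) / 2 - real b) = (real N + real N) / 2 - real c) \<longleftrightarrow>
      N + c = a + b" for a b c :: nat
  proof -
    have "N + c = a + b \<longleftrightarrow> real N + real c = real a + real b" by (simp flip: of_nat_add)
    then show ?thesis by auto
  qed
  show ?thesis
    unfolding part_le_def part_dist_def q id \<sigma> card part_join_pairs U Un_absorb
      num_components_def[symmetric] arith
    by (simp add: Un_commute)
qed

section \<open>Permutations given by their cycles\<close>

definition cycles :: "nat list list \<Rightarrow> nat \<Rightarrow> nat" where
  "cycles cs = foldr (\<lambda>c f. cycle_of_list c \<circ> f) cs id"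

lemma cycles_simps [simp]: "cycles [] = id" "cycles (c # cs) = cycle_of_list c \<circ> cycles cs"
  by (simp_all add: cycles_def)

lemma cycles_permutes: "cycles cs permutes set (concat cs)"
proof (induction cs)
  case (Cons c cs)
  have "cycle_of_list c permutes set (concat (c # cs))" "cycles cs permutes set (concat (c # cs))"
    by (rule permutes_subset[OF cycle_permutes] permutes_subset[OF Cons], simp)+
  then show ?case using permutes_compose by (metis cycles_simps(2))
qed (simp only: cycles_simps permutes_id)

lemma cycles_apply:
  "distinct (concat cs) \<Longrightarrow> c \<in> set cs \<Longrightarrow> k \<in> set c \<Longrightarrow> cycles cs k = cycle_of_list c k"
proof (induction cs)
  case (Cons d cs)
  show ?case
  proof (cases "k \<in> set d")
    case True
    then have "k \<notin> set (concat cs)" using Cons.prems(1) by auto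
    then have "cycles cs k = k" by (rule permutes_not_in[OF cycles_permutes])
    moreover have "c = d" using Cons.prems \<open>k \<notin> set (concat cs)\<close> by auto
    ultimately show ?thesis by simp
  next
    case False
    then have c: "c \<in> set cs" using Cons.prems by auto
    then have "cycle_of_list c k \<in> set (concat cs)"
      using permutes_in_image[OF cycle_permutes[of c], of k] Cons.prems(3) by auto
    then have "cycle_of_list c k \<notin> set d" using Cons.prems(1) by auto
    then show ?thesis using Cons c by (simp add: id_outside_supp)
  qed
qed simp

lemma ring_edges_cycles:
  assumes "distinct (concat cs)"
  shows "(\<lambda>k. (flip J (0, k), flip J (1, cycles cs k))) ` set (concat cs) = (\<Union>c\<in>set cs. ring_edges J c)"
proof -
  have "(\<lambda>k. (flip J (0, k), flip J (1, cycles cs k))) ` set (concat cs) =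
      (\<Union>c\<in>set cs. (\<lambda>k. (flip J (0, k), flip J (1, cycles cs k))) ` set c)" by auto
  also have "\<dots> = (\<Union>c\<in>set cs. ring_edges J c)"
    unfolding ring_edges_def by (intro SUP_cong image_cong refl) (simp add: cycles_apply[OF assms])
  finally show ?thesis .
qed

lemma cycles_map: "inj f \<Longrightarrow> cycles (map (map f) cs) (f x) = f (cycles cs x)"
proof (induction cs)
  case (Cons c cs)
  have "cycle_of_list (map f c) (f x) = f (cycle_of_list c x)" for x
    by (induction c arbitrary: x rule: cycle_of_list.induct)
      (simp_all add: transpose_def inj_eq[OF Cons.prems])
  then show ?case using Cons by simp
qed simp

context coloured_blocks
begin

text \<open>The partition \<open>q I\<close> of the introduction is
  \<open>relabel (flip J) (perm_part N (cycles (ring_lists I)))\<close>.\<close>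
definition ring_lists :: "nat set \<Rightarrow> nat list list" where
  "ring_lists I = merged I # map blk (filter (\<lambda>i. i \<notin> I) [0..<n])"

lemma ring_lists:
  shows "distinct (concat (ring_lists I))" "set (concat (ring_lists I)) = {..<N}"
proof -
  have eq: "concat (ring_lists I) = merged I @ merged (- I)" by (simp add: ring_lists_def merged_def)
  have "set (merged I) \<inter> set (merged (- I)) = {}"
  proof (rule ccontr)
    assume "set (merged I) \<inter> set (merged (- I)) \<noteq> {}"
    then obtain x i j where "x \<in> set (blk i)" "x \<in> set (blk j)" "i < n" "j < n" "i \<in> I" "j \<notin> I"
      by (auto simp: merged_def)
    then show False using blk_disjoint[of i j] by auto
  qed
  then show "distinct (concat (ring_lists I))" unfolding eq by (simp add: distinct_merged)
  have "set (merged I) \<union> set (merged (- I)) = set (concat (map blk [0..<n]))" by (auto simp: merged_def)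
  then show "set (concat (ring_lists I)) = {..<N}"
    unfolding eq concat_blk by (simp add: atLeast0LessThan)
qed

lemma ring_lists_permutes: "cycles (ring_lists I) permutes {..<N}"
  using cycles_permutes[of "ring_lists I"] unfolding ring_lists(2) .

lemma part_le_iff_geodesic:
  assumes "\<tau> permutes {..<N}"
  shows "part_le N (perm_part N \<tau>) (relabel (flip J) (perm_part N (cycles (ring_lists I)))) \<longleftrightarrow>
    geodesic (perm_pairing \<tau>) I"
proof -
  have "(\<lambda>k. (flip J (0, k), flip J (1, cycles (ring_lists I) k))) ` {..<N} = ring_system I"
    using ring_edges_cycles[OF ring_lists(1)[of I], of J] unfolding ring_lists(2)
    by (auto simp: ring_lists_def ring_system_def)
  then show ?thesis using part_le_perm_part_iff[OF assms ring_lists_permutes[of I], of J]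
    by (simp add: geodesic_def joint_components_def)
qed

end

section \<open>Moments of letters and transposed letters\<close>

definition transposed_at :: "('a \<Rightarrow> 'a) \<Rightarrow> nat set \<Rightarrow> 'a list \<Rightarrow> 'a list" where
  "transposed_at t J as = map (\<lambda>i. if i \<in> J then t (as ! i) else as ! i) [0..<length as]"

lemma length_transposed_at [simp]: "length (transposed_at t J as) = length as"
  by (simp add: transposed_at_def)

lemma nth_transposed_at [simp]:
  "i < length as \<Longrightarrow> transposed_at t J as ! i = (if i \<in> J then t (as ! i) else as ! i)"
  by (simp add: transposed_at_def)

lemma relabel_relabel: "relabel f (relabel g p) = relabel (f \<circ> g) p"
  by (simp add: relabel_def image_image image_comp)

lemma relabel_cong:
  assumes "p \<in> all_parts k" "\<And>x. x \<in> points k \<Longrightarrow> f x = g x"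
  shows "relabel f p = relabel g p"
proof -
  have "f ` b = g ` b" if "b \<in> p" for b
    using that assms by (intro image_cong) (auto simp: all_parts_def partition_on_def)
  then show ?thesis by (simp add: relabel_def)
qed

lemma part_transpose_eq_flip: "part_transpose k1 p = relabel (flip {k1..}) p"
  by (simp add: part_transpose_def flip_def)

lemma relabel_flip_flip:
  assumes "p \<in> all_parts k" "J \<inter> K = {}"
  shows "relabel (flip J) (relabel (flip K) p) = relabel (flip (J \<union> K)) p"
    and "relabel (flip K) (relabel (flip (J \<union> K)) p) = relabel (flip J) p"
  unfolding relabel_relabel using assms(2)
  by (auto intro!: relabel_cong[OF assms(1)] simp: flip_simps points_def split: if_splits)

lemma part_tensor_perm_parts:
  assumes "\<And>i. i < k1 \<Longrightarrow> \<pi> i = \<pi>1 i" "\<And>i. i < k2 \<Longrightarrow> \<pi> (k1 + i) = k1 + \<pi>2 i"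
  shows "part_tensor k1 (perm_part k1 \<pi>1) (perm_part k2 \<pi>2) = perm_part (k1 + k2) \<pi>"
proof -
  have "{..<k1 + k2} = {..<k1} \<union> (+) k1 ` {..<k2}"
    by (auto simp: image_iff lessThan_def) (metis add_diff_inverse_nat add_less_cancel_left)
  then have "perm_part (k1 + k2) \<pi> = (\<lambda>i. {(0, i), (1, \<pi> i)}) ` {..<k1} \<union>
      (\<lambda>i. {(0, k1 + i), (1, \<pi> (k1 + i))}) ` {..<k2}"
    by (simp add: perm_part_def image_Un image_image)
  also have "\<dots> = part_tensor k1 (perm_part k1 \<pi>1) (perm_part k2 \<pi>2)"
    using assms by (simp add: part_tensor_def perm_part_def relabel_def image_image)
  finally show ?thesis by simp
qed

locale transposed_algebra = tracial_algebra scale \<A> m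
  for scale :: "complex \<Rightarrow> 'a::ring \<Rightarrow> 'a" and \<A> m +
  fixes t :: "'a \<Rightarrow> 'a" and F :: "'a set"
  assumes cases: "\<A> \<in> {all_parts, pair_parts, even_parts, short_parts}"
    and transpose: "transpose_operation scale \<A> m t"
    and det: "deterministic scale \<A> m F"
begin

lemma in_all_parts: "p \<in> \<A> k \<Longrightarrow> p \<in> all_parts k"
  using cases by (auto simp: pair_parts_def even_parts_def short_parts_def)

lemma relabel_in_A:
  assumes "p \<in> \<A> k" "bij_betw f (points k) (points k)"
  shows "relabel f p \<in> \<A> k"
  using relabel_points[OF in_all_parts[OF assms(1)] assms(2)] cases assms(1)
  by (auto simp: pair_parts_def even_parts_def short_parts_def relabel_def)

lemma perm_part_in_A:
  assumes "\<pi> permutes {..<k}"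
  shows "perm_part k \<pi> \<in> \<A> k"
proof -
  have "card b = 2" if "b \<in> perm_part k \<pi>" for b using that by (auto simp: perm_part_def)
  then show ?thesis using perm_part_in_all_parts[OF assms] cases
    by (auto simp: pair_parts_def even_parts_def short_parts_def)
qed

lemma moment_transpose_suffix:
  assumes "p \<in> \<A> k" "length as = k" "k1 \<le> k"
  shows "m p (take k1 as @ map t (drop k1 as)) = m (relabel (flip {k1..}) p) as"
proof (cases "k1 = k")
  case True
  have "relabel (flip {k..}) p = relabel id p"
    by (rule relabel_cong[OF in_all_parts[OF assms(1)]]) (auto simp: points_def flip_simps)
  then show ?thesis using True assms(2) by (simp add: relabel_def)
next
  case False
  then have "k1 < k" using assms(3) by simp
  then show ?thesis using transpose assms(1,2) unfolding transpose_operation_def part_transpose_eq_flip by blast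
qed

text \<open>The defining property of a transpose operation concerns all places from some \<open>k1\<close> on. Comparing
  \<open>k1 = i\<close> with \<open>k1 = Suc i\<close> isolates the single place \<open>i\<close>.\<close>
lemma moment_transpose_one:
  assumes p: "p \<in> \<A> k" and as: "length as = k" "i < k"
  shows "m p (as[i := t (as ! i)]) = m (relabel (flip {i}) p) as"
proof -
  let ?L = "as[i := t (as ! i)]" and ?p' = "relabel (flip {Suc i..}) p"
  have p': "?p' \<in> \<A> k" by (rule relabel_in_A[OF p bij_betw_flip])
  have "p = relabel (flip {Suc i..}) ?p'"
    using relabel_flip_flip(2)[OF in_all_parts[OF p], of "{}" "{Suc i..}"]
      relabel_cong[OF in_all_parts[OF p], of "flip {}" id]
    by (simp add: flip_def relabel_def)
  then have "m p ?L = m (relabel (flip {Suc i..}) ?p') ?L" by simp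
  also have "\<dots> = m ?p' (take (Suc i) ?L @ map t (drop (Suc i) ?L))"
    using moment_transpose_suffix[OF p', of ?L "Suc i"] as by simp
  also have "take (Suc i) ?L @ map t (drop (Suc i) ?L) = take i as @ map t (drop i as)"
    using as by (simp add: take_Suc_conv_app_nth flip: Cons_nth_drop_Suc)
  also have "m ?p' \<dots> = m (relabel (flip {i..}) ?p') as"
    by (rule moment_transpose_suffix[OF p']) (use as in simp_all)
  also have "relabel (flip {i..}) ?p' = relabel (flip {i}) p"
    unfolding relabel_relabel
    by (rule relabel_cong[OF in_all_parts[OF p]]) (auto simp: points_def flip_simps split: if_splits)
  finally show ?thesis .
qed

lemma moment_transposed_at:
  assumes p: "p \<in> \<A> k" and as: "length as = k" and J: "J \<subseteq> {..<k}"
  shows "m p (transposed_at t J as) = m (relabel (flip J) p) as"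
proof -
  have "finite J" using J finite_subset by blast
  then show ?thesis using J p
  proof (induction J arbitrary: p)
    case empty
    have "transposed_at t {} as = as" by (simp add: transposed_at_def map_nth)
    moreover have "relabel (flip {}) p = p" by (simp add: relabel_def flip_def)
    ultimately show ?case by simp
  next
    case (insert i J)
    then have i: "i < k" by simp
    have "transposed_at t (insert i J) as = (transposed_at t J as)[i := t (transposed_at t J as ! i)]"
      by (rule nth_equalityI) (use insert.hyps as i in \<open>auto simp: nth_list_update\<close>)
    then have "m p (transposed_at t (insert i J) as) = m (relabel (flip {i}) p) (transposed_at t J as)"
      using moment_transpose_one[OF insert.prems(2) _ i] as by simp
    also have "\<dots> = m (relabel (flip J) (relabel (flip {i}) p)) as"
      using insert by (intro insert.IH relabel_in_A bij_betw_flip) simp_all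
    also have "relabel (flip J) (relabel (flip {i}) p) = relabel (flip (insert i J)) p"
      using relabel_flip_flip(1)[OF in_all_parts[OF insert.prems(2)], of J "{i}"] insert.hyps by simp
    finally show ?case .
  qed
qed

lemma obtain_transposed_at:
  assumes "set xs \<subseteq> F \<union> t ` F"
  obtains as J where "set as \<subseteq> F" "J \<subseteq> {..<length as}" "xs = transposed_at t J as"
proof -
  have "\<exists>as J. set as \<subseteq> F \<and> J \<subseteq> {..<length as} \<and> xs = transposed_at t J as"
    using assms
  proof (induction xs rule: rev_induct)
    case (snoc x xs)
    then obtain as J where as: "set as \<subseteq> F" "J \<subseteq> {..<length as}" "xs = transposed_at t J as" by auto
    have "x \<in> F \<or> (\<exists>a\<in>F. x = t a)" using snoc.prems by auto
    then show ?case
    proof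
      assume "x \<in> F"
      moreover have "xs @ [x] = transposed_at t J (as @ [x])"
        using as by (intro nth_equalityI) (auto simp: nth_append less_Suc_eq)
      ultimately show ?case using as by (intro exI[of _ "as @ [x]"] exI[of _ J]) auto
    next
      assume "\<exists>a\<in>F. x = t a"
      then obtain a where a: "a \<in> F" "x = t a" by blast
      then have "xs @ [x] = transposed_at t (insert (length as) J) (as @ [a])"
        using as by (intro nth_equalityI) (auto simp: nth_append less_Suc_eq)
      then show ?case using as a by (intro exI[of _ "as @ [a]"] exI[of _ "insert (length as) J"]) auto
    qed
  qed (simp add: transposed_at_def)
  then show ?thesis using that by blast
qed

text \<open>Determinism is assumed for the algebra generated by \<open>F\<close>, which need not contain the transposes
  of its elements. It extends to transposed letters because exchanging points inside columns
  commutes with putting partitions side by side.\<close>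
lemma moment_tensor:
  assumes p: "p1 \<in> \<A> k1" "p2 \<in> \<A> k2" "part_tensor k1 p1 p2 \<in> \<A> (k1 + k2)"
    and xs: "set xs \<subseteq> F \<union> t ` F" "length xs = k1" and ys: "set ys \<subseteq> F \<union> t ` F" "length ys = k2"
  shows "m (part_tensor k1 p1 p2) (xs @ ys) = m p1 xs * m p2 ys"
proof -
  obtain as J where as: "set as \<subseteq> F" "J \<subseteq> {..<length as}" "xs = transposed_at t J as"
    using obtain_transposed_at[OF xs(1)] .
  obtain bs K where bs: "set bs \<subseteq> F" "K \<subseteq> {..<length bs}" "ys = transposed_at t K bs"
    using obtain_transposed_at[OF ys(1)] .
  have len: "length as = k1" "length bs = k2" using as bs xs ys by simp_all
  define JK where "JK = J \<union> (+) k1 ` K"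
  have JK: "i \<in> JK \<longleftrightarrow> i \<in> J" "k1 + j \<in> JK \<longleftrightarrow> j \<in> K" if "i < k1" for i j
    using as(2) that len by (auto simp: JK_def)
  have J2: "k1 + j \<in> JK \<longleftrightarrow> j \<in> K" for j
    using as(2) len by (auto simp: JK_def)
  have "xs @ ys = transposed_at t JK (as @ bs)"
  proof (rule nth_equalityI)
    fix i assume "i < length (xs @ ys)"
    then show "(xs @ ys) ! i = transposed_at t JK (as @ bs) ! i"
      using JK(1)[of i] J2[of "i - k1"] len as(3) bs(3) by (auto simp: nth_append)
  qed (simp add: as bs)
  moreover have "JK \<subseteq> {..<k1 + k2}" using as(2) bs(2) len by (auto simp: JK_def)
  ultimately have "m (part_tensor k1 p1 p2) (xs @ ys) = m (relabel (flip JK) (part_tensor k1 p1 p2)) (as @ bs)"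
    using moment_transposed_at[OF p(3), of "as @ bs" JK] len by simp
  also have "relabel (flip JK) (part_tensor k1 p1 p2) =
      part_tensor k1 (relabel (flip J) p1) (relabel (flip K) p2)"
  proof -
    have "relabel (flip JK) p1 = relabel (flip J) p1"
      by (rule relabel_cong[OF in_all_parts[OF p(1)]]) (auto simp: points_def flip_simps JK(1))
    moreover have "flip JK \<circ> (\<lambda>(r, i). (r, k1 + i)) = (\<lambda>(r, i). (r, k1 + i)) \<circ> flip K"
      by (rule ext) (auto simp: flip_simps J2)
    then have "relabel (flip JK) (relabel (\<lambda>(r, i). (r, k1 + i)) p2) =
        relabel (\<lambda>(r, i). (r, k1 + i)) (relabel (flip K) p2)" by (simp add: relabel_relabel)
    ultimately show ?thesis by (simp add: part_tensor_def relabel_def image_Un)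
  qed
  also have "m \<dots> (as @ bs) = m (relabel (flip J) p1) as * m (relabel (flip K) p2) bs"
  proof -
    have "relabel (flip J) p1 \<in> \<A> k1" "relabel (flip K) p2 \<in> \<A> k2"
      using relabel_in_A bij_betw_flip p by blast+
    moreover have "set (as @ bs) \<subseteq> generated_algebra scale F"
      using as(1) bs(1) generated_algebra.base[of _ F scale] by auto
    ultimately show ?thesis using det len unfolding deterministic_def by blast
  qed
  also have "\<dots> = m p1 xs * m p2 ys"
    using moment_transposed_at[OF p(1) len(1), of J] moment_transposed_at[OF p(2) len(2), of K] as bs len
    by simp
  finally show ?thesis .
qed

text \<open>The empty word has moment 1, as it stands for the unit of the unitization.\<close>
definition word_moment :: "'a list \<Rightarrow> complex" where
  "word_moment w = (if w = [] then 1 else m (id_part 1) [word_prod w])"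

lemma word_moment_eq:
  "word_moment w = m (perm_part (length w) (cycle_of_list [0..<length w])) w"
proof (cases "w = []")
  case True
  then show ?thesis using m_empty by (simp add: word_moment_def perm_part_def)
next
  case False
  let ?n = "length w"
  have id1: "id_part 1 \<in> \<A> 1" unfolding id_part_def by (rule perm_part_in_A) (rule permutes_id)
  have "m (id_part 1) (map word_prod [w]) =
      m (part_comp (part_ins ?n (map (word_start [?n]) [0..<1]) (id_part 1)) (perm_part ?n (word_cycles [?n])))
        (concat [w])"
    by (rule product[OF id1]) (use False in simp_all)
  moreover have "part_ins ?n (map (word_start [?n]) [0..<1]) (id_part 1) = perm_part ?n id"
    using False by (auto simp: part_ins_def word_start_def id_part_def perm_part_def relabel_def lessThan_Suc)
  moreover have "word_cycles [?n] = cycle_of_list [0..<?n]"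
    by (simp add: word_cycles_def word_start_def)
  moreover have "cycle_of_list [0..<?n] permutes {..<?n}"
    using cycle_permutes[of "[0..<?n]"] by (simp add: atLeast0LessThan)
  ultimately show ?thesis using False part_comp_perm_part[OF permutes_id, of "cycle_of_list [0..<?n]" ?n]
    by (simp add: word_moment_def)
qed

text \<open>Here the cycles run through consecutive places. The general case \<open>moment_cycles\<close> is reduced to this
  one by conjugating with the permutation that lists the cycles one after the other.\<close>
lemma prod_word_moments:
  assumes "\<And>w. w \<in> set ws \<Longrightarrow> set w \<subseteq> F \<union> t ` F"
  shows "\<exists>cs. map length cs = map length ws \<and> concat cs = [0..<length (concat ws)] \<and>
    m (perm_part (length (concat ws)) (cycles cs)) (concat ws) = prod_list (map word_moment ws)"
  using assms
proof (induction ws)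
  case Nil
  then show ?case using m_empty by (intro exI[of _ "[]"]) (simp add: perm_part_def)
next
  case (Cons w ws)
  let ?k1 = "length w" and ?k2 = "length (concat ws)"
  obtain cs where cs: "map length cs = map length ws" "concat cs = [0..<?k2]"
    "m (perm_part ?k2 (cycles cs)) (concat ws) = prod_list (map word_moment ws)"
    using Cons by auto
  let ?ds = "map (map ((+) ?k1)) cs" and ?c = "cycle_of_list [0..<?k1]"
  have concat_ds: "concat ?ds = [?k1..<?k1 + ?k2]"
  proof -
    have "concat ?ds = map ((+) ?k1) [0..<?k2]" unfolding cs(2)[symmetric] by (simp add: map_concat)
    also have "\<dots> = [?k1..<?k1 + ?k2]" by (rule nth_equalityI) simp_all
    finally show ?thesis .
  qed
  have c: "?c permutes {..<?k1}" using cycle_permutes[of "[0..<?k1]"] by (simp add: atLeast0LessThan)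
  have cyc: "cycles cs permutes {..<?k2}"
    using cycles_permutes[of cs] unfolding cs(2) by (simp add: atLeast0LessThan)
  have all: "concat ([0..<?k1] # ?ds) = [0..<?k1 + ?k2]"
    using concat_ds by (simp flip: upt_add_eq_append[of 0, simplified])
  have cyc_all: "cycles ([0..<?k1] # ?ds) permutes {..<?k1 + ?k2}"
    using cycles_permutes[of "[0..<?k1] # ?ds"] unfolding all by (simp add: atLeast0LessThan)
  have tensor: "part_tensor ?k1 (perm_part ?k1 ?c) (perm_part ?k2 (cycles cs)) =
      perm_part (?k1 + ?k2) (cycles ([0..<?k1] # ?ds))"
  proof (rule part_tensor_perm_parts)
    show "cycles ([0..<?k1] # ?ds) i = ?c i" if "i < ?k1" for i
    proof -
      have "i \<notin> set (concat ?ds)" unfolding concat_ds using that by simp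
      then show ?thesis using permutes_not_in[OF cycles_permutes, of i ?ds] by simp
    qed
    show "cycles ([0..<?k1] # ?ds) (?k1 + i) = ?k1 + cycles cs i" for i
      using cycles_map[of "(+) ?k1" cs i] by (simp add: id_outside_supp)
  qed
  have "m (perm_part (?k1 + ?k2) (cycles ([0..<?k1] # ?ds))) (w @ concat ws) =
      m (perm_part ?k1 ?c) w * m (perm_part ?k2 (cycles cs)) (concat ws)"
    unfolding tensor[symmetric]
  proof (rule moment_tensor)
    show "part_tensor ?k1 (perm_part ?k1 ?c) (perm_part ?k2 (cycles cs)) \<in> \<A> (?k1 + ?k2)"
      unfolding tensor by (rule perm_part_in_A[OF cyc_all])
    show "perm_part ?k1 ?c \<in> \<A> ?k1" by (rule perm_part_in_A[OF c])
    show "perm_part ?k2 (cycles cs) \<in> \<A> ?k2" by (rule perm_part_in_A[OF cyc])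
  qed (use Cons.prems in auto)
  then show ?case using cs all
    by (intro exI[of _ "[0..<?k1] # ?ds"]) (simp add: word_moment_eq[of w] comp_def)
qed

lemma moment_cycles:
  assumes cs: "distinct (concat cs)" "set (concat cs) = {..<length xs}" and xs: "set xs \<subseteq> F \<union> t ` F"
  shows "m (perm_part (length xs) (cycles cs)) xs = prod_list (map (\<lambda>c. word_moment (map ((!) xs) c)) cs)"
proof -
  let ?N = "length xs" and ?l = "concat cs" and ?ws = "map (map ((!) xs)) cs"
  have len: "length ?l = ?N" using distinct_card[OF cs(1)] cs(2) by simp
  have concat_ws: "concat ?ws = map ((!) xs) ?l" by (simp add: map_concat)
  have "set w \<subseteq> F \<union> t ` F" if w: "w \<in> set ?ws" for w
  proof -
    obtain c where c: "c \<in> set cs" "w = map ((!) xs) c" using w by auto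
    then have "set c \<subseteq> {..<?N}" using cs(2) by auto
    then have "(!) xs ` set c \<subseteq> set xs" by (auto intro!: nth_mem)
    then show ?thesis using c xs by auto
  qed
  then obtain ds where ds: "map length ds = map length ?ws" "concat ds = [0..<?N]"
    "m (perm_part ?N (cycles ds)) (map ((!) xs) ?l) = prod_list (map word_moment ?ws)"
    using prod_word_moments[of ?ws] unfolding concat_ws by (auto simp: len)
  \<comment> \<open>Conjugation by \<open>\<sigma>\<close> carries the consecutive cycles \<open>ds\<close> to \<open>cs\<close>.\<close>
  define \<sigma> where "\<sigma> j = (if j < ?N then ?l ! j else j)" for j
  have \<sigma>: "\<sigma> permutes {..<?N}"
  proof (rule bij_imp_permutes)
    have "bij_betw ((!) ?l) {..<?N} {..<?N}" using bij_betw_nth[OF cs(1), of "{..<?N}"] len cs(2) by simp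
    then show "bij_betw \<sigma> {..<?N} {..<?N}" by (rule bij_betw_cong[THEN iffD1, rotated]) (simp add: \<sigma>_def)
  qed (simp add: \<sigma>_def)
  have ds_cs: "map (map \<sigma>) ds = cs"
  proof (rule concat_injective)
    have "concat (map (map \<sigma>) ds) = map \<sigma> (concat ds)" by (simp add: map_concat)
    also have "\<dots> = map ((!) ?l) [0..<length ?l]" unfolding ds(2) len by (simp add: \<sigma>_def)
    finally show "concat (map (map \<sigma>) ds) = concat cs" by (simp add: map_nth)
    have lens: "map length ds = map length cs" using ds(1) by (simp add: comp_def)
    then show "length (map (map \<sigma>) ds) = length cs" using map_eq_imp_length_eq by fastforce
    then show "\<forall>(x, y)\<in>set (zip (map (map \<sigma>) ds) cs). length x = length y"
      using lens by (auto simp: set_zip list_eq_iff_nth_eq)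
  qed
  have cyc_ds: "cycles ds permutes {..<?N}"
    using cycles_permutes[of ds] unfolding ds(2) by (simp add: atLeast0LessThan)
  have conj: "\<sigma> \<circ> (cycles ds \<circ> inv \<sigma>) = cycles cs"
  proof
    fix x
    show "(\<sigma> \<circ> (cycles ds \<circ> inv \<sigma>)) x = cycles cs x"
      using cycles_map[OF permutes_inj[OF \<sigma>], of ds "inv \<sigma> x"] permutes_inverses(1)[OF \<sigma>, of x]
      unfolding ds_cs by simp
  qed
  have "m (perm_part ?N (cycles ds)) (map ((!) xs) ?l) =
      m (part_comp (perm_part ?N \<sigma>) (part_comp (perm_part ?N (cycles ds)) (perm_part ?N (inv \<sigma>))))
        (map (\<lambda>i. map ((!) xs) ?l ! inv \<sigma> i) [0..<?N])"
    by (rule equivariant[OF perm_part_in_A[OF cyc_ds] \<sigma>]) (simp add: len)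
  also have "part_comp (perm_part ?N \<sigma>) (part_comp (perm_part ?N (cycles ds)) (perm_part ?N (inv \<sigma>))) =
      perm_part ?N (cycles cs)"
    using part_comp_perm_part[OF cyc_ds permutes_inv[OF \<sigma>]]
      part_comp_perm_part[OF \<sigma> permutes_compose[OF permutes_inv[OF \<sigma>] cyc_ds]] conj by simp
  also have "map (\<lambda>i. map ((!) xs) ?l ! inv \<sigma> i) [0..<?N] = xs"
  proof (rule nth_equalityI)
    fix i assume "i < length (map (\<lambda>i. map ((!) xs) ?l ! inv \<sigma> i) [0..<?N])"
    then have i: "i < ?N" by simp
    then have inv: "inv \<sigma> i < ?N" using permutes_in_image[OF permutes_inv[OF \<sigma>], of i] by simp
    moreover have "?l ! inv \<sigma> i = \<sigma> (inv \<sigma> i)" using inv by (simp add: \<sigma>_def)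
    ultimately show "map (\<lambda>i. map ((!) xs) ?l ! inv \<sigma> i) [0..<?N] ! i = xs ! i"
      using i len permutes_inverses(1)[OF \<sigma>, of i] by simp
  qed simp
  finally show ?thesis using ds(3) by (simp add: comp_def)
qed

end

section \<open>Centred words\<close>

lemma inj_on_insert_Pow: "j \<notin> S \<Longrightarrow> inj_on (insert j) (Pow S)"
proof (rule inj_onI)
  fix x y assume "j \<notin> S" "x \<in> Pow S" "y \<in> Pow S" "insert j x = insert j y"
  then have "insert j x - {j} = insert j y - {j}" "j \<notin> x" "j \<notin> y" by auto
  then show "x = y" by simp
qed

lemma word_prod_append: "u \<noteq> [] \<Longrightarrow> v \<noteq> [] \<Longrightarrow> word_prod (u @ v) = word_prod u * word_prod v"
proof (induction u rule: word_prod.induct)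
  case (1 a)
  then show ?case by (cases v) simp_all
qed (simp_all add: mult.assoc)

text \<open>The following takes place in the unitization \<open>\<complex> \<oplus> A\<close>; \<open>unit_word w\<close> is the product of \<open>w\<close> there.\<close>
definition unit_word :: "'a::ring list \<Rightarrow> complex \<times> 'a" where
  "unit_word w = (if w = [] then (1, 0) else (0, word_prod w))"

definition centred :: "('a::ring \<Rightarrow> complex) \<Rightarrow> 'a \<Rightarrow> complex \<times> 'a" where
  "centred \<phi> a = (- \<phi> a, a)"

context complex_algebra
begin

abbreviation umult (infixl "\<star>" 70) where
  "umult \<equiv> unitization_mult scale"

lemma scale_simps:
  "scale c (x + y) = scale c x + scale c y" "scale c (scale d x) = scale (c * d) x"
  "scale (c + d) x = scale c x + scale d x"
  by (simp_all add: scale_right_distrib scale_left_distrib)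

lemma umult_assoc: "(x \<star> y) \<star> z = x \<star> (y \<star> z)"
  by (simp add: unitization_mult_def scale_simps algebra_simps
      scale_mult_left[symmetric] scale_mult_right[symmetric])

lemma umult_one: "(1, 0) \<star> x = x" "x \<star> (1, 0) = x"
  by (simp_all add: unitization_mult_def)

lemma foldr_umult: "foldr (\<star>) (us @ vs) (1, 0) = foldr (\<star>) us (1, 0) \<star> foldr (\<star>) vs (1, 0)"
  by (induction us) (simp_all add: umult_one umult_assoc)

lemma generated_algebra_span:
  assumes "a \<in> generated_algebra scale F"
  shows "a \<in> span {word_prod w |w. w \<noteq> [] \<and> set w \<subseteq> F}"
  using assms
proof induction
  case (base a)
  then have "a \<in> {word_prod w |w. w \<noteq> [] \<and> set w \<subseteq> F}"
    by (intro CollectI exI[of _ "[a]"]) simp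
  then show ?case by (rule span_base)
next
  case zero
  show ?case by (rule span_zero)
next
  case (add a b)
  then show ?case by (simp add: span_add)
next
  case (scale a c)
  then show ?case by (simp add: span_scale)
next
  case (mult a b)
  let ?S = "{word_prod w |w. w \<noteq> [] \<and> set w \<subseteq> F}"
  have word: "word_prod w * b \<in> span ?S" if w: "w \<noteq> []" "set w \<subseteq> F" for w
    using mult.IH(2)
  proof (induction rule: span_induct_alt)
    case base
    show ?case by (simp add: span_zero)
  next
    case (step c x y)
    then obtain v where v: "v \<noteq> []" "set v \<subseteq> F" "x = word_prod v" by blast
    have "word_prod w * x \<in> span ?S" using v w
      by (intro span_base CollectI exI[of _ "w @ v"]) (simp add: word_prod_append)
    then show ?case using step by (simp add: distrib_left span_add span_scale flip: scale_mult_right)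
  qed
  show ?case
    using mult.IH(1)
  proof (induction rule: span_induct_alt)
    case base
    show ?case by (simp add: span_zero)
  next
    case (step c x y)
    then have "x * b \<in> span ?S" using word by blast
    then show ?case using step by (simp add: distrib_right span_add span_scale flip: scale_mult_left)
  qed
qed

lemma generated_algebra_vanish:
  fixes L :: "'a \<Rightarrow> complex"
  assumes "a \<in> generated_algebra scale F"
    and L: "\<And>x y. L (x + y) = L x + L y" "\<And>c x. L (scale c x) = c * L x"
    and words: "\<And>w. w \<noteq> [] \<Longrightarrow> set w \<subseteq> F \<Longrightarrow> L (word_prod w) = 0"
  shows "L a = 0"
  using generated_algebra_span[OF assms(1)]
proof (induction rule: span_induct_alt)
  case base
  show ?case using L(2)[of 0 0] by simp
next
  case (step c x y)
  then show ?case using L words by auto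
qed

context
  fixes \<phi> :: "'a \<Rightarrow> complex"
  assumes \<phi>_add: "\<phi> (x + y) = \<phi> x + \<phi> y" and \<phi>_scale: "\<phi> (scale c x) = c * \<phi> x"
begin

lemma \<phi>_minus: "\<phi> (- x) = - \<phi> x" "\<phi> (x - y) = \<phi> x - \<phi> y"
  using \<phi>_scale[of "- 1"] \<phi>_add[of x "- y"] by simp_all

lemma form_centred_linear:
  defines "L \<equiv> \<lambda>x a y. unitization_form \<phi> (x \<star> (centred \<phi> a \<star> y))"
  shows "L x (a + b) y = L x a y + L x b y" "L x (scale c a) y = c * L x a y"
  by (simp_all add: L_def unitization_form_def unitization_mult_def centred_def \<phi>_add \<phi>_minus \<phi>_scale
      scale_simps algebra_simps scale_mult_left[symmetric] scale_mult_right[symmetric])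

lemma form_centred_word:
  assumes "w \<noteq> []"
  shows "unitization_form \<phi> (unit_word u \<star> (centred \<phi> (word_prod w) \<star> y)) =
    unitization_form \<phi> (unit_word (u @ w) \<star> y) - \<phi> (word_prod w) * unitization_form \<phi> (unit_word u \<star> y)"
proof -
  obtain d b where y: "y = (d, b)" by (cases y)
  show ?thesis
    using assms
    by (cases "u = []") (simp_all add: y unit_word_def unitization_form_def unitization_mult_def centred_def
        word_prod_append \<phi>_add \<phi>_minus \<phi>_scale scale_simps algebra_simps
        scale_mult_left[symmetric] scale_mult_right[symmetric])
qed

text \<open>The prefix \<open>u\<close> collects the words chosen so far, so that the induction can go through the factors
  from left to right.\<close>
lemma form_centred_words:
  assumes "\<And>i. i < n \<Longrightarrow> W i \<noteq> []" "j \<le> n"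
  shows "unitization_form \<phi> (unit_word u \<star> foldr (\<star>) (map (\<lambda>i. centred \<phi> (word_prod (W i))) [j..<n]) (1, 0)) =
    (\<Sum>I\<in>Pow {j..<n}. (\<Prod>i\<in>{j..<n} - I. - \<phi> (word_prod (W i))) *
      unitization_form \<phi> (unit_word (u @ concat (map W (filter (\<lambda>i. i \<in> I) [j..<n])))))"
  using assms(2)
proof (induction "n - j" arbitrary: j u)
  case 0
  then show ?case by (simp add: umult_one)
next
  case (Suc k)
  then have j: "j < n" by simp
  then have upt: "[j..<n] = j # [Suc j..<n]" by (rule upt_conv_Cons)
  have set: "{j..<n} = insert j {Suc j..<n}" using j by auto
  let ?R = "foldr (\<star>) (map (\<lambda>i. centred \<phi> (word_prod (W i))) [Suc j..<n]) (1, 0)"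
  let ?c = "\<lambda>j I. \<Prod>i\<in>{j..<n} - I. - \<phi> (word_prod (W i))"
  let ?g = "\<lambda>u j I. unitization_form \<phi> (unit_word (u @ concat (map W (filter (\<lambda>i. i \<in> I) [j..<n]))))"
  have IH: "unitization_form \<phi> (unit_word v \<star> ?R) = (\<Sum>I\<in>Pow {Suc j..<n}. ?c (Suc j) I * ?g v (Suc j) I)" for v
    using Suc.hyps(1)[of "Suc j" v] Suc.hyps(2) j by simp
  have out: "?c j I * ?g u j I = - \<phi> (word_prod (W j)) * (?c (Suc j) I * ?g u (Suc j) I)"
    if I: "I \<in> Pow {Suc j..<n}" for I
  proof -
    have "j \<notin> I" using I by auto
    then have "{j..<n} - I = insert j ({Suc j..<n} - I)" using set by auto
    then show ?thesis using \<open>j \<notin> I\<close> unfolding upt by simp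
  qed
  have into: "?c j (insert j I) * ?g u j (insert j I) = ?c (Suc j) I * ?g (u @ W j) (Suc j) I"
    if I: "I \<in> Pow {Suc j..<n}" for I
  proof -
    have "{j..<n} - insert j I = {Suc j..<n} - I" using set by auto
    moreover have "filter (\<lambda>i. i \<in> insert j I) [Suc j..<n] = filter (\<lambda>i. i \<in> I) [Suc j..<n]"
      by (rule filter_cong) auto
    ultimately show ?thesis unfolding upt by simp
  qed
  have inj: "inj_on (insert j) (Pow {Suc j..<n})" by (rule inj_on_insert_Pow) simp
  have "Pow {j..<n} = Pow {Suc j..<n} \<union> insert j ` Pow {Suc j..<n}" unfolding set by (rule Pow_insert)
  moreover have "Pow {Suc j..<n} \<inter> insert j ` Pow {Suc j..<n} = {}" by auto
  ultimately have "(\<Sum>I\<in>Pow {j..<n}. ?c j I * ?g u j I) =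
      (\<Sum>I\<in>Pow {Suc j..<n}. ?c j I * ?g u j I) + (\<Sum>I\<in>insert j ` Pow {Suc j..<n}. ?c j I * ?g u j I)"
    by (simp add: sum.union_disjoint)
  also have "(\<Sum>I\<in>insert j ` Pow {Suc j..<n}. ?c j I * ?g u j I) =
      (\<Sum>I\<in>Pow {Suc j..<n}. ?c (Suc j) I * ?g (u @ W j) (Suc j) I)"
    unfolding sum.reindex[OF inj] comp_def by (rule sum.cong[OF refl into])
  also have "(\<Sum>I\<in>Pow {Suc j..<n}. ?c j I * ?g u j I) =
      - \<phi> (word_prod (W j)) * (\<Sum>I\<in>Pow {Suc j..<n}. ?c (Suc j) I * ?g u (Suc j) I)"
    unfolding sum_distrib_left by (rule sum.cong[OF refl out])
  finally show ?case using form_centred_word[OF assms(1)[OF j], of u ?R] IH upt by simp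
qed

end

end

section \<open>Vanishing of centred products\<close>

text \<open>Either all terms are zero, or adding the block \<open>i\<close> given by \<open>geodesic_toggle\<close> changes only the
  sign of a term.\<close>
lemma (in coloured_blocks) alternating_sum_zero:
  assumes s: "pairing_on s (points N)" "\<And>x. x \<in> points N \<Longrightarrow> fst (s x) \<noteq> fst x"
  shows "(\<Sum>I\<in>Pow {..<n}. if geodesic s I then \<Prod>i\<in>{..<n} - I. - 1 else 0 :: complex) = 0"
proof (rule geodesic_toggle[OF s])
  assume "\<And>I. I \<subseteq> {..<n} \<Longrightarrow> \<not> geodesic s I"
  then show ?thesis by (intro sum.neutral) auto
next
  fix i assume i: "i < n"
    and toggle: "\<And>I. I \<subseteq> {..<n} \<Longrightarrow> i \<notin> I \<Longrightarrow> geodesic s (insert i I) \<longleftrightarrow> geodesic s I"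
  define X where "X = {..<n} - {i}"
  let ?f = "\<lambda>I. if geodesic s I then \<Prod>i\<in>{..<n} - I. - 1 else 0 :: complex"
  have nX: "{..<n} = insert i X" using i by (auto simp: X_def)
  have cancel: "?f (insert i I) = - ?f I" if I: "I \<in> Pow X" for I
  proof -
    have I': "I \<subseteq> {..<n}" "i \<notin> I" using I by (auto simp: X_def)
    then have eq: "{..<n} - I = insert i ({..<n} - insert i I)" using i by auto
    have "(\<Prod>i\<in>{..<n} - I. - 1 :: complex) = - (\<Prod>i\<in>{..<n} - insert i I. - 1)"
      by (subst eq) (simp del: Diff_insert)
    then show ?thesis using toggle[OF I'] by simp
  qed
  have inj: "inj_on (insert i) (Pow X)" by (rule inj_on_insert_Pow) (simp add: X_def)
  have "Pow {..<n} = Pow X \<union> insert i ` Pow X" unfolding nX by (rule Pow_insert)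
  moreover have "Pow X \<inter> insert i ` Pow X = {}" by (auto simp: X_def)
  moreover have "finite X" by (simp add: X_def)
  ultimately have "(\<Sum>I\<in>Pow {..<n}. ?f I) = (\<Sum>I\<in>Pow X. ?f I) + (\<Sum>I\<in>insert i ` Pow X. ?f I)"
    by (simp add: sum.union_disjoint)
  also have "(\<Sum>I\<in>insert i ` Pow X. ?f I) = (\<Sum>I\<in>Pow X. - ?f I)"
    unfolding sum.reindex[OF inj] comp_def by (rule sum.cong[OF refl cancel])
  finally show ?thesis by (simp add: sum_negf)
qed

context transposed_algebra
begin

lemma first_moment_linear:
  "m (id_part 1) [x + y] = m (id_part 1) [x] + m (id_part 1) [y]"
  "m (id_part 1) [scale c x] = c * m (id_part 1) [x]"
proof -
  have "id_part 1 \<in> \<A> 1" unfolding id_part_def by (rule perm_part_in_A) (rule permutes_id)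
  then have "multilinear_form scale 1 (m (id_part 1))" by (rule multilinear)
  then have "Vector_Spaces.linear scale (*) (\<lambda>x. m (id_part 1) ([0][0 := x]))"
    unfolding multilinear_form_def by (elim allE[of _ "[0]"] allE[of _ 0]) simp
  then interpret L: Vector_Spaces.linear scale "(*)" "\<lambda>x. m (id_part 1) [x]" by simp
  show "m (id_part 1) [x + y] = m (id_part 1) [x] + m (id_part 1) [y]"
    "m (id_part 1) [scale c x] = c * m (id_part 1) [x]" by (rule L.add L.scale)+
qed

text \<open>The cumulants enter the proof through this expansion, in which the coefficients \<open>\<kappa> p\<close> are the same
  for every partition \<open>q\<close>.\<close>
lemma U_invariant_moment:
  assumes "U_invariant scale \<A> m F"
  obtains \<kappa> where "\<And>N q as. q \<in> \<A> N \<Longrightarrow> length as = N \<Longrightarrow> set as \<subseteq> F \<Longrightarrow>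
    m q as = (\<Sum>p\<in>perm_parts N. if part_le N p q then \<kappa> p as else 0)"
proof -
  obtain \<kappa>A \<kappa>S where \<kappa>: "cumulants scale \<A> m \<kappa>A"
    "\<And>k p as. p \<in> \<A> k \<Longrightarrow> length as = k \<Longrightarrow> set as \<subseteq> F \<Longrightarrow>
        \<kappa>A p as = (if p \<in> perm_parts k then \<kappa>S p as else 0)"
    using assms unfolding U_invariant_def by blast
  have fin: "finite (\<A> N)" for N
    by (rule finite_subset[OF _ finite_all_parts[of N]]) (auto intro: in_all_parts)
  have perm: "perm_parts N \<subseteq> \<A> N" for N by (auto simp: perm_parts_def intro: perm_part_in_A)
  have "m q as = (\<Sum>p\<in>perm_parts N. if part_le N p q then \<kappa>S p as else 0)"
    if as: "q \<in> \<A> N" "length as = N" "set as \<subseteq> F" for N q as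
  proof -
    have "m q as = (\<Sum>p\<in>{p \<in> \<A> N. part_le N p q}. \<kappa>A p as)"
      using \<kappa>(1) as unfolding cumulants_def by blast
    also have "\<dots> = (\<Sum>p\<in>\<A> N. if part_le N p q then \<kappa>A p as else 0)"
      using fin by (simp add: sum.inter_filter)
    also have "\<dots> = (\<Sum>p\<in>perm_parts N. if part_le N p q then \<kappa>S p as else 0)"
    proof (rule sum.mono_neutral_cong_right[OF fin perm])
      show "\<forall>p\<in>\<A> N - perm_parts N. (if part_le N p q then \<kappa>A p as else 0) = 0"
        using \<kappa>(2)[OF _ as(2,3)] by simp
      show "(if part_le N p q then \<kappa>A p as else 0) = (if part_le N p q then \<kappa>S p as else 0)"
        if "p \<in> perm_parts N" for p
        using \<kappa>(2)[OF subsetD[OF perm that] as(2,3)] that by simp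
    qed
    finally show ?thesis .
  qed
  then show ?thesis by (rule that)
qed

lemma form_unit_word: "unitization_form (\<lambda>a. m (id_part 1) [a]) (unit_word w) = word_moment w"
  using first_moment_linear(2)[of 0 0] by (simp add: unitization_form_def unit_word_def word_moment_def)

text \<open>Each word is a block of columns, and the letters that are transposed give \<open>J\<close>. The letters are
  tagged with the colour of their word, so that \<open>J\<close> can be read off from the concatenation \<open>ls\<close>.\<close>
lemma centred_words_vanish:
  assumes U: "U_invariant scale \<A> m F" and n: "0 < n"
    and w: "\<And>i. i < n \<Longrightarrow> w i \<noteq> [] \<and> set (w i) \<subseteq> F"
    and cl: "\<And>i. cl (Suc i) \<longleftrightarrow> \<not> cl i"
  defines "W \<equiv> \<lambda>i. if cl i then map t (w i) else w i"
  shows "unitization_form (\<lambda>a. m (id_part 1) [a])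
    (foldr (unitization_mult scale) (map (\<lambda>i. centred (\<lambda>a. m (id_part 1) [a]) (word_prod (W i))) [0..<n]) (1, 0)) = 0"
proof -
  let ?\<phi> = "\<lambda>a. m (id_part 1) [a]"
  define ls where "ls = concat (map (\<lambda>i. map (Pair (cl i)) (w i)) [0..<n])"
  define N where "N = length ls"
  define start where "start i = (\<Sum>j<i. length (w j))" for i
  define blk where "blk i = [start i..<start (Suc i)]" for i
  define J where "J = {k. k < N \<and> fst (ls ! k)}"
  define as where "as = map snd ls"
  define xs where "xs = transposed_at t J as"
  have W_ne: "W i \<noteq> []" if "i < n" for i using w[OF that] by (simp add: W_def)
  have concat_k: "concat (map blk [0..<k]) = [0..<start k]" for k
  proof (induction k)
    case (Suc k)
    have "start (Suc k) = start k + length (w k)" by (simp add: start_def)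
    then show ?case using Suc upt_add_eq_append[of 0 "start k" "length (w k)"] by (simp add: blk_def)
  qed (simp add: start_def)
  have N: "N = start n"
    by (simp add: N_def ls_def length_concat comp_def start_def interv_sum_list_conv_sum_set_nat atLeast0LessThan)
  have concat_blk: "concat (map blk [0..<n]) = [0..<N]" using concat_k N by simp
  have len_blk: "length (blk i) = length (w i)" for i by (simp add: blk_def start_def)
  have "map (map ((!) ls)) (map blk [0..<n]) = map (\<lambda>i. map (Pair (cl i)) (w i)) [0..<n]"
  proof (rule concat_injective)
    show "concat (map (map ((!) ls)) (map blk [0..<n])) = concat (map (\<lambda>i. map (Pair (cl i)) (w i)) [0..<n])"
      unfolding ls_def[symmetric] map_concat[symmetric] concat_blk N_def by (rule map_nth)
    show "\<forall>(x, y)\<in>set (zip (map (map ((!) ls)) (map blk [0..<n])) (map (\<lambda>i. map (Pair (cl i)) (w i)) [0..<n])).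
      length x = length y" by (auto simp: set_zip len_blk)
  qed simp
  then have ls_blk: "map ((!) ls) (blk i) = map (Pair (cl i)) (w i)" if "i < n" for i
    using that by (auto simp: list_eq_iff_nth_eq)
  have blk_N: "k < N" if "i < n" "k \<in> set (blk i)" for i k
  proof -
    have "k \<in> set (concat (map blk [0..<n]))" using that by auto
    then show ?thesis unfolding concat_blk by simp
  qed
  have J_blk: "k \<in> J \<longleftrightarrow> cl i" if "i < n" "k \<in> set (blk i)" for i k
  proof -
    have "ls ! k \<in> set (map ((!) ls) (blk i))" using that(2) by simp
    then have "fst (ls ! k) = cl i" unfolding ls_blk[OF that(1)] by auto
    then show ?thesis using blk_N[OF that] by (simp add: J_def)
  qed
  have xs_blk: "map ((!) xs) (blk i) = W i" if i: "i < n" for i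
  proof -
    have "map ((!) xs) (blk i) = map (\<lambda>k. if cl i then t (snd (ls ! k)) else snd (ls ! k)) (blk i)"
      using J_blk[OF i] blk_N[OF i] by (intro map_cong refl) (simp add: xs_def as_def N_def)
    also have "\<dots> = map (\<lambda>x. if cl i then t (snd x) else snd x) (map ((!) ls) (blk i))" by simp
    also have "\<dots> = W i" unfolding ls_blk[OF i] by (simp add: W_def comp_def)
    finally show ?thesis .
  qed
  interpret coloured_blocks blk n N J
  proof
    show "0 < n" by (rule n)
    show "blk i \<noteq> []" if "i < n" for i using w[OF that] len_blk[of i] by auto
    show "concat (map blk [0..<n]) = [0..<N]" by (rule concat_blk)
    show "a \<in> J \<longleftrightarrow> b \<notin> J" if "Suc i < n" "a \<in> set (blk i)" "b \<in> set (blk (Suc i))" for i a b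
      using J_blk[of i a] J_blk[of "Suc i" b] that cl by simp
  qed
  have as: "length as = N" "set as \<subseteq> F"
    using w by (simp add: as_def N_def, force simp: as_def ls_def)
  have xs: "length xs = N" using as by (simp add: xs_def)
  have xs_F: "set xs \<subseteq> F \<union> t ` F"
  proof
    fix x assume "x \<in> set xs"
    then obtain k where k: "k < N" "x = xs ! k" using xs by (auto simp: in_set_conv_nth)
    then have "as ! k \<in> F" using as nth_mem[of k as] by auto
    then show "x \<in> F \<union> t ` F" using k as(1) by (simp add: xs_def)
  qed
  define q where "q I = relabel (flip J) (perm_part N (cycles (ring_lists I)))" for I
  have q: "q I \<in> \<A> N" for I
    unfolding q_def by (intro relabel_in_A perm_part_in_A ring_lists_permutes bij_betw_flip)
  have moment: "word_moment (map ((!) xs) (merged I)) * (\<Prod>i\<in>{..<n} - I. word_moment (W i)) = m (q I) as" for I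
  proof -
    have "m (q I) as = m (perm_part N (cycles (ring_lists I))) xs"
      unfolding q_def xs_def
      by (rule moment_transposed_at[OF perm_part_in_A[OF ring_lists_permutes] as(1), symmetric]) (auto simp: J_def)
    also have "\<dots> = prod_list (map (\<lambda>c. word_moment (map ((!) xs) c)) (ring_lists I))"
      using moment_cycles[OF ring_lists(1)[of I], of xs] ring_lists(2)[of I] xs xs_F by simp
    also have "\<dots> = word_moment (map ((!) xs) (merged I)) *
        prod_list (map (\<lambda>i. word_moment (map ((!) xs) (blk i))) (filter (\<lambda>i. i \<notin> I) [0..<n]))"
      by (simp add: ring_lists_def comp_def)
    also have "prod_list (map (\<lambda>i. word_moment (map ((!) xs) (blk i))) (filter (\<lambda>i. i \<notin> I) [0..<n])) =
        (\<Prod>i\<in>set (filter (\<lambda>i. i \<notin> I) [0..<n]). word_moment (map ((!) xs) (blk i)))"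
      by (rule prod.distinct_set_conv_list[symmetric]) simp
    also have "\<dots> = (\<Prod>i\<in>{..<n} - I. word_moment (W i))"
      by (rule prod.cong) (auto simp: xs_blk)
    finally show ?thesis by simp
  qed
  obtain \<kappa> where \<kappa>: "\<And>N q as. q \<in> \<A> N \<Longrightarrow> length as = N \<Longrightarrow> set as \<subseteq> F \<Longrightarrow>
      m q as = (\<Sum>p\<in>perm_parts N. if part_le N p q then \<kappa> p as else 0)"
    using U_invariant_moment[OF U] by blast
  let ?sg = "\<lambda>I. \<Prod>i\<in>{..<n} - I. - 1 :: complex"
  have summand: "(\<Prod>i\<in>{..<n} - I. - ?\<phi> (word_prod (W i))) *
      unitization_form ?\<phi> (unit_word (concat (map W (filter (\<lambda>i. i \<in> I) [0..<n])))) =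
      (\<Sum>p\<in>perm_parts N. \<kappa> p as * (if part_le N p (q I) then ?sg I else 0))" for I
  proof -
    have "map W (filter (\<lambda>i. i \<in> I) [0..<n]) = map (map ((!) xs)) (map blk (filter (\<lambda>i. i \<in> I) [0..<n]))"
      by (simp add: xs_blk)
    then have merged_W: "concat (map W (filter (\<lambda>i. i \<in> I) [0..<n])) = map ((!) xs) (merged I)"
      by (simp only: merged_def map_concat)
    have "(\<Prod>i\<in>{..<n} - I. - ?\<phi> (word_prod (W i))) = (\<Prod>i\<in>{..<n} - I. - 1 * word_moment (W i))"
      by (rule prod.cong) (auto simp: word_moment_def W_ne)
    also have "\<dots> = ?sg I * (\<Prod>i\<in>{..<n} - I. word_moment (W i))" by (rule prod.distrib)
    finally have "(\<Prod>i\<in>{..<n} - I. - ?\<phi> (word_prod (W i))) *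
        unitization_form ?\<phi> (unit_word (concat (map W (filter (\<lambda>i. i \<in> I) [0..<n])))) = ?sg I * m (q I) as"
      unfolding merged_W form_unit_word moment[symmetric] by (simp only: mult_ac)
    also have "m (q I) as = (\<Sum>p\<in>perm_parts N. if part_le N p (q I) then \<kappa> p as else 0)"
      by (rule \<kappa>[OF q as])
    also have "?sg I * \<dots> = (\<Sum>p\<in>perm_parts N. \<kappa> p as * (if part_le N p (q I) then ?sg I else 0))"
      unfolding sum_distrib_left by (rule sum.cong) auto
    finally show ?thesis .
  qed
  have "unitization_form ?\<phi>
      (unit_word [] \<star> foldr (\<star>) (map (\<lambda>i. centred ?\<phi> (word_prod (W i))) [0..<n]) (1, 0)) =
      (\<Sum>I\<in>Pow {0..<n}. (\<Prod>i\<in>{0..<n} - I. - ?\<phi> (word_prod (W i))) *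
        unitization_form ?\<phi> (unit_word ([] @ concat (map W (filter (\<lambda>i. i \<in> I) [0..<n])))))"
    by (rule form_centred_words[OF first_moment_linear W_ne]) simp_all
  also have "\<dots> = (\<Sum>I\<in>Pow {..<n}. \<Sum>p\<in>perm_parts N. \<kappa> p as * (if part_le N p (q I) then ?sg I else 0))"
    unfolding atLeast0LessThan append_Nil by (rule sum.cong[OF refl summand])
  also have "\<dots> = (\<Sum>p\<in>perm_parts N. \<Sum>I\<in>Pow {..<n}. \<kappa> p as * (if part_le N p (q I) then ?sg I else 0))"
    by (rule sum.swap)
  also have "\<dots> = (\<Sum>p\<in>perm_parts N. \<kappa> p as * (\<Sum>I\<in>Pow {..<n}. if part_le N p (q I) then ?sg I else 0))"
    by (simp only: sum_distrib_left)
  also have "\<dots> = 0"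
  proof (rule sum.neutral, rule ballI)
    fix p assume "p \<in> perm_parts N"
    then obtain \<tau> where \<tau>: "\<tau> permutes {..<N}" "p = perm_part N \<tau>" by (auto simp: perm_parts_def)
    have "(\<Sum>I\<in>Pow {..<n}. if part_le N p (q I) then ?sg I else 0) = 0"
      unfolding \<tau>(2) q_def part_le_iff_geodesic[OF \<tau>(1)]
      by (rule alternating_sum_zero) (rule perm_pairing[OF \<tau>(1)])+
    then show "\<kappa> p as * (\<Sum>I\<in>Pow {..<n}. if part_le N p (q I) then ?sg I else 0) = 0" by simp
  qed
  finally show ?thesis by (simp add: unit_word_def umult_one)
qed

text \<open>The elements \<open>ys ! i\<close> are replaced by words one after the other: the form is linear in each of them,
  and the algebra generated by a set is spanned by its words. The induction is on the number of
  elements that are not yet words.\<close>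
lemma centred_elements_vanish:
  assumes U: "U_invariant scale \<A> m F" and "ys \<noteq> []" and cl: "\<And>i. cl (Suc i) \<longleftrightarrow> \<not> cl i"
    and sub: "A1 \<subseteq> F" "A2 \<subseteq> F"
    and ys: "\<And>i. i < length ys \<Longrightarrow> ys ! i \<in> generated_algebra scale (if cl i then t ` A2 else A1)"
  shows "unitization_form (\<lambda>a. m (id_part 1) [a])
    (foldr (unitization_mult scale) (map (centred (\<lambda>a. m (id_part 1) [a])) ys) (1, 0)) = 0"
proof -
  let ?\<phi> = "\<lambda>a. m (id_part 1) [a]" and ?B = "\<lambda>i. if cl i then t ` A2 else A1"
  let ?form = "\<lambda>ys. unitization_form ?\<phi> (foldr (\<star>) (map (centred ?\<phi>) ys) (1, 0))"
  let ?word = "\<lambda>i x. \<exists>w. w \<noteq> [] \<and> set w \<subseteq> ?B i \<and> x = word_prod w"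
  have "?form ys = 0" if "k \<le> length ys" "ys \<noteq> []" "\<And>i. i < k \<Longrightarrow> ?word i (ys ! i)"
    "\<And>i. k \<le> i \<Longrightarrow> i < length ys \<Longrightarrow> ys ! i \<in> generated_algebra scale (?B i)" for k ys
    using that
  proof (induction "length ys - k" arbitrary: k ys)
    case 0
    let ?n = "length ys"
    have "\<exists>w. w \<noteq> [] \<and> set w \<subseteq> F \<and> ys ! i = word_prod (if cl i then map t w else w)" if i: "i < ?n" for i
    proof -
      obtain v where v: "v \<noteq> []" "set v \<subseteq> ?B i" "ys ! i = word_prod v" using 0 i by auto
      show ?thesis
      proof (cases "cl i")
        case True
        then have "v \<in> lists (t ` A2)" using v(2) by auto
        then have "v \<in> map t ` lists A2" unfolding lists_image .
        then obtain w where w: "v = map t w" "set w \<subseteq> A2" by auto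
        then show ?thesis using v sub(2) True by (intro exI[of _ w]) auto
      next
        case False
        then show ?thesis using v sub(1) by (intro exI[of _ v]) auto
      qed
    qed
    then have "\<forall>i. \<exists>w. i < ?n \<longrightarrow> w \<noteq> [] \<and> set w \<subseteq> F \<and> ys ! i = word_prod (if cl i then map t w else w)"
      by blast
    then obtain w where w: "\<And>i. i < ?n \<Longrightarrow> w i \<noteq> [] \<and> set (w i) \<subseteq> F"
      "\<And>i. i < ?n \<Longrightarrow> ys ! i = word_prod (if cl i then map t (w i) else w i)" by metis
    have "map (centred ?\<phi>) ys = map (\<lambda>i. centred ?\<phi> (word_prod (if cl i then map t (w i) else w i))) [0..<?n]"
      by (rule nth_equalityI) (simp_all add: w(2))
    then show ?case using centred_words_vanish[of ?n w cl, OF U _ w(1) cl] 0(3) by simp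
  next
    case (Suc l)
    then have k: "k < length ys" by simp
    define us vs where "us = take k ys" and "vs = drop (Suc k) ys"
    have form: "?form (ys[k := x]) =
        unitization_form ?\<phi> (foldr (\<star>) (map (centred ?\<phi>) us) (1, 0) \<star>
          (centred ?\<phi> x \<star> foldr (\<star>) (map (centred ?\<phi>) vs) (1, 0)))" for x
      using k foldr_umult[of "map (centred ?\<phi>) us" "map (centred ?\<phi>) (x # vs)"]
      by (simp add: upd_conv_take_nth_drop us_def vs_def)
    have "?form (ys[k := ys ! k]) = 0"
    proof (rule generated_algebra_vanish[where L = "\<lambda>x. ?form (ys[k := x])"])
      show "ys ! k \<in> generated_algebra scale (?B k)" using Suc.prems(4) k by simp
      show "?form (ys[k := x + y]) = ?form (ys[k := x]) + ?form (ys[k := y])" for x y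
        unfolding form by (rule form_centred_linear(1)[OF first_moment_linear])
      show "?form (ys[k := scale c x]) = c * ?form (ys[k := x])" for c x
        unfolding form by (rule form_centred_linear(2)[OF first_moment_linear])
      show "?form (ys[k := word_prod w]) = 0" if w: "w \<noteq> []" "set w \<subseteq> ?B k" for w
      proof (rule Suc.hyps(1)[of "ys[k := word_prod w]" "Suc k"])
        show "?word i (ys[k := word_prod w] ! i)" if "i < Suc k" for i
          using that w k Suc.prems(3)[of i] by (cases "i = k") auto
        show "ys[k := word_prod w] ! i \<in> generated_algebra scale (?B i)"
          if "Suc k \<le> i" "i < length (ys[k := word_prod w])" for i
          using that Suc.prems(4)[of i] by simp
      qed (use Suc.hyps(2) k Suc.prems(2) in auto)
    qed
    then show ?case by simp
  qed
  from this[of 0 ys] show ?thesis using assms by simp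
qed

end

theorem theorem2p9:
  fixes scale :: "complex \<Rightarrow> 'a::ring \<Rightarrow> 'a"
    and \<A> :: "nat \<Rightarrow> part set"
    and m :: "part \<Rightarrow> 'a list \<Rightarrow> complex"
    and t :: "'a \<Rightarrow> 'a"
    and A\<^sub>1 A\<^sub>2 :: "'a set"
  assumes "\<A> \<in> {all_parts, pair_parts, even_parts, short_parts}"
    and "tracial_algebra scale \<A> m"
    and "transpose_operation scale \<A> m t"
    and "U_invariant scale \<A> m (A\<^sub>1 \<union> A\<^sub>2)"
    and "deterministic scale \<A> m (A\<^sub>1 \<union> A\<^sub>2)"
  shows "voiculescu_free scale (\<lambda>a. m (id_part 1) [a]) A\<^sub>1 (t ` A\<^sub>2)"
proof -
  interpret transposed_algebra scale \<A> m t "A\<^sub>1 \<union> A\<^sub>2"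
    using assms by (simp add: transposed_algebra_def transposed_algebra_axioms_def)
  let ?\<phi> = "\<lambda>a. m (id_part 1) [a]"
  let ?G = "\<lambda>B. UNIV \<times> generated_algebra scale B"
  show ?thesis
    unfolding voiculescu_free_def
  proof (intro allI impI, elim conjE)
    fix xs assume xs: "xs \<noteq> []" "alternating (?G A\<^sub>1) (?G (t ` A\<^sub>2)) xs"
      "\<forall>x\<in>set xs. unitization_form ?\<phi> x = 0"
    obtain cl :: "nat \<Rightarrow> bool" where cl: "\<And>i. cl (Suc i) \<longleftrightarrow> \<not> cl i"
      "\<And>i. i < length xs \<Longrightarrow> xs ! i \<in> ?G (if cl i then t ` A\<^sub>2 else A\<^sub>1)"
    proof -
      from xs(2) consider "\<forall>i<length xs. xs ! i \<in> (if even i then ?G A\<^sub>1 else ?G (t ` A\<^sub>2))"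
        | "\<forall>i<length xs. xs ! i \<in> (if even i then ?G (t ` A\<^sub>2) else ?G A\<^sub>1)"
        unfolding alternating_def by blast
      then show thesis
      proof cases
        case 1
        have "xs ! i \<in> ?G (if odd i then t ` A\<^sub>2 else A\<^sub>1)" if "i < length xs" for i
          using 1[rule_format, OF that] by (cases "even i") simp_all
        then show thesis using that[of odd] by simp
      next
        case 2
        have "xs ! i \<in> ?G (if even i then t ` A\<^sub>2 else A\<^sub>1)" if "i < length xs" for i
          using 2[rule_format, OF that] by (cases "even i") simp_all
        then show thesis using that[of even] by simp
      qed
    qed
    have "x = centred ?\<phi> (snd x)" if "x \<in> set xs" for x
      using xs(3) that by (cases x) (auto simp: centred_def unitization_form_def add_eq_0_iff2)
    then have "map (centred ?\<phi>) (map snd xs) = xs" by (simp add: map_idI)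
    moreover have "unitization_form ?\<phi>
        (foldr (unitization_mult scale) (map (centred ?\<phi>) (map snd xs)) (1, 0)) = 0"
    proof (rule centred_elements_vanish[where cl = cl, OF assms(4) _ cl(1)])
      show "map snd xs ! i \<in> generated_algebra scale (if cl i then t ` A\<^sub>2 else A\<^sub>1)"
        if "i < length (map snd xs)" for i
        using cl(2)[of i] that by (simp add: mem_Times_iff)
    qed (use xs(1) in auto)
    ultimately show "unitization_form ?\<phi> (foldr (unitization_mult scale) xs (1, 0)) = 0" by simp
  qed
qed

end
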